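(* Let $s>1$, $\theta=\frac{s+1}{2}$, $c=\frac{\theta^2}{s}$. (I) Let $u_0,v_0:\mathbb{R}\to\mathbb{R}$ be bounded with $v_0\ge 0$, and set $w_0=u_0-v_0^{\theta}$, $z_0=u_0+v_0^{\theta}$. Suppose that $z_0$ and $w_0$ are decreasing and that there are constants $c_1,c_0,c_2$ with $$c_1\le w_0(x)\le c_0\le z_0(x)\le c_2\qquad\text{for all } x\in\mathbb{R}.$$ Then the Cauchy problem $$v_t-u_x=0,\qquad u_t-c(|v|^{s-1}v)_x=0,\qquad (v,u)|_{t=0}=(v_0,u_0)$$ has a global generalized solution $(v,u)$ (in the sense of the context). (II) Let $v_0\ge 0$ be bounded, let $v_1\in L^1(\mathbb{R})$, and suppose that the limits $v_0^{\theta}(\pm\infty):=\lim_{x\to\pm\infty}v_0^{\theta}(x)$ exist. Suppose moreover that $$\int_{-\infty}^{\infty}v_1(x)\,dx+v_0^{\theta}(+\infty)+v_0^{\theta}(-\infty)\ge 0$$ and that, for both choices of sign, $$v_1(x)\pm\theta\, v_0^{\frac{s-1}{2}}(x)\,\partial_xv_0(x)\le 0 .$$ Then the Cauchy problem $$v_{tt}=c(|v|^{s-1}v)_{xx},\qquad (v,v_t)|_{t=0}=(v_0,v_1)$$ has a global generalized solution $v$ (in the sense of the context).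
   Context: The spatial variable is $x\in\mathbb{R}$, time is $t\in\mathbb{R}^+=(0,\infty)$. "Decreasing" means non-increasing. Generalized solution of the system: a pair $(v,u)\in L^\infty(\mathbb{R}\times\mathbb{R}^+)\times L^\infty(\mathbb{R}\times\mathbb{R}^+)$ such that for all $\phi_1,\phi_2\in C_0^\infty(\mathbb{R}\times[0,\infty))$, $$\int_0^\infty\!\!\int_{-\infty}^\infty \big(v\,\partial_t\phi_1-u\,\partial_x\phi_1\big)\,dx\,dt+\int_{-\infty}^\infty v_0(x)\phi_1(x,0)\,dx=0,$$ $$\int_0^\infty\!\!\int_{-\infty}^\infty \big(u\,\partial_t\phi_2-c|v|^{s-1}v\,\partial_x\phi_2\big)\,dx\,dt+\int_{-\infty}^\infty u_0(x)\phi_2(x,0)\,dx=0.$$ Generalized solution of the wave equation: a function $v\in L^\infty(\mathbb{R}\times\mathbb{R}^+)$ such that for all $\phi\in C_0^\infty(\mathbb{R}\times[0,\infty))$, $$\int_0^\infty\!\!\int_{-\infty}^\infty \big(v\,\partial_t^2\phi-c|v|^{s-1}v\,\partial_x^2\phi\big)\,dx\,dt+\int_{-\infty}^\infty \big(v_0(x)\,\partial_t\phi(x,0)-v_1(x)\phi(x,0)\big)\,dx=0.$$ In part (II), $\theta v_0^{\frac{s-1}{2}}\partial_xv_0$ stands for $\partial_x(v_0^{\theta})$ (note $\theta-1=\frac{s-1}{2}$), understood in the sense of distributions, and the inequality is understood accordingly. *)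

theory Defs
  imports "HOL-Analysis.Analysis"
begin

primrec Ck :: "nat \<Rightarrow> ('a::real_normed_vector \<Rightarrow> 'b::real_normed_vector) \<Rightarrow> bool" where
  "Ck 0 f \<longleftrightarrow> continuous_on UNIV f"
| "Ck (Suc n) f \<longleftrightarrow>
     (\<forall>x. f differentiable (at x)) \<and> (\<forall>h. Ck n (\<lambda>x. frechet_derivative f (at x) h))"

definition test_functions :: "('a::real_normed_vector \<Rightarrow> real) set" where
  "test_functions = {\<phi>. (\<forall>n. Ck n \<phi>) \<and> compact (closure {x. \<phi> x \<noteq> 0})}"

definition L_infinity :: "'a measure \<Rightarrow> ('a \<Rightarrow> real) set" where
  "L_infinity M = {f \<in> borel_measurable M. \<exists>C. AE p in M. \<bar>f p\<bar> \<le> C}"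

(* Points of the plane are pairs (x, t). *)

definition half_plane :: "(real \<times> real) measure" where
  "half_plane = lebesgue_on (UNIV \<times> {0<..})"

definition dx :: "(real \<times> real \<Rightarrow> real) \<Rightarrow> real \<times> real \<Rightarrow> real" where
  "dx \<phi> p = deriv (\<lambda>x. \<phi> (x, snd p)) (fst p)"

definition dt :: "(real \<times> real \<Rightarrow> real) \<Rightarrow> real \<times> real \<Rightarrow> real" where
  "dt \<phi> p = deriv (\<lambda>t. \<phi> (fst p, t)) (snd p)"

(* The test functions on R x [0,oo) are the restrictions of the test functions on the whole plane;
   they need not vanish at t = 0, and only their values for t >= 0 enter below. *)

definition generalized_solution_system ::
  "real \<Rightarrow> real \<Rightarrow> (real \<Rightarrow> real) \<Rightarrow> (real \<Rightarrow> real) \<Rightarrow>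
   (real \<times> real \<Rightarrow> real) \<Rightarrow> (real \<times> real \<Rightarrow> real) \<Rightarrow> bool" where
  "generalized_solution_system c s v0 u0 v u \<longleftrightarrow>
     v \<in> L_infinity half_plane \<and> u \<in> L_infinity half_plane \<and>
     (\<forall>\<phi>1\<in>test_functions. \<forall>\<phi>2\<in>test_functions.
        (LINT p|half_plane. v p * dt \<phi>1 p - u p * dx \<phi>1 p)
          + (LINT x|lebesgue. v0 x * \<phi>1 (x, 0)) = 0 \<and>
        (LINT p|half_plane. u p * dt \<phi>2 p - c * \<bar>v p\<bar> powr (s - 1) * v p * dx \<phi>2 p)
          + (LINT x|lebesgue. u0 x * \<phi>2 (x, 0)) = 0)"

definition generalized_solution_wave ::
  "real \<Rightarrow> real \<Rightarrow> (real \<Rightarrow> real) \<Rightarrow> (real \<Rightarrow> real) \<Rightarrow> (real \<times> real \<Rightarrow> real) \<Rightarrow> bool" where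
  "generalized_solution_wave c s v0 v1 v \<longleftrightarrow>
     v \<in> L_infinity half_plane \<and>
     (\<forall>\<phi>\<in>test_functions.
        (LINT p|half_plane. v p * dt (dt \<phi>) p - c * \<bar>v p\<bar> powr (s - 1) * v p * dx (dx \<phi>) p)
          + (LINT x|lebesgue. v0 x * dt \<phi> (x, 0) - v1 x * \<phi> (x, 0)) = 0)"

(* Distributions on the real line, represented by their action on test functions. *)

definition distr_of :: "(real \<Rightarrow> real) \<Rightarrow> (real \<Rightarrow> real) \<Rightarrow> real" where
  "distr_of f \<psi> = (LINT x|lebesgue. f x * \<psi> x)"

definition distr_deriv :: "((real \<Rightarrow> real) \<Rightarrow> real) \<Rightarrow> (real \<Rightarrow> real) \<Rightarrow> real" where
  "distr_deriv T \<psi> = - T (deriv \<psi>)"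

definition distr_nonpos :: "((real \<Rightarrow> real) \<Rightarrow> real) \<Rightarrow> bool" where
  "distr_nonpos T \<longleftrightarrow> (\<forall>\<psi>\<in>test_functions. (\<forall>x. 0 \<le> \<psi> x) \<longrightarrow> T \<psi> \<le> 0)"

end

(*
  In the Riemann invariants z = u + v^theta, w = u - v^theta the system reads z_t = lam z_x, w_t = - lam w_x
  with lam an increasing function of d = (z - w)/2 = v^theta. For decreasing z and w both families are
  rarefactions: an upwind scheme keeps z and w decreasing and never increases the larger of the two slopes,
  and the separation w <= c0 <= z keeps d nonnegative. Starting from Lipschitz data with d bounded away from 0,
  the scheme satisfies the two conservation laws in v and u up to an error of the order of the mesh size.
  Since z also decreases and w increases in time, the approximations are monotone in both variables, so a
  Helly argument in the plane gives almost everywhere convergence of a subsequence, and the weak equations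
  pass to the limit.

  For the wave equation take u0 as the primitive of v1. The sign conditions say that u0 + v0^theta and
  u0 - v0^theta have nonpositive distributional derivatives, hence agree almost everywhere with decreasing
  functions, and the condition on the integral of v1 is w0(-oo) <= z0(+oo). The system with these data,
  tested with phi_t and phi_x, gives the wave equation.
*)
theory Submission
  imports Defs "HOL-Complex_Analysis.Great_Picard" "HOL-Computational_Algebra.Polynomial"
begin


text \<open>Upwinding in z and w is not a conservative scheme for v and u, while the weak equations
  are statements about v and u. The value of c bridges this: with d = (z - w) / 2, v = g(d) and flux
  P(d) of u it gives g' = 1 / lam and P' = lam, so both laws are the chain rule applied to d_t = lam
  u_x and u_t = lam d_x. On the mesh the chain rule costs an error quadratic in the increment over
  one mesh width h. Under a slope bound L this increment is at most L h, and dividing by h leaves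
  O(h); hence the weight put on preserving the slope bound.

  The constants in this O(h) explode at the vacuum d = 0, where the derivative of lam is unbounded,
  and with the slope of the data. So the data are regularized first: z is lifted by 2 / (n + 1),
  slopes are bounded by n + 1, and the mesh is chosen last, depending on n. Compactness rests on
  monotonicity and sup bounds alone, and these are uniform in n.\<close>

abbreviation borel_fun :: "('a::topological_space \<Rightarrow> 'b::topological_space) \<Rightarrow> bool" where
  "borel_fun f \<equiv> f \<in> borel_measurable borel"

subsection \<open>The upwind scheme for the Riemann invariants\<close>

text \<open>\<open>q\<close> is the Courant number as a function of d = (z - w) / 2, which the four
  bounds and \<open>gap\<close> confine to [\<delta>, (zu - wl) / 2]. \<open>q_growth\<close>
  combines two properties: t = 0 gives monotonicity, t = d - e the Lipschitz bound. \<open>M\<close>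
  bounds the drop over one mesh width. The smallness of \<open>K * M\<close> and the bound 1 / 2 on
  \<open>q\<close>, stricter than the usual 1, provide the room that \<open>convex_slack\<close>
  spends.\<close>

locale upwind =
  fixes q :: "real \<Rightarrow> real" and \<delta> zl zu wl wu h M K :: real
  assumes h_pos: "0 < h" and M_nonneg: "0 \<le> M"
    and gap: "2 * \<delta> \<le> zl - wu"
    and q_bounds: "\<And>d. \<delta> \<le> d \<Longrightarrow> d \<le> (zu - wl) / 2 \<Longrightarrow> 0 \<le> q d \<and> q d \<le> 1 / 2"
    and q_growth: "\<And>d e t. \<delta> \<le> d \<Longrightarrow> \<delta> \<le> e \<Longrightarrow> 0 \<le> t \<Longrightarrow> d - e \<le> t \<Longrightarrow> q d - q e \<le> K * t"
    and K_small: "0 \<le> K" "K * M \<le> 1 / 2"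
begin

text \<open>One \<open>M\<close> serves both functions because the drop of w enters the slope
  estimate for z through the gap, and conversely. Drops are taken over the exact distance
  \<open>h\<close>, the only distance at which the scheme couples points.\<close>

definition admissible :: "(real \<Rightarrow> real) \<times> (real \<Rightarrow> real) \<Rightarrow> bool" where
  "admissible Y \<longleftrightarrow> (case Y of (z, w) \<Rightarrow> antimono z \<and> antimono w \<and>
     (\<forall>x. zl \<le> z x \<and> z x \<le> zu \<and> wl \<le> w x \<and> w x \<le> wu \<and>
          z x - z (x + h) \<le> M \<and> w x - w (x + h) \<le> M))"

definition gap_of :: "(real \<Rightarrow> real) \<times> (real \<Rightarrow> real) \<Rightarrow> real \<Rightarrow> real" where
  "gap_of Y x = (fst Y x - snd Y x) / 2"

text \<open>Explicit upwind scheme for \<open>z\<^sub>t = lam z\<^sub>x\<close>, \<open>w\<^sub>t = - lam w\<^sub>x\<close> with time step \<open>k\<close>, where \<open>q = lam k / h\<close>;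
  the space variable is not discretized.\<close>

definition step :: "(real \<Rightarrow> real) \<times> (real \<Rightarrow> real) \<Rightarrow> (real \<Rightarrow> real) \<times> (real \<Rightarrow> real)" where
  "step Y = (\<lambda>x. fst Y x - q (gap_of Y x) * (fst Y x - fst Y (x + h)),
             \<lambda>x. snd Y x + q (gap_of Y x) * (snd Y (x - h) - snd Y x))"

lemma admissible_slope:
  assumes "admissible Y"
  shows "fst Y x - fst Y (x + h) \<le> M" "snd Y x - snd Y (x + h) \<le> M" "snd Y (x - h) - snd Y x \<le> M"
  using assms by (auto simp: admissible_def split: prod.splits dest: spec[of _ "x - h"])

lemma gap_of_bounds:
  assumes "admissible Y"
  shows "\<delta> \<le> gap_of Y x" "gap_of Y x \<le> (zu - wl) / 2"
proof -
  obtain z w where Y: "Y = (z, w)" by force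
  have "zl \<le> z x" "z x \<le> zu" "wl \<le> w x" "w x \<le> wu" using assms by (auto simp: admissible_def Y)
  thus "\<delta> \<le> gap_of Y x" "gap_of Y x \<le> (zu - wl) / 2" using gap by (auto simp: gap_of_def Y)
qed

lemma weight_bounds:
  assumes "admissible Y"
  shows "0 \<le> q (gap_of Y x)" "q (gap_of Y x) \<le> 1 / 2"
  using q_bounds gap_of_bounds[OF assms] by auto

lemma weight_growth:
  assumes "admissible Y" "0 \<le> t" "gap_of Y x - gap_of Y y \<le> t"
  shows "q (gap_of Y x) - q (gap_of Y y) \<le> K * t"
  using q_growth gap_of_bounds[OF assms(1)] assms by auto

lemma step_decreasing_fst:
  assumes "admissible Y" shows "fst (step Y) x \<le> fst Y x"
proof -
  have "antimono (fst Y)" using assms by (auto simp: admissible_def)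
  hence "fst Y (x + h) \<le> fst Y x" using h_pos by (auto simp: antimono_def)
  thus ?thesis using weight_bounds[OF assms] by (simp add: step_def)
qed

lemma step_increasing_snd:
  assumes "admissible Y" shows "snd Y x \<le> snd (step Y) x"
proof -
  have "antimono (snd Y)" using assms by (auto simp: admissible_def)
  hence "snd Y x \<le> snd Y (x - h)" using h_pos by (auto simp: antimono_def)
  thus ?thesis using weight_bounds[OF assms] by (simp add: step_def)
qed

lemma upwind_le:
  fixes a b c p :: real
  assumes "0 \<le> p" "p \<le> 1 / 2" "b \<le> a"
  shows "b \<le> a - p * (a - b)" "b + p * (a - b) \<le> a"
proof -
  have "p * (a - b) \<le> 1 * (a - b)" using assms by (intro mult_right_mono) auto
  thus "b \<le> a - p * (a - b)" "b + p * (a - b) \<le> a" by auto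
qed

lemma step_fst_ge:
  assumes "admissible Y" shows "fst Y (x + h) \<le> fst (step Y) x"
proof -
  have "antimono (fst Y)" using assms by (auto simp: admissible_def)
  hence "fst Y (x + h) \<le> fst Y x" using h_pos by (auto simp: antimono_def)
  thus ?thesis using upwind_le[OF weight_bounds[OF assms]] by (simp add: step_def)
qed

lemma step_snd_le:
  assumes "admissible Y" shows "snd (step Y) x \<le> snd Y (x - h)"
proof -
  have "antimono (snd Y)" using assms by (auto simp: admissible_def)
  hence "snd Y x \<le> snd Y (x - h)" using h_pos by (auto simp: antimono_def)
  thus ?thesis using upwind_le[OF weight_bounds[OF assms]] by (simp add: step_def)
qed

text \<open>The characteristic speeds spread out a decreasing profile, so the weight of the steeper
  neighbour can exceed the own weight only by a multiple of the slack in the bound to be shown.\<close>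

lemma convex_slack:
  fixes a b p e t :: real
  assumes "0 \<le> p" "p \<le> 1 / 2" "0 \<le> t" "e \<le> K * (t / 2)" "0 \<le> b" "b \<le> M"
  shows "p * t + e * b \<le> t"
proof -
  have "e * b \<le> K * (t / 2) * b" using assms by (intro mult_right_mono)
  also have "\<dots> = (K * b) * (t / 2)" by simp
  also have "\<dots> \<le> (1 / 2) * (t / 2)"
  proof (rule mult_right_mono)
    have "K * b \<le> K * M" using assms K_small by (intro mult_left_mono) auto
    thus "K * b \<le> 1 / 2" using K_small by simp
  qed (use assms in simp)
  finally have "e * b \<le> t / 4" by simp
  moreover have "p * t \<le> (1 / 2) * t" using assms by (intro mult_right_mono)
  ultimately show ?thesis using assms by simp
qed

text \<open>Points further apart than \<open>h\<close> are separated by the old value at x + h. For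
  closer points the decrease of w helps: the gap at x exceeds the gap at y by at most half the drop
  of z between them, so the excess of the weight at x is paid for by that drop.\<close>

lemma step_antimono_fst:
  assumes adm: "admissible Y" shows "antimono (fst (step Y))"
proof (rule antimonoI)
  fix x y :: real assume xy: "x \<le> y"
  define z where "z = fst Y"
  have z: "antimono z" and M: "z x - z (x + h) \<le> M" and w: "antimono (snd Y)"
    using adm by (auto simp: admissible_def z_def)
  show "fst (step Y) y \<le> fst (step Y) x"
  proof (cases "y \<le> x + h")
    case False
    hence "z y \<le> z (x + h)" using z by (auto simp: antimono_def)
    thus ?thesis using step_fst_ge[OF adm, of x] step_decreasing_fst[OF adm, of y] by (simp add: z_def)
  next
    case True
    define p q' where "p = q (gap_of Y x)" and "q' = q (gap_of Y y)"
    have ord: "z y \<le> z x" "z (x + h) \<le> z y" "z (y + h) \<le> z (x + h)"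
      using z xy True by (auto simp: antimono_def)
    have w': "snd Y y \<le> snd Y x" using w xy by (auto simp: antimono_def)
    have "p - q' \<le> K * ((z x - z y) / 2)" unfolding p_def q'_def
      using ord w' by (intro weight_growth[OF adm]) (auto simp: gap_of_def z_def field_simps)
    \<comment> \<open>The drop over [x, x + h] is split at y. The part up to y is the slack; the
      rest is also contained in the drop over [y, y + h], so only the difference of the two weights
      counts there.\<close>
    hence "p * (z x - z y) + (p - q') * (z y - z (x + h)) \<le> z x - z y"
      using ord M weight_bounds[OF adm] by (intro convex_slack) (auto simp: p_def)
    moreover have "q' * (z y - z (x + h)) \<le> q' * (z y - z (y + h))"
      using ord weight_bounds[OF adm] by (intro mult_left_mono) (auto simp: q'_def)
    moreover have "fst (step Y) x = z x - p * (z x - z (x + h))"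
        "fst (step Y) y = z y - q' * (z y - z (y + h))"
      by (auto simp: step_def p_def q'_def z_def)
    ultimately show ?thesis by (simp add: algebra_simps)
  qed
qed

text \<open>Mirror image of the argument for z: w travels to the right, so now the weight at y must
  not exceed the weight at x by too much, and the decrease of z supplies this.\<close>

lemma step_antimono_snd:
  assumes adm: "admissible Y" shows "antimono (snd (step Y))"
proof (rule antimonoI)
  fix x y :: real assume xy: "x \<le> y"
  define w where "w = snd Y"
  have w: "antimono w" and M: "w (x - h) - w x \<le> M" and z: "antimono (fst Y)"
    using adm admissible_slope[OF adm] by (auto simp: admissible_def w_def)
  show "snd (step Y) y \<le> snd (step Y) x"
  proof (cases "y \<le> x + h")
    case False
    hence "w (y - h) \<le> w x" using w by (auto simp: antimono_def)
    thus ?thesis using step_snd_le[OF adm, of y] step_increasing_snd[OF adm, of x] by (simp add: w_def)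
  next
    case True
    define p q' where "p = q (gap_of Y x)" and "q' = q (gap_of Y y)"
    have ord: "w y \<le> w x" "w x \<le> w (y - h)" "w (y - h) \<le> w (x - h)"
      using w xy True by (auto simp: antimono_def)
    have z': "fst Y y \<le> fst Y x" using z xy by (auto simp: antimono_def)
    have "q' - p \<le> K * ((w x - w y) / 2)" unfolding p_def q'_def
      using ord z' by (intro weight_growth[OF adm]) (auto simp: gap_of_def w_def field_simps)
    hence "q' * (w x - w y) + (q' - p) * (w (y - h) - w x) \<le> w x - w y"
      using ord M weight_bounds[OF adm] by (intro convex_slack) (auto simp: q'_def)
    moreover have "p * (w (y - h) - w x) \<le> p * (w (x - h) - w x)"
      using ord weight_bounds[OF adm] by (intro mult_left_mono) (auto simp: p_def)
    moreover have "snd (step Y) x = w x + p * (w (x - h) - w x)"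
        "snd (step Y) y = w y + q' * (w (y - h) - w y)"
      by (auto simp: step_def p_def q'_def w_def)
    ultimately show ?thesis by (simp add: algebra_simps)
  qed
qed

text \<open>The new drop is (1 - p) a + q' a'. It could exceed \<open>M\<close> only through q' > p,
  but the gap grows from x to x + h by (b - a) / 2 \<le> (M - a) / 2. So the excess of the weight is
  controlled by M - a, the distance of the old drop from the bound.\<close>

lemma step_slope_fst:
  assumes adm: "admissible Y" shows "fst (step Y) x - fst (step Y) (x + h) \<le> M"
proof -
  define z where "z = fst Y"
  define w where "w = snd Y"
  define p q' where "p = q (gap_of Y x)" and "q' = q (gap_of Y (x + h))"
  define a a' b where "a = z x - z (x + h)" and "a' = z (x + h) - z (x + h + h)" and "b = w x - w (x + h)"
  have "antimono z" using adm by (auto simp: admissible_def z_def)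
  hence a0: "0 \<le> a" using h_pos by (auto simp: antimono_def a_def)
  have aM: "a \<le> M" "a' \<le> M" "b \<le> M"
    unfolding a_def a'_def b_def z_def w_def by (rule admissible_slope[OF adm])+
  have "q' - p \<le> K * ((M - a) / 2)" unfolding p_def q'_def
    using aM by (intro weight_growth[OF adm]) (auto simp: gap_of_def z_def w_def a_def b_def field_simps)
  hence "q' * (M - a) + (q' - p) * a \<le> M - a"
    using a0 aM weight_bounds[OF adm] by (intro convex_slack) (auto simp: q'_def)
  moreover have "q' * a' \<le> q' * M"
    using aM weight_bounds[OF adm] by (intro mult_left_mono) (auto simp: q'_def)
  moreover have "fst (step Y) x - fst (step Y) (x + h) = a - p * a + q' * a'"
    by (simp add: step_def p_def q'_def z_def a_def a'_def algebra_simps)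
  ultimately show ?thesis by (simp add: algebra_simps)
qed

lemma step_slope_snd:
  assumes adm: "admissible Y" shows "snd (step Y) x - snd (step Y) (x + h) \<le> M"
proof -
  define z where "z = fst Y"
  define w where "w = snd Y"
  define p q' where "p = q (gap_of Y x)" and "q' = q (gap_of Y (x + h))"
  define a b b' where "a = z x - z (x + h)" and "b = w x - w (x + h)" and "b' = w (x - h) - w x"
  have "antimono w" using adm by (auto simp: admissible_def w_def)
  hence b0: "0 \<le> b" using h_pos by (auto simp: antimono_def b_def)
  have aM: "a \<le> M" "b \<le> M"
    unfolding a_def b_def z_def w_def by (rule admissible_slope[OF adm])+
  have b'M: "b' \<le> M"
    unfolding b'_def w_def by (rule admissible_slope[OF adm])
  have "p - q' \<le> K * ((M - b) / 2)" unfolding p_def q'_def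
    using aM by (intro weight_growth[OF adm]) (auto simp: gap_of_def z_def w_def a_def b_def field_simps)
  hence "p * (M - b) + (p - q') * b \<le> M - b"
    using b0 aM weight_bounds[OF adm] by (intro convex_slack) (auto simp: p_def)
  moreover have "p * b' \<le> p * M"
    using b'M weight_bounds[OF adm] by (intro mult_left_mono) (auto simp: p_def)
  moreover have "snd (step Y) x - snd (step Y) (x + h) = b + p * b' - q' * b"
    by (simp add: step_def p_def q'_def w_def b_def b'_def algebra_simps)
  ultimately show ?thesis by (simp add: algebra_simps)
qed

lemma admissible_step:
  assumes adm: "admissible Y" shows "admissible (step Y)"
proof -
  have b: "zl \<le> fst Y x" "fst Y x \<le> zu" "wl \<le> snd Y x" "snd Y x \<le> wu" for x
    using adm by (auto simp: admissible_def)
  have "zl \<le> fst (step Y) x" "fst (step Y) x \<le> zu" "wl \<le> snd (step Y) x" "snd (step Y) x \<le> wu" for x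
    using b[of x] b[of "x + h"] b[of "x - h"] step_fst_ge[OF adm, of x] step_decreasing_fst[OF adm, of x]
      step_snd_le[OF adm, of x] step_increasing_snd[OF adm, of x] by auto
  thus ?thesis
    using step_antimono_fst[OF adm] step_antimono_snd[OF adm] step_slope_fst[OF adm] step_slope_snd[OF adm]
    by (auto simp: admissible_def case_prod_beta)
qed

lemma admissible_iterate: "admissible Y \<Longrightarrow> admissible ((step ^^ n) Y)"
  by (induction n) (auto intro: admissible_step)

end


section \<open>Consistency of the scheme with the two conservation laws\<close>

lemma measurable_antimono:
  fixes f :: "real \<Rightarrow> real"
  assumes "antimono f" shows "borel_fun f"
proof -
  have "mono (\<lambda>x. - f x)" using assms by (auto simp: mono_def antimono_def)
  hence "borel_fun (\<lambda>x. - f x)" by (rule borel_measurable_mono)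
  thus ?thesis by simp
qed

text \<open>The slope \<open>m\<close> need not be a derivative at a point of the segment. The
  estimate for u takes it at a point outside in general, and \<open>staggered_flux_u\<close> takes m
  = 0.\<close>

lemma increment_linear_bound:
  fixes f f' :: "real \<Rightarrow> real"
  assumes "\<And>\<xi>. \<xi> \<in> closed_segment x y \<Longrightarrow> (f has_real_derivative f' \<xi>) (at \<xi>)"
    and "\<And>\<xi>. \<xi> \<in> closed_segment x y \<Longrightarrow> \<bar>f' \<xi> - m\<bar> \<le> B"
  shows "\<bar>f y - f x - m * (y - x)\<bar> \<le> B * \<bar>y - x\<bar>"
proof -
  have "norm ((\<lambda>\<xi>. f \<xi> - m * \<xi>) y - (\<lambda>\<xi>. f \<xi> - m * \<xi>) x) \<le> B * norm (y - x)"
    by (rule field_differentiable_bound[where f' = "\<lambda>\<xi>. f' \<xi> - m" and S = "closed_segment x y"])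
       (auto intro!: derivative_eq_intros DERIV_subset[OF assms(1)] assms(2))
  thus ?thesis by (simp add: algebra_simps)
qed

text \<open>\<open>g\<close> and \<open>P\<close> stand for v and for the flux of u as functions of
  d, and \<open>r\<close> is the ratio of time step to mesh width. The reciprocal derivatives of
  \<open>g\<close> and \<open>P\<close> are the link between the Riemann invariants and the
  conservation laws.\<close>

locale upwind_flux = upwind +
  fixes lam g P :: "real \<Rightarrow> real" and r \<Lambda> \<Gamma> \<Theta> :: real
  assumes r_pos: "0 < r" and q_eq: "q = (\<lambda>d. r * lam d)"
    and \<delta>_pos: "0 < \<delta>"
    and g_deriv: "\<And>d. \<delta> \<le> d \<Longrightarrow> (g has_real_derivative 1 / lam d) (at d)"
    and P_deriv: "\<And>d. \<delta> \<le> d \<Longrightarrow> (P has_real_derivative lam d) (at d)"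
    and lam_pos: "\<And>d. \<delta> \<le> d \<Longrightarrow> 0 < lam d"
    and lam_le: "\<And>d. \<delta> \<le> d \<Longrightarrow> d \<le> (zu - wl) / 2 \<Longrightarrow> lam d \<le> \<Theta>"
    and lam_lip: "\<And>d e. \<delta> \<le> d \<Longrightarrow> \<delta> \<le> e \<Longrightarrow> \<bar>lam d - lam e\<bar> \<le> \<Lambda> * \<bar>d - e\<bar>"
    and inv_lam_lip: "\<And>d e. \<delta> \<le> d \<Longrightarrow> \<delta> \<le> e \<Longrightarrow> \<bar>1 / lam d - 1 / lam e\<bar> \<le> \<Gamma> * \<bar>d - e\<bar>"
    and lip_nonneg: "0 \<le> \<Lambda>" "0 \<le> \<Gamma>"
begin

text \<open>The step looks to the right for z and to the left for w. Pairing z at x with w at x - h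
  makes the difference of the pair between x and x + h consist of exactly the two differences that
  the step at x uses.\<close>

definition staggered :: "(real \<Rightarrow> real) \<times> (real \<Rightarrow> real) \<Rightarrow> real \<Rightarrow> real" where
  "staggered Y x = (fst Y x - snd Y (x - h)) / 2"

lemma slopes:
  assumes "admissible Y"
  shows "0 \<le> fst Y x - fst Y (x + h)" "fst Y x - fst Y (x + h) \<le> M"
    "0 \<le> snd Y (x - h) - snd Y x" "snd Y (x - h) - snd Y x \<le> M"
  using assms admissible_slope[OF assms] h_pos by (auto simp: admissible_def antimono_def split: prod.splits)

lemma staggered_bounds:
  assumes "admissible Y"
  shows "\<delta> \<le> staggered Y x" "staggered Y x \<le> (zu - wl) / 2"
proof -
  have "zl \<le> fst Y x" "fst Y x \<le> zu" "wl \<le> snd Y (x - h)" "snd Y (x - h) \<le> wu"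
    using assms by (auto simp: admissible_def)
  thus "\<delta> \<le> staggered Y x" "staggered Y x \<le> (zu - wl) / 2" using gap by (auto simp: staggered_def)
qed

text \<open>The linearization of \<open>g\<close> at the old gap turns the increment - lam r (a + b)
  / 2 into - r (a + b) / 2, which is an exact flux difference of the staggered average. What remains
  is the second-order error of \<open>g\<close>, with |d' - d| \<le> M / 2.\<close>

lemma step_residual_v:
  assumes adm: "admissible Y"
  defines "F \<equiv> \<lambda>x. (fst Y x + snd Y (x - h)) / 2"
  shows "\<bar>(g (gap_of (step Y) x) - g (gap_of Y x)) / (r * h) - (F (x + h) - F x) / h\<bar>
           \<le> \<Gamma> * M\<^sup>2 / (4 * (r * h))"
proof -
  define d d' where "d = gap_of Y x" and "d' = gap_of (step Y) x"
  define a b where "a = fst Y x - fst Y (x + h)" and "b = snd Y (x - h) - snd Y x"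
  have ab: "0 \<le> a" "a \<le> M" "0 \<le> b" "b \<le> M" using slopes[OF adm, of x] by (auto simp: a_def b_def)
  have d: "\<delta> \<le> d" and d': "\<delta> \<le> d'"
    using gap_of_bounds adm admissible_step[OF adm] by (auto simp: d_def d'_def)
  have diff: "d' - d = - (q d * (a + b) / 2)"
    by (simp add: d_def d'_def gap_of_def[of "step Y"] step_def a_def b_def)
       (simp add: gap_of_def algebra_simps add_divide_distrib diff_divide_distrib)
  have seg: "\<delta> \<le> \<xi>" "\<bar>\<xi> - d\<bar> \<le> \<bar>d' - d\<bar>" if "\<xi> \<in> closed_segment d d'" for \<xi>
    using that d d' by (auto simp: closed_segment_eq_real_ivl split: if_splits)
  have "q d * (a + b) \<le> 1 / 2 * (2 * M)"
    using ab weight_bounds[OF adm, of x] by (intro mult_mono) (auto simp: d_def)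
  moreover have "0 \<le> q d * (a + b)" using ab weight_bounds[OF adm, of x] by (auto simp: d_def)
  ultimately have dM: "\<bar>d' - d\<bar> \<le> M / 2" by (simp add: diff)
  have "\<bar>g d' - g d - 1 / lam d * (d' - d)\<bar> \<le> (\<Gamma> * \<bar>d' - d\<bar>) * \<bar>d' - d\<bar>"
  proof (rule increment_linear_bound[where f' = "\<lambda>\<xi>. 1 / lam \<xi>"])
    fix \<xi> assume \<xi>: "\<xi> \<in> closed_segment d d'"
    show "(g has_real_derivative 1 / lam \<xi>) (at \<xi>)" using seg[OF \<xi>] by (intro g_deriv)
    have "\<bar>1 / lam \<xi> - 1 / lam d\<bar> \<le> \<Gamma> * \<bar>\<xi> - d\<bar>" using seg[OF \<xi>] d by (intro inv_lam_lip)
    also have "\<dots> \<le> \<Gamma> * \<bar>d' - d\<bar>" using seg[OF \<xi>] lip_nonneg by (intro mult_left_mono) auto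
    finally show "\<bar>1 / lam \<xi> - 1 / lam d\<bar> \<le> \<Gamma> * \<bar>d' - d\<bar>" .
  qed
  also have "\<dots> \<le> (\<Gamma> * (M / 2)) * (M / 2)"
    using dM lip_nonneg M_nonneg by (intro mult_mono mult_left_mono) auto
  finally have "\<bar>g d' - g d - 1 / lam d * (d' - d)\<bar> \<le> \<Gamma> * M\<^sup>2 / 4" by (simp add: power2_eq_square)
  moreover have "1 / lam d * (d' - d) = - (r * (a + b) / 2)"
    using lam_pos[OF d] unfolding diff by (simp add: q_eq)
  ultimately have "\<bar>g d' - g d + r * (a + b) / 2\<bar> / (r * h) \<le> (\<Gamma> * M\<^sup>2 / 4) / (r * h)"
    using r_pos h_pos by (intro divide_right_mono) auto
  moreover have "\<bar>g d' - g d + r * (a + b) / 2\<bar> / (r * h) = \<bar>(g d' - g d + r * (a + b) / 2) / (r * h)\<bar>"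
    using r_pos h_pos by (simp add: abs_mult)
  moreover have "(g d' - g d + r * (a + b) / 2) / (r * h) = (g d' - g d) / (r * h) - (F (x + h) - F x) / h"
    using r_pos h_pos by (simp add: F_def a_def b_def field_simps)
  ultimately show ?thesis unfolding d_def d'_def by (simp only: divide_divide_eq_left)
qed

text \<open>Here the update is exactly \<open>q d * (e' - e)\<close> for the staggered gaps e and
  e', so the whole error comes from linearizing \<open>P\<close> at d. The point d lies within M / 2
  of e and of e', though not between them in general.\<close>

lemma step_residual_u:
  assumes adm: "admissible Y"
  shows "\<bar>((fst (step Y) x + snd (step Y) x) / 2 - (fst Y x + snd Y x) / 2) / (r * h)
            - (P (staggered Y (x + h)) - P (staggered Y x)) / h\<bar> \<le> \<Lambda> * M\<^sup>2 / (4 * h)"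
proof -
  define d e e' where "d = gap_of Y x" and "e = staggered Y x" and "e' = staggered Y (x + h)"
  define a b where "a = fst Y x - fst Y (x + h)" and "b = snd Y (x - h) - snd Y x"
  have ab: "0 \<le> a" "a \<le> M" "0 \<le> b" "b \<le> M" using slopes[OF adm, of x] by (auto simp: a_def b_def)
  have d: "\<delta> \<le> d" and e: "\<delta> \<le> e" and e': "\<delta> \<le> e'"
    using gap_of_bounds staggered_bounds adm by (auto simp: d_def e_def e'_def)
  have diff: "e' - e = (b - a) / 2" "e - d = - b / 2" "e' - d = - a / 2"
    by (auto simp: e_def e'_def d_def staggered_def gap_of_def a_def b_def field_simps)
  have seg: "\<delta> \<le> \<xi>" "\<bar>\<xi> - d\<bar> \<le> M / 2" if "\<xi> \<in> closed_segment e e'" for \<xi>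
  proof -
    have m: "min e e' \<le> \<xi>" "\<xi> \<le> max e e'"
      using that by (auto simp: closed_segment_eq_real_ivl split: if_splits)
    show "\<delta> \<le> \<xi>" using m e e' by (auto simp: min_def split: if_splits)
    show "\<bar>\<xi> - d\<bar> \<le> M / 2" using m diff ab by (auto simp: min_def max_def abs_le_iff split: if_splits)
  qed
  have "\<bar>P e' - P e - lam d * (e' - e)\<bar> \<le> (\<Lambda> * (M / 2)) * \<bar>e' - e\<bar>"
  proof (rule increment_linear_bound[where f' = lam])
    fix \<xi> assume \<xi>: "\<xi> \<in> closed_segment e e'"
    show "(P has_real_derivative lam \<xi>) (at \<xi>)" using seg[OF \<xi>] by (intro P_deriv)
    have "\<bar>lam \<xi> - lam d\<bar> \<le> \<Lambda> * \<bar>\<xi> - d\<bar>" using seg[OF \<xi>] d by (intro lam_lip)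
    also have "\<dots> \<le> \<Lambda> * (M / 2)" using seg[OF \<xi>] lip_nonneg by (intro mult_left_mono) auto
    finally show "\<bar>lam \<xi> - lam d\<bar> \<le> \<Lambda> * (M / 2)" .
  qed
  also have "\<dots> \<le> (\<Lambda> * (M / 2)) * (M / 2)"
    using ab lip_nonneg M_nonneg by (intro mult_left_mono) (auto simp: diff(1) abs_le_iff)
  finally have "\<bar>P e' - P e - lam d * (e' - e)\<bar> \<le> \<Lambda> * M\<^sup>2 / 4" by (simp add: power2_eq_square)
  hence "\<bar>P e' - P e - lam d * (e' - e)\<bar> / h \<le> (\<Lambda> * M\<^sup>2 / 4) / h"
    using h_pos by (intro divide_right_mono) auto
  moreover have "\<bar>P e' - P e - lam d * (e' - e)\<bar> / h = \<bar>lam d * (e' - e) / h - (P e' - P e) / h\<bar>"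
  proof -
    have "\<bar>P e' - P e - lam d * (e' - e)\<bar> / h = \<bar>(lam d * (e' - e) - (P e' - P e)) / h\<bar>"
      using h_pos by (simp add: abs_minus_commute)
    thus ?thesis by (simp add: diff_divide_distrib)
  qed
  moreover have "((fst (step Y) x + snd (step Y) x) / 2 - (fst Y x + snd Y x) / 2) / (r * h)
      = lam d * (e' - e) / h"
  proof -
    have "(fst (step Y) x + snd (step Y) x) / 2 - (fst Y x + snd Y x) / 2 = q d * (e' - e)"
      unfolding diff by (simp add: step_def d_def[symmetric] a_def b_def field_simps)
    thus ?thesis using r_pos by (simp add: q_eq)
  qed
  ultimately show ?thesis by (simp add: e_def e'_def)
qed

lemma staggered_flux_v:
  assumes adm: "admissible Y"
  shows "\<bar>(fst Y x + snd Y (x - h)) / 2 - (fst Y x + snd Y x) / 2\<bar> \<le> M"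
proof -
  have "(fst Y x + snd Y (x - h)) / 2 - (fst Y x + snd Y x) / 2 = (snd Y (x - h) - snd Y x) / 2"
    by (simp add: field_simps)
  thus ?thesis using slopes[OF adm, of x] by (simp only:) (simp add: abs_le_iff)
qed

lemma staggered_flux_u:
  assumes adm: "admissible Y"
  shows "\<bar>P (staggered Y x) - P (gap_of Y x)\<bar> \<le> \<Theta> * M"
proof -
  define d e where "d = gap_of Y x" and "e = staggered Y x"
  have b: "\<delta> \<le> d" "d \<le> (zu - wl) / 2" "\<delta> \<le> e" "e \<le> (zu - wl) / 2"
    using gap_of_bounds staggered_bounds adm by (auto simp: d_def e_def)
  have \<Theta>: "0 < \<Theta>" using lam_pos[of d] lam_le[of d] b by simp
  have "\<bar>P e - P d - 0 * (e - d)\<bar> \<le> \<Theta> * \<bar>e - d\<bar>"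
  proof (rule increment_linear_bound[where f' = lam])
    fix \<xi> assume "\<xi> \<in> closed_segment d e"
    hence "\<delta> \<le> \<xi>" "\<xi> \<le> (zu - wl) / 2"
      using b by (auto simp: closed_segment_eq_real_ivl split: if_splits)
    thus "(P has_real_derivative lam \<xi>) (at \<xi>)" "\<bar>lam \<xi> - 0\<bar> \<le> \<Theta>"
      using P_deriv lam_pos[of \<xi>] lam_le[of \<xi>] by auto
  qed
  moreover have "e - d = - (snd Y (x - h) - snd Y x) / 2"
    by (simp add: d_def e_def gap_of_def staggered_def field_simps)
  hence "\<bar>e - d\<bar> \<le> M" using slopes[OF adm, of x] by simp
  hence "\<Theta> * \<bar>e - d\<bar> \<le> \<Theta> * M" using \<Theta> by (intro mult_left_mono) auto
  ultimately show ?thesis by (simp add: d_def e_def)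
qed

text \<open>With the ceiling, the slab \<open>0 < t \<le> k\<close> carries the initial data, and so does \<open>t \<le> 0\<close> because \<open>nat\<close>
  truncates; hence the discrete conservation law needs a cut-off only in the flux term.\<close>

definition level :: "real \<Rightarrow> nat" where "level t = nat (\<lceil>t / (r * h)\<rceil> - 1)"

definition flow :: "(real \<Rightarrow> real) \<times> (real \<Rightarrow> real) \<Rightarrow> real \<Rightarrow> (real \<Rightarrow> real) \<times> (real \<Rightarrow> real)" where
  "flow Y t = (step ^^ level t) Y"

lemma level_nonpos: "t \<le> r * h \<Longrightarrow> level t = 0"
proof -
  assume "t \<le> r * h"
  hence "t / (r * h) \<le> 1" using r_pos h_pos by simp
  thus ?thesis by (simp add: level_def ceiling_le_iff)
qed

lemma level_shift: "0 < t \<Longrightarrow> level (t + r * h) = Suc (level t)"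
proof -
  assume t: "0 < t"
  have "(t + r * h) / (r * h) = t / (r * h) + 1" using r_pos h_pos by (simp add: add_divide_distrib)
  moreover have "0 < \<lceil>t / (r * h)\<rceil>" using t r_pos h_pos by simp
  ultimately show ?thesis by (simp add: level_def nat_diff_distrib)
qed

lemma level_mono: "t \<le> t' \<Longrightarrow> level t \<le> level t'"
  unfolding level_def using r_pos h_pos by (intro nat_mono diff_right_mono ceiling_mono divide_right_mono) auto

lemma flow_shift: "flow Y (t + r * h) = (if 0 < t then step (flow Y t) else flow Y t)"
proof -
  have "0 < r * h" using r_pos h_pos by simp
  thus ?thesis using level_shift[of t] level_nonpos[of t] level_nonpos[of "t + r * h"]
    by (auto simp: flow_def)
qed

lemma flow_initial: "t \<le> 0 \<Longrightarrow> flow Y t = Y"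
proof -
  assume "t \<le> 0"
  moreover have "0 < r * h" using r_pos h_pos by simp
  ultimately show ?thesis using level_nonpos[of t] by (simp add: flow_def)
qed

lemma admissible_flow: "admissible Y \<Longrightarrow> admissible (flow Y t)"
  by (simp add: flow_def admissible_iterate)

lemma flow_antimono_fst:
  assumes adm: "admissible Y" and xt: "x \<le> x'" "t \<le> t'"
  shows "fst (flow Y t') x' \<le> fst (flow Y t) x"
proof -
  have "decseq (\<lambda>n. fst ((step ^^ n) Y) x')"
    by (rule decseq_SucI) (simp add: step_decreasing_fst admissible_iterate adm)
  hence "fst (flow Y t') x' \<le> fst (flow Y t) x'"
    using level_mono[OF xt(2)] by (simp add: flow_def decseq_def)
  also have "\<dots> \<le> fst (flow Y t) x"
    using admissible_flow[OF adm, of t] xt by (auto simp: admissible_def antimono_def split: prod.splits)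
  finally show ?thesis .
qed

lemma flow_monotone_snd:
  assumes adm: "admissible Y" and xt: "x \<le> x'" "t' \<le> t"
  shows "snd (flow Y t') x' \<le> snd (flow Y t) x"
proof -
  have "incseq (\<lambda>n. snd ((step ^^ n) Y) x')"
    by (rule incseq_SucI) (simp add: step_increasing_snd admissible_iterate adm)
  hence "snd (flow Y t') x' \<le> snd (flow Y t) x'"
    using level_mono[OF xt(2)] by (simp add: flow_def incseq_def)
  also have "\<dots> \<le> snd (flow Y t) x"
    using admissible_flow[OF adm, of t] xt by (auto simp: admissible_def antimono_def split: prod.splits)
  finally show ?thesis .
qed

text \<open>There are countably many time levels, and at each of them the flow depends on x alone
  and is monotone.\<close>

lemma measurable_flow:
  assumes adm: "admissible Y"
  shows "borel_fun (\<lambda>p. fst (flow Y (snd p)) (fst p))"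
    "borel_fun (\<lambda>p. snd (flow Y (snd p)) (fst p))"
proof -
  have lev: "(\<lambda>p::real \<times> real. level (snd p)) \<in> measurable borel (count_space UNIV)"
    unfolding level_def by (simp add: borel_prod[symmetric])
  have *: "borel_fun (fst ((step ^^ n) Y))" "borel_fun (snd ((step ^^ n) Y))" for n
    using admissible_iterate[OF adm, of n] measurable_antimono by (auto simp: admissible_def)
  have fst_b: "fst \<in> borel_measurable (borel :: (real \<times> real) measure)"
    by (simp add: borel_prod[symmetric])
  show "borel_fun (\<lambda>p. fst (flow Y (snd p)) (fst p))"
    "borel_fun (\<lambda>p. snd (flow Y (snd p)) (fst p))"
    unfolding flow_def
    by (rule measurable_compose_countable[OF _ lev], rule measurable_compose[OF fst_b *(1)])
       (rule measurable_compose_countable[OF _ lev], rule measurable_compose[OF fst_b *(2)])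
qed

end


text \<open>\<open>G\<close> is the numerical flux of a discrete form of \<open>A\<^sub>t = F\<^sub>x\<close>, in which \<open>A\<close> is stationary for \<open>t \<le> 0\<close>.\<close>

definition consistent ::
  "real \<Rightarrow> real \<Rightarrow> real \<Rightarrow> (real \<times> real \<Rightarrow> real) \<Rightarrow> (real \<times> real \<Rightarrow> real) \<Rightarrow> bool" where
  "consistent \<epsilon> h k A F \<longleftrightarrow> (\<exists>G \<in> borel_measurable borel. \<forall>x t.
     \<bar>G (x, t) - F (x, t)\<bar> \<le> \<epsilon> \<and>
     \<bar>(A (x, t + k) - A (x, t)) / k - (if 0 < t then (G (x + h, t) - G (x, t)) / h else 0)\<bar> \<le> \<epsilon>)"

text \<open>This records just what survives along the approximating sequence: bounds, monotonicity
  in both variables, initial values and consistency. The slope bound and the Lipschitz constants of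
  the speed, which degenerate along it, do not appear.\<close>

definition approximate_flow where
  "approximate_flow \<theta> c s \<epsilon> zl zu wl wu z0 w0 h k Z W \<longleftrightarrow>
     0 < h \<and> h < \<epsilon> \<and> 0 < k \<and> k < \<epsilon> \<and>
     Z \<in> borel_measurable borel \<and> W \<in> borel_measurable borel \<and>
     (\<forall>p. zl \<le> Z p \<and> Z p \<le> zu) \<and> (\<forall>p. wl \<le> W p \<and> W p \<le> wu) \<and>
     (\<forall>x x' t t'. x \<le> x' \<longrightarrow> t \<le> t' \<longrightarrow> Z (x', t') \<le> Z (x, t)) \<and>
     (\<forall>x x' t t'. x \<le> x' \<longrightarrow> t' \<le> t \<longrightarrow> W (x', t') \<le> W (x, t)) \<and>
     (\<forall>x t. t \<le> 0 \<longrightarrow> Z (x, t) = z0 x) \<and> (\<forall>x t. t \<le> 0 \<longrightarrow> W (x, t) = w0 x) \<and>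
     consistent \<epsilon> h k (\<lambda>p. ((Z p - W p) / 2) powr (1 / \<theta>)) (\<lambda>p. (Z p + W p) / 2) \<and>
     consistent \<epsilon> h k (\<lambda>p. (Z p + W p) / 2) (\<lambda>p. c * ((Z p - W p) / 2) powr (s / \<theta>))"

lemma measurable_shift_plane:
  fixes F :: "real \<times> real \<Rightarrow> real"
  assumes "borel_fun F"
  shows "borel_fun (\<lambda>p. F (fst p + a, snd p + b))"
  by (rule measurable_compose[OF _ assms]) (simp add: borel_prod[symmetric])

section \<open>The power-law speed and the choice of the mesh\<close>

context
  fixes s \<theta> c :: real
  assumes s: "s > 1" and \<theta>: "\<theta> = (s + 1) / 2" and c: "c = \<theta>\<^sup>2 / s"
begin

text \<open>All four follow from s = 2 \<theta> - 1. The last identity is what the value of c is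
  made for: it gives c * d powr (s / \<theta>) the derivative lam, the reciprocal of the derivative
  of d powr (1 / \<theta>).\<close>

lemma speed_exponents:
  shows "1 < \<theta>" "s / \<theta> - 1 = (\<theta> - 1) / \<theta>" "1 / \<theta> - 1 = - ((\<theta> - 1) / \<theta>)" "c * (s / \<theta>) = \<theta>"
proof -
  show t: "1 < \<theta>" using s \<theta> by simp
  have s_eq: "s = 2 * \<theta> - 1" using \<theta> by simp
  show "s / \<theta> - 1 = (\<theta> - 1) / \<theta>" "1 / \<theta> - 1 = - ((\<theta> - 1) / \<theta>)"
    using t by (auto simp: s_eq field_simps)
  show "c * (s / \<theta>) = \<theta>" using t s by (simp add: c power2_eq_square)
qed

text \<open>The derivative of \<open>lam\<close> is (\<theta> - 1) d powr (- 1 / \<theta>),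
  unbounded at the vacuum but largest at d = \<delta> on the range considered. For 1 / lam the
  fractions are subtracted and both denominators bounded below by lam \<delta>.\<close>

lemma speed_facts:
  fixes lam :: "real \<Rightarrow> real"
  assumes "0 < \<delta>" and lam_def: "lam = (\<lambda>d. \<theta> * d powr ((\<theta> - 1) / \<theta>))"
  shows "\<delta> \<le> d \<Longrightarrow> ((\<lambda>d. d powr (1 / \<theta>)) has_real_derivative 1 / lam d) (at d)"
    and "\<delta> \<le> d \<Longrightarrow> ((\<lambda>d. c * d powr (s / \<theta>)) has_real_derivative lam d) (at d)"
    and "\<delta> \<le> d \<Longrightarrow> 0 < lam d"
    and "\<delta> \<le> d \<Longrightarrow> d \<le> e \<Longrightarrow> lam d \<le> lam e"
    and "\<exists>\<Lambda>\<ge>0. \<forall>d\<ge>\<delta>. \<forall>e\<ge>\<delta>. \<bar>lam d - lam e\<bar> \<le> \<Lambda> * \<bar>d - e\<bar>"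
    and "\<exists>\<Gamma>\<ge>0. \<forall>d\<ge>\<delta>. \<forall>e\<ge>\<delta>. \<bar>1 / lam d - 1 / lam e\<bar> \<le> \<Gamma> * \<bar>d - e\<bar>"
proof -
  note e = speed_exponents
  have pos: "0 < lam d" if "\<delta> \<le> d" for d using that assms(1) e(1) by (simp add: lam_def)
  show "0 < lam d" if "\<delta> \<le> d" using pos that .
  show mono: "lam d \<le> lam e'" if "\<delta> \<le> d" "d \<le> e'" for d e'
    unfolding lam_def using that assms(1) e(1) by (intro mult_left_mono powr_mono2) auto
  show "((\<lambda>d. d powr (1 / \<theta>)) has_real_derivative 1 / lam d) (at d)" if "\<delta> \<le> d"
  proof -
    have "0 < d" using that assms(1) by simp
    moreover have "1 / \<theta> * d powr (1 / \<theta> - 1) = 1 / lam d"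
      unfolding e(3) lam_def powr_minus using e(1) \<open>0 < d\<close> by (simp add: field_simps)
    ultimately show ?thesis
      using has_real_derivative_powr[of d "1 / \<theta>"] by simp
  qed
  show "((\<lambda>d. c * d powr (s / \<theta>)) has_real_derivative lam d) (at d)" if "\<delta> \<le> d"
  proof -
    have "0 < d" using that assms(1) by simp
    hence "((\<lambda>d. c * d powr (s / \<theta>)) has_real_derivative c * (s / \<theta> * d powr (s / \<theta> - 1))) (at d)"
      by (rule DERIV_cmult[OF has_real_derivative_powr])
    moreover have "c * (s / \<theta> * d powr (s / \<theta> - 1)) = (c * (s / \<theta>)) * d powr (s / \<theta> - 1)"
      by (simp only: mult.assoc)
    hence "c * (s / \<theta> * d powr (s / \<theta> - 1)) = lam d"
      by (simp only: e(2) e(4) lam_def)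
    ultimately show ?thesis by simp
  qed
  define \<Lambda> where "\<Lambda> = (\<theta> - 1) * \<delta> powr (- (1 / \<theta>))"
  have \<Lambda>0: "0 \<le> \<Lambda>" using e(1) by (simp add: \<Lambda>_def)
  have lip: "\<bar>lam d - lam e'\<bar> \<le> \<Lambda> * \<bar>d - e'\<bar>" if "\<delta> \<le> d" "\<delta> \<le> e'" for d e'
  proof -
    have "norm (lam d - lam e') \<le> \<Lambda> * norm (d - e')"
    proof (rule field_differentiable_bound[where S = "{\<delta>..}" and f' = "\<lambda>x. (\<theta> - 1) * x powr (- (1 / \<theta>))"])
      fix x assume x: "x \<in> {\<delta>..}"
      hence x0: "0 < x" using assms(1) by simp
      have ex: "(\<theta> - 1) / \<theta> - 1 = - (1 / \<theta>)" using e(1) by (simp add: field_simps)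
      have "(lam has_real_derivative \<theta> * ((\<theta> - 1) / \<theta> * x powr ((\<theta> - 1) / \<theta> - 1))) (at x)"
        unfolding lam_def by (rule DERIV_cmult[OF has_real_derivative_powr[OF x0]])
      hence "(lam has_real_derivative (\<theta> - 1) * x powr (- (1 / \<theta>))) (at x)"
        using e(1) by (simp add: ex)
      thus "(lam has_real_derivative (\<theta> - 1) * x powr (- (1 / \<theta>))) (at x within {\<delta>..})"
        by (rule DERIV_subset) simp
      have "x powr (- (1 / \<theta>)) \<le> \<delta> powr (- (1 / \<theta>))"
        using x assms(1) e(1) by (intro powr_mono2') auto
      thus "norm ((\<theta> - 1) * x powr (- (1 / \<theta>))) \<le> \<Lambda>"
        using e(1) x0 by (simp add: \<Lambda>_def abs_mult mult_left_mono)
    qed (use that in auto)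
    thus ?thesis by simp
  qed
  show "\<exists>\<Lambda>\<ge>0. \<forall>d\<ge>\<delta>. \<forall>e\<ge>\<delta>. \<bar>lam d - lam e\<bar> \<le> \<Lambda> * \<bar>d - e\<bar>" using lip \<Lambda>0 by blast
  show "\<exists>\<Gamma>\<ge>0. \<forall>d\<ge>\<delta>. \<forall>e\<ge>\<delta>. \<bar>1 / lam d - 1 / lam e\<bar> \<le> \<Gamma> * \<bar>d - e\<bar>"
  proof (intro exI[of _ "\<Lambda> / (lam \<delta> * lam \<delta>)"] conjI allI impI)
    show "0 \<le> \<Lambda> / (lam \<delta> * lam \<delta>)" using \<Lambda>0 by simp
    fix d e' assume de: "\<delta> \<le> d" "\<delta> \<le> e'"
    have "1 / lam d - 1 / lam e' = (lam e' - lam d) / (lam d * lam e')"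
      using pos[OF de(1)] pos[OF de(2)] by (simp add: field_simps)
    hence "\<bar>1 / lam d - 1 / lam e'\<bar> = \<bar>lam d - lam e'\<bar> / (lam d * lam e')"
      using pos[OF de(1)] pos[OF de(2)] by (simp add: abs_mult abs_minus_commute)
    also have "\<dots> \<le> (\<Lambda> * \<bar>d - e'\<bar>) / (lam \<delta> * lam \<delta>)"
      using lip[OF de] pos[of \<delta>] mono[of \<delta> d] mono[of \<delta> e'] de
      by (intro frac_le mult_mono) auto
    finally show "\<bar>1 / lam d - 1 / lam e'\<bar> \<le> \<Lambda> / (lam \<delta> * lam \<delta>) * \<bar>d - e'\<bar>" by simp
  qed
qed

text \<open>Every condition on the mesh has the form B * h < \<epsilon> or B * h < 1, where B
  depends on L, \<delta> and the bounds only. So a single h small against the sum of all these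
  coefficients meets all conditions at once.\<close>

lemma approximate_solution:
  fixes z0 w0 :: "real \<Rightarrow> real" and L \<delta> zl zu wl wu \<epsilon> :: real
  assumes L: "0 < L" and \<delta>: "0 < \<delta>" and \<epsilon>: "0 < \<epsilon>"
    and gap: "2 * \<delta> \<le> zl - wu"
    and z0: "antimono z0" "\<And>x. zl \<le> z0 x \<and> z0 x \<le> zu"
    and w0: "antimono w0" "\<And>x. wl \<le> w0 x \<and> w0 x \<le> wu"
    and slope: "\<And>x a. 0 \<le> a \<Longrightarrow> z0 x - z0 (x + a) \<le> L * a" "\<And>x a. 0 \<le> a \<Longrightarrow> w0 x - w0 (x + a) \<le> L * a"
  shows "\<exists>h k Z W. approximate_flow \<theta> c s \<epsilon> zl zu wl wu z0 w0 h k Z W"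
proof -
  define lam where "lam = (\<lambda>d. \<theta> * d powr ((\<theta> - 1) / \<theta>))"
  define g where "g = (\<lambda>d. d powr (1 / \<theta>))"
  define P where "P = (\<lambda>d. c * d powr (s / \<theta>))"
  note sf = speed_facts[OF \<delta> lam_def]
  obtain \<Lambda> where \<Lambda>: "0 \<le> \<Lambda>" "\<And>d e. \<delta> \<le> d \<Longrightarrow> \<delta> \<le> e \<Longrightarrow> \<bar>lam d - lam e\<bar> \<le> \<Lambda> * \<bar>d - e\<bar>"
    using sf(5) by blast
  obtain \<Gamma> where \<Gamma>: "0 \<le> \<Gamma>" "\<And>d e. \<delta> \<le> d \<Longrightarrow> \<delta> \<le> e \<Longrightarrow> \<bar>1 / lam d - 1 / lam e\<bar> \<le> \<Gamma> * \<bar>d - e\<bar>"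
    using sf(6) by blast
  define D where "D = (zu - wl) / 2"
  define \<Theta> where "\<Theta> = lam D"
  have D: "\<delta> \<le> D" using gap z0(2)[of 0] w0(2)[of 0] by (simp add: D_def)
  have \<Theta>: "0 < \<Theta>" using sf(3)[OF D] by (simp add: \<Theta>_def)
  \<comment> \<open>\<open>D\<close> is the largest possible gap and \<open>lam\<close> is
    increasing, so this ratio makes the Courant number \<open>r * lam d\<close> at most 1 /
    2.\<close>
  define r where "r = 1 / (2 * \<Theta>)"
  have r: "0 < r" using \<Theta> by (simp add: r_def)
  \<comment> \<open>In this order the summands serve: the mesh width h, the time step r h, the
    condition K M \<le> 1 / 2, the residuals of the laws for v and u, and the offsets of the
    staggered fluxes in these two laws.\<close>
  define C where "C = 1 + r + 2 * (r * \<Lambda> * L) + \<Gamma> * L\<^sup>2 / (4 * r) + \<Lambda> * L\<^sup>2 / 4 + L + \<Theta> * L"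
  have C1: "0 \<le> r * \<Lambda> * L" "0 \<le> \<Gamma> * L\<^sup>2 / (4 * r)" "0 \<le> \<Lambda> * L\<^sup>2 / 4" "0 \<le> \<Theta> * L"
    using r \<Lambda>(1) \<Gamma>(1) \<Theta> L by auto
  hence C0: "0 < C" using r L by (simp add: C_def)
  define h where "h = min \<epsilon> 1 / (2 * C)"
  have h: "0 < h" using \<epsilon> C0 by (simp add: h_def)
  have Ch: "C * h < \<epsilon>" "C * h < 1" using \<epsilon> C0 by (auto simp: h_def min_def)
  have small: "B * h < \<epsilon>" "B * h < 1" if "B \<le> C" for B
    using order.strict_trans1[OF mult_right_mono[OF that less_imp_le[OF h]]] Ch by blast+
  define M where "M = L * h"
  interpret upwind_flux "\<lambda>d. r * lam d" \<delta> zl zu wl wu h M "r * \<Lambda>" lam g P r \<Lambda> \<Gamma> \<Theta>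
  proof unfold_locales
    show "0 < h" "0 < r" "0 < \<delta>" "2 * \<delta> \<le> zl - wu" "0 \<le> \<Lambda>" "0 \<le> \<Gamma>"
      using h r \<delta> gap \<Lambda>(1) \<Gamma>(1) by auto
    show "0 \<le> M" using L h by (simp add: M_def)
    show "0 \<le> r * lam d \<and> r * lam d \<le> 1 / 2" if "\<delta> \<le> d" "d \<le> (zu - wl) / 2" for d
    proof -
      have "r * lam d \<le> r * \<Theta>"
        using sf(4)[of d D] that r by (intro mult_left_mono) (auto simp: \<Theta>_def D_def)
      also have "\<dots> = 1 / 2" using \<Theta> by (simp add: r_def)
      finally show ?thesis using sf(3)[OF that(1)] r by simp
    qed
    show "r * lam d - r * lam e \<le> r * \<Lambda> * t"
      if "\<delta> \<le> d" "\<delta> \<le> e" "0 \<le> t" "d - e \<le> t" for d e t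
    proof (cases "d \<le> e")
      case True
      hence "r * lam d \<le> r * lam e" using sf(4)[of d e] that r by simp
      moreover have "0 \<le> r * \<Lambda> * t" using r \<Lambda>(1) that by simp
      ultimately show ?thesis by simp
    next
      case False
      have "lam d - lam e \<le> \<Lambda> * \<bar>d - e\<bar>" using \<Lambda>(2)[OF that(1,2)] by simp
      also have "\<dots> \<le> \<Lambda> * t" using False that \<Lambda>(1) by (intro mult_left_mono) auto
      finally have "r * (lam d - lam e) \<le> r * (\<Lambda> * t)" using r by (intro mult_left_mono) auto
      thus ?thesis by (simp add: algebra_simps)
    qed
    show "0 \<le> r * \<Lambda>" using r \<Lambda>(1) by simp
    have "2 * (r * \<Lambda> * L) * h < 1" by (rule small(2)) (use C1 r L in \<open>simp add: C_def\<close>)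
    thus "r * \<Lambda> * M \<le> 1 / 2" by (simp add: M_def algebra_simps)
    show "(g has_real_derivative 1 / lam d) (at d)" if "\<delta> \<le> d" for d
      using sf(1)[OF that] by (simp add: g_def)
    show "(P has_real_derivative lam d) (at d)" if "\<delta> \<le> d" for d
      using sf(2)[OF that] by (simp add: P_def)
    show "0 < lam d" if "\<delta> \<le> d" for d using sf(3)[OF that] .
    show "lam d \<le> \<Theta>" if "\<delta> \<le> d" "d \<le> (zu - wl) / 2" for d
      using sf(4)[of d D] that by (auto simp: \<Theta>_def D_def)
    show "\<bar>lam d - lam e\<bar> \<le> \<Lambda> * \<bar>d - e\<bar>" "\<bar>1 / lam d - 1 / lam e\<bar> \<le> \<Gamma> * \<bar>d - e\<bar>"
      if "\<delta> \<le> d" "\<delta> \<le> e" for d e using \<Lambda>(2)[OF that] \<Gamma>(2)[OF that] .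
  qed simp
  define Y where "Y = (z0, w0)"
  have adm: "admissible Y"
    unfolding admissible_def Y_def using z0 w0 slope[of h] h by (simp add: M_def)
  define Z where "Z = (\<lambda>p. fst (flow Y (snd p)) (fst p))"
  define W where "W = (\<lambda>p. snd (flow Y (snd p)) (fst p))"
  have meas: "borel_fun Z" "borel_fun W"
    unfolding Z_def W_def by (rule measurable_flow[OF adm])+
  note admt = admissible_flow[OF adm]
  have bounds: "zl \<le> Z p \<and> Z p \<le> zu" "wl \<le> W p \<and> W p \<le> wu" for p
    using admt[of "snd p"] by (auto simp: admissible_def Z_def W_def split: prod.splits)
  define G1 where "G1 = (\<lambda>p. (Z p + W (fst p - h, snd p)) / 2)"
  define G2 where "G2 = (\<lambda>p. P ((Z p - W (fst p - h, snd p)) / 2))"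
  have Wshift: "borel_fun (\<lambda>p. W (fst p - h, snd p))"
    using measurable_shift_plane[OF meas(2), of "- h" 0] by simp
  have measG: "borel_fun G1" "borel_fun G2"
    unfolding G1_def G2_def P_def using meas(1) Wshift by measurable
  have k: "0 < r * h" using r h by simp
  have M\<epsilon>: "M \<le> \<epsilon>" "\<Theta> * M \<le> \<epsilon>"
  proof -
    have "L * h < \<epsilon>" by (rule small(1)) (use C1 r L in \<open>simp add: C_def\<close>)
    thus "M \<le> \<epsilon>" by (simp add: M_def)
    have "(\<Theta> * L) * h < \<epsilon>" by (rule small(1)) (use C1 r L in \<open>simp add: C_def\<close>)
    thus "\<Theta> * M \<le> \<epsilon>" by (simp add: M_def)
  qed
  have R\<epsilon>: "\<Gamma> * M\<^sup>2 / (4 * (r * h)) \<le> \<epsilon>" "\<Lambda> * M\<^sup>2 / (4 * h) \<le> \<epsilon>"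
  proof -
    have "(\<Gamma> * L\<^sup>2 / (4 * r)) * h < \<epsilon>" by (rule small(1)) (use C1 r L in \<open>simp add: C_def\<close>)
    moreover have "\<Gamma> * M\<^sup>2 / (4 * (r * h)) = (\<Gamma> * L\<^sup>2 / (4 * r)) * h"
      using h r by (simp add: M_def power2_eq_square field_simps)
    ultimately show "\<Gamma> * M\<^sup>2 / (4 * (r * h)) \<le> \<epsilon>" by simp
    have "(\<Lambda> * L\<^sup>2 / 4) * h < \<epsilon>" by (rule small(1)) (use C1 r L in \<open>simp add: C_def\<close>)
    moreover have "\<Lambda> * M\<^sup>2 / (4 * h) = (\<Lambda> * L\<^sup>2 / 4) * h"
      using h by (simp add: M_def power2_eq_square field_simps)
    ultimately show "\<Lambda> * M\<^sup>2 / (4 * h) \<le> \<epsilon>" by simp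
  qed
  have con1: "consistent \<epsilon> h (r * h) (\<lambda>p. g ((Z p - W p) / 2)) (\<lambda>p. (Z p + W p) / 2)"
    unfolding consistent_def
  proof (intro bexI[OF _ measG(1)] allI conjI)
    fix x t :: real
    show "\<bar>G1 (x, t) - (Z (x, t) + W (x, t)) / 2\<bar> \<le> \<epsilon>"
      using staggered_flux_v[OF admt, of t x] M\<epsilon> by (simp add: G1_def Z_def W_def)
    show "\<bar>(g ((Z (x, t + r * h) - W (x, t + r * h)) / 2) - g ((Z (x, t) - W (x, t)) / 2)) / (r * h) -
           (if 0 < t then (G1 (x + h, t) - G1 (x, t)) / h else 0)\<bar> \<le> \<epsilon>"
      using step_residual_v[OF admt, of t x] R\<epsilon> \<epsilon>
      by (simp add: G1_def Z_def W_def flow_shift gap_of_def)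
  qed
  have con2: "consistent \<epsilon> h (r * h) (\<lambda>p. (Z p + W p) / 2) (\<lambda>p. P ((Z p - W p) / 2))"
    unfolding consistent_def
  proof (intro bexI[OF _ measG(2)] allI conjI)
    fix x t :: real
    show "\<bar>G2 (x, t) - P ((Z (x, t) - W (x, t)) / 2)\<bar> \<le> \<epsilon>"
      using staggered_flux_u[OF admt, of t x] M\<epsilon> by (simp add: G2_def Z_def W_def staggered_def gap_of_def)
    show "\<bar>((Z (x, t + r * h) + W (x, t + r * h)) / 2 - (Z (x, t) + W (x, t)) / 2) / (r * h) -
           (if 0 < t then (G2 (x + h, t) - G2 (x, t)) / h else 0)\<bar> \<le> \<epsilon>"
      using step_residual_u[OF admt, of t x] R\<epsilon> \<epsilon>
      by (simp add: G2_def Z_def W_def flow_shift staggered_def)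
  qed
  have "approximate_flow \<theta> c s \<epsilon> zl zu wl wu z0 w0 h (r * h) Z W"
    unfolding approximate_flow_def
  proof (intro conjI allI impI)
    have "1 * h < \<epsilon>" by (rule small(1)) (use C1 r L in \<open>simp add: C_def\<close>)
    thus "h < \<epsilon>" by simp
    show "r * h < \<epsilon>" by (rule small(1)) (use C1 r L in \<open>simp add: C_def\<close>)
    show "Z (x', t') \<le> Z (x, t)" if "x \<le> x'" "t \<le> t'" for x x' t t'
      using flow_antimono_fst[OF adm that] by (simp add: Z_def)
    show "W (x', t') \<le> W (x, t)" if "x \<le> x'" "t' \<le> t" for x x' t t'
      using flow_monotone_snd[OF adm that] by (simp add: W_def)
    show "Z (x, t) = z0 x" "W (x, t) = w0 x" if "t \<le> 0" for x t
      using flow_initial[OF that] by (simp_all add: Z_def W_def Y_def)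
  qed (use h k meas bounds con1 con2 in \<open>simp_all add: g_def P_def\<close>)
  thus ?thesis by blast
qed

end


subsection \<open>A Helly selection theorem in the plane\<close>

lemma integrable_bounded_support:
  fixes f :: "'a::euclidean_space \<Rightarrow> real"
  assumes "borel_fun f" "\<And>p. \<bar>f p\<bar> \<le> B" "\<And>p. p \<notin> cbox a b \<Longrightarrow> f p = 0"
  shows "integrable lborel f"
  by (rule integrableI_bounded_set[where A = "cbox a b" and B = B])
     (use assms emeasure_compact_finite[OF compact_cbox, of a b] in auto)

lemma integrable_mult_bounded_support:
  fixes F \<phi> :: "'a::euclidean_space \<Rightarrow> real"
  assumes F: "borel_fun F" "\<And>p. \<bar>F p\<bar> \<le> K"
    and \<phi>: "borel_fun \<phi>" "\<And>p. \<bar>\<phi> p\<bar> \<le> B" "\<And>p. R < norm p \<Longrightarrow> \<phi> p = 0"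
  shows "integrable lborel (\<lambda>p. F p * \<phi> p)"
proof (rule integrableI_bounded_set[where A = "cball 0 R" and B = "K * B"])
  show "emeasure lborel (cball (0::'a) R) < \<infinity>" by (rule emeasure_compact_finite) simp
  have "0 \<le> K" using F(2)[of 0] by simp
  hence "norm (F p * \<phi> p) \<le> K * B" for p
    unfolding real_norm_def abs_mult using F(2)[of p] \<phi>(2)[of p] by (intro mult_mono) auto
  thus "AE p in lborel. p \<in> cball 0 R \<longrightarrow> norm (F p * \<phi> p) \<le> K * B" by (intro AE_I2) blast
  show "AE p in lborel. p \<notin> cball 0 R \<longrightarrow> F p * \<phi> p = 0" using \<phi>(3) by (intro AE_I2) simp
qed (use F(1) \<phi>(1) in auto)

lemma integral_tendsto_bounded_support:
  fixes f :: "nat \<Rightarrow> 'a::euclidean_space \<Rightarrow> real"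
  assumes f: "\<And>n. borel_fun (f n)" and f': "borel_fun f'"
    and B: "\<And>n p. \<bar>f n p\<bar> \<le> B" and supp: "\<And>n p. p \<notin> cbox a b \<Longrightarrow> f n p = 0"
    and lim: "AE p in lborel. (\<lambda>n. f n p) \<longlonglongrightarrow> f' p"
  shows "(\<lambda>n. LBINT p. f n p) \<longlonglongrightarrow> (LBINT p. f' p)"
proof (rule integral_dominated_convergence[where w = "\<lambda>p. B * indicator (cbox a b) p"])
  have "integrable lborel (indicator (cbox a b) :: 'a \<Rightarrow> real)"
    by (rule integrable_bounded_support[where B = 1 and a = a and b = b]) (auto simp: indicator_def)
  thus "integrable lborel (\<lambda>p. B * indicator (cbox a b) p)" by simp
  show "AE p in lborel. norm (f n p) \<le> B * indicator (cbox a b) p" for n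
    using B supp by (auto simp: indicator_def)
qed (use f f' lim in auto)

lemma integral_translate:
  fixes f :: "'a::euclidean_space \<Rightarrow> real"
  assumes "borel_fun f"
  shows "(LBINT p. f (a + p)) = (LBINT p. f p)"
proof -
  have "(LBINT p. f p) = (LINT p|distr lborel borel ((+) a). f p)" by (simp add: lborel_distr_plus)
  also have "\<dots> = (LBINT p. f (a + p))" using assms by (subst integral_distr) auto
  finally show ?thesis by simp
qed

text \<open>Along the diagonal direction the upper limit at a point is below
  the lower limit at an earlier point, so the oscillation has integral zero by translation invariance.\<close>

lemma bimonotone_subsequence:
  fixes f :: "nat \<Rightarrow> real \<times> real \<Rightarrow> real" and \<sigma> K :: real
  assumes f_meas: "\<And>n. borel_fun (f n)"
    and f_bound: "\<And>n p. \<bar>f n p\<bar> \<le> K"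
    and \<sigma>: "\<sigma> = 1 \<or> \<sigma> = -1"
    and f_mono: "\<And>n x x' t t'. x \<le> x' \<Longrightarrow> \<sigma> * t \<le> \<sigma> * t' \<Longrightarrow> f n (x', t') \<le> f n (x, t)"
  obtains \<rho> F where "strict_mono (\<rho> :: nat \<Rightarrow> nat)" "borel_fun F" "\<And>p. \<bar>F p\<bar> \<le> K"
    "AE p in lborel. (\<lambda>n. f (\<rho> n) p) \<longlonglongrightarrow> F p"
proof -
  have "countable (\<rat> \<times> \<rat> :: (real \<times> real) set)" by (intro countable_SIGMA countable_rat)
  then obtain \<rho> where \<rho>: "strict_mono (\<rho> :: nat \<Rightarrow> nat)"
    and conv: "\<And>p. p \<in> \<rat> \<times> \<rat> \<Longrightarrow> \<exists>l. (\<lambda>n. f (\<rho> n) p) \<longlonglongrightarrow> l"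
    using function_convergent_subsequence[of "\<rat> \<times> \<rat>" f K] f_bound by (auto simp: real_norm_def)
  define U where "U = (\<lambda>p. limsup (\<lambda>n. ereal (f (\<rho> n) p)))"
  define D where "D = (\<lambda>p. liminf (\<lambda>n. ereal (f (\<rho> n) p)))"
  have "\<And>n p. ereal (f n p) \<le> ereal K" "\<And>n p. ereal (- K) \<le> ereal (f n p)"
    using f_bound by (auto simp: abs_le_iff minus_le_iff)
  hence UD: "ereal (- K) \<le> D p" "D p \<le> U p" "U p \<le> ereal K" for p
    unfolding U_def D_def by (intro Limsup_bounded Liminf_bounded Liminf_le_Limsup always_eventually allI; simp)+
  have meas: "borel_fun U" "borel_fun D"
    unfolding U_def D_def using f_meas by auto
  define u d where "u = (\<lambda>p. real_of_ereal (U p))" and "d = (\<lambda>p. real_of_ereal (D p))"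
  have u: "U p = ereal (u p)" and d: "D p = ereal (d p)" for p
  proof -
    have "\<bar>U p\<bar> \<noteq> \<infinity>" "\<bar>D p\<bar> \<noteq> \<infinity>" using UD[of p] by (cases "U p"; cases "D p"; auto)+
    thus "U p = ereal (u p)" "D p = ereal (d p)" by (auto simp: u_def d_def ereal_real)
  qed
  have ud: "- K \<le> d p" "d p \<le> u p" "u p \<le> K" for p using UD[of p] by (auto simp: u d)
  have ud_meas: "borel_fun u" "borel_fun d"
    unfolding u_def d_def using meas by auto
  \<comment> \<open>A rational point strictly between the two points, where the subsequence
    converges, bounds the upper limit at the later point and the lower limit at the earlier one.
    Since \<sigma> squared is 1, \<open>\<sigma> * b\<close> is the time coordinate whose signed
    value is b.\<close>
  have key: "u (x', t') \<le> d (x, t)" if xt: "x < x'" "\<sigma> * t < \<sigma> * t'" for x x' t t'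
  proof -
    obtain a where a: "a \<in> \<rat>" "x < a" "a < x'" using Rats_dense_in_real[OF xt(1)] by blast
    obtain b where b: "b \<in> \<rat>" "\<sigma> * t < b" "b < \<sigma> * t'" using Rats_dense_in_real[OF xt(2)] by blast
    have sb: "\<sigma> * b \<in> \<rat>" "\<sigma> * (\<sigma> * b) = b" using \<sigma> b by auto
    obtain l where l: "(\<lambda>n. f (\<rho> n) (a, \<sigma> * b)) \<longlonglongrightarrow> l" using conv[of "(a, \<sigma> * b)"] a sb by auto
    hence l': "(\<lambda>n. ereal (f (\<rho> n) (a, \<sigma> * b))) \<longlonglongrightarrow> ereal l" by simp
    have "U (x', t') \<le> limsup (\<lambda>n. ereal (f (\<rho> n) (a, \<sigma> * b)))"
      unfolding U_def using a b by (intro Limsup_mono always_eventually allI) (simp add: f_mono sb(2))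
    also have "\<dots> = ereal l" using lim_imp_Limsup[OF _ l'] by simp
    also have "\<dots> = liminf (\<lambda>n. ereal (f (\<rho> n) (a, \<sigma> * b)))" using lim_imp_Liminf[OF _ l'] by simp
    also have "\<dots> \<le> D (x, t)"
      unfolding D_def using a b by (intro Liminf_mono always_eventually allI) (simp add: f_mono sb(2))
    finally show ?thesis by (simp add: u d)
  qed
  have zero: "AE p in lborel. (u p - d p) * (max 0 (R - \<bar>fst p\<bar>) * max 0 (R - \<bar>snd p\<bar>)) = 0"
    if R: "0 \<le> R" for R
  proof -
    define \<psi> where "\<psi> = (\<lambda>p::real \<times> real. max 0 (R - \<bar>fst p\<bar>) * max 0 (R - \<bar>snd p\<bar>))"
    define S where "S = cbox (- (R + 1), - (R + 1)) (R + 1, R + 1)"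
    have \<psi>: "0 \<le> \<psi> p" "\<psi> p \<le> R * R" for p
      unfolding \<psi>_def using R by (auto intro!: mult_mono)
    have \<psi>_supp: "\<psi> (p - (\<eta>, \<sigma> * \<eta>)) = 0" if "p \<notin> S" "0 \<le> \<eta>" "\<eta> \<le> 1" for p \<eta>
      using that \<sigma> by (cases p) (auto simp: \<psi>_def S_def max_def)
    have cont: "continuous_on UNIV \<psi>" unfolding \<psi>_def by (intro continuous_intros)
    hence \<psi>_meas: "borel_fun \<psi>" by (rule borel_measurable_continuous_onI)
    have shift_meas: "borel_fun (\<lambda>p. F (p + q))" if "borel_fun F"
      for F :: "real \<times> real \<Rightarrow> real" and q using that by measurable
    have int: "integrable lborel (\<lambda>p. (F p :: real) * \<psi> (p - (\<eta>, \<sigma> * \<eta>)))"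
      if F: "borel_fun F" "\<And>p. \<bar>F p\<bar> \<le> C" and \<eta>: "0 \<le> \<eta>" "\<eta> \<le> 1" for F \<eta> C
    proof (rule integrable_bounded_support[where B = "C * (R * R)" and a = "(- (R + 1), - (R + 1))" and b = "(R + 1, R + 1)"])
      show "borel_fun (\<lambda>p. F p * \<psi> (p - (\<eta>, \<sigma> * \<eta>)))" using F \<psi>_meas by measurable
      have "0 \<le> C" using F(2)[of 0] by simp
      thus "\<bar>F p * \<psi> (p - (\<eta>, \<sigma> * \<eta>))\<bar> \<le> C * (R * R)" for p
        unfolding abs_mult using F(2)[of p] \<psi>[of "p - (\<eta>, \<sigma> * \<eta>)"] by (intro mult_mono) auto
    qed (use \<psi>_supp \<eta> in \<open>auto simp: S_def\<close>)
    have uK: "\<bar>u p\<bar> \<le> K" for p using ud[of p] by (simp add: abs_le_iff)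
    have j: "\<bar>u p - d p\<bar> \<le> 2 * K" for p using ud[of p] by (simp add: abs_le_iff)
    define \<eta> where "\<eta> = (\<lambda>n. 1 / real (Suc n))"
    have \<eta>: "0 < \<eta> n" "\<eta> n \<le> 1" for n by (auto simp: \<eta>_def)
    have \<eta>0: "\<eta> \<longlonglongrightarrow> 0" unfolding \<eta>_def by (rule LIMSEQ_Suc[OF lim_1_over_n])
    have int0: "integrable lborel (\<lambda>p. (u p - d p) * \<psi> p)"
      using int[OF borel_measurable_diff[OF ud_meas] j, of 0] by (simp add: zero_prod_def[symmetric])
    \<comment> \<open>By \<open>key\<close>, u - d is at most u minus its diagonal translate.
      Translation invariance moves the shift from u, which is merely measurable, to the continuous
      tent \<psi>, where it disappears as \<eta> tends to 0.\<close>
    have le: "(LBINT p. (u p - d p) * \<psi> p)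
        \<le> (LBINT p. u p * (\<psi> p - \<psi> (p - (\<eta> n, \<sigma> * \<eta> n))))" for n
    proof -
      let ?e = "(\<eta> n, \<sigma> * \<eta> n)"
      have u\<psi>: "integrable lborel (\<lambda>p. u p * \<psi> p)"
        using int[OF ud_meas(1) uK, of 0] by (simp add: zero_prod_def[symmetric])
      have us: "integrable lborel (\<lambda>p. u p * \<psi> (p - ?e))" using int[OF ud_meas(1) uK, of "\<eta> n"] \<eta>[of n] by simp
      have us': "integrable lborel (\<lambda>p. u (?e + p) * \<psi> p)"
        using int[OF shift_meas[OF ud_meas(1)] uK, of "0" "?e"]
        by (simp add: zero_prod_def[symmetric] add.commute)
      have "(LBINT p. (u p - d p) * \<psi> p) \<le> (LBINT p. u p * \<psi> p - u (?e + p) * \<psi> p)"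
      proof (intro integral_mono int0 Bochner_Integration.integrable_diff u\<psi> us')
        fix p :: "real \<times> real"
        have "\<sigma> * snd p < \<sigma> * snd (?e + p)" using \<sigma> \<eta>[of n] by auto
        hence "u (fst (?e + p), snd (?e + p)) \<le> d (fst p, snd p)" using \<eta>[of n] by (intro key) auto
        hence "u (?e + p) \<le> d p" unfolding prod.collapse .
        hence "(u p - d p) * \<psi> p \<le> (u p - u (?e + p)) * \<psi> p" using \<psi> by (intro mult_right_mono) auto
        thus "(u p - d p) * \<psi> p \<le> u p * \<psi> p - u (?e + p) * \<psi> p" by (simp add: algebra_simps)
      qed
      also have "\<dots> = (LBINT p. u p * \<psi> p) - (LBINT p. u (?e + p) * \<psi> p)"
        by (rule Bochner_Integration.integral_diff[OF u\<psi> us'])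
      also have "(LBINT p. u (?e + p) * \<psi> p) = (LBINT p. u p * \<psi> (p - ?e))"
      proof -
        have "borel_fun (\<lambda>p. u p * \<psi> (p - ?e))" using ud_meas \<psi>_meas by measurable
        from integral_translate[OF this, of ?e] show ?thesis by simp
      qed
      also have "(LBINT p. u p * \<psi> p) - \<dots> = (LBINT p. u p * \<psi> p - u p * \<psi> (p - ?e))"
        by (rule Bochner_Integration.integral_diff[symmetric, OF u\<psi> us])
      finally show ?thesis by (simp add: algebra_simps)
    qed
    have "(\<lambda>n. LBINT p. u p * (\<psi> p - \<psi> (p - (\<eta> n, \<sigma> * \<eta> n)))) \<longlonglongrightarrow> (LINT p::real \<times> real|lborel. (0::real))"
    proof (rule integral_tendsto_bounded_support[where B = "K * (R * R)" and a = "(- (R + 1), - (R + 1))" and b = "(R + 1, R + 1)"])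
      show "borel_fun (\<lambda>p. u p * (\<psi> p - \<psi> (p - (\<eta> n, \<sigma> * \<eta> n))))" for n
        using ud_meas \<psi>_meas by measurable
      have "0 \<le> K" using uK[of 0] by simp
      thus "\<bar>u p * (\<psi> p - \<psi> (p - (\<eta> n, \<sigma> * \<eta> n)))\<bar> \<le> K * (R * R)" for n p
        unfolding abs_mult using uK[of p] \<psi>[of p] \<psi>[of "p - (\<eta> n, \<sigma> * \<eta> n)"] by (intro mult_mono) auto
      show "u p * (\<psi> p - \<psi> (p - (\<eta> n, \<sigma> * \<eta> n))) = 0"
        if "p \<notin> cbox (- (R + 1), - (R + 1)) (R + 1, R + 1)" for n p
        using \<psi>_supp[of p 0] \<psi>_supp[of p "\<eta> n"] that \<eta>[of n] by (simp add: S_def zero_prod_def[symmetric])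
      have "(\<lambda>n. u p * (\<psi> p - \<psi> (p - (\<eta> n, \<sigma> * \<eta> n)))) \<longlonglongrightarrow> u p * (\<psi> p - \<psi> p)" for p
      proof (intro tendsto_intros)
        have "(\<lambda>n. p - (\<eta> n, \<sigma> * \<eta> n)) \<longlonglongrightarrow> p - (0, \<sigma> * 0)" by (intro tendsto_intros \<eta>0)
        hence "(\<lambda>n. p - (\<eta> n, \<sigma> * \<eta> n)) \<longlonglongrightarrow> p" by (simp add: zero_prod_def[symmetric])
        thus "(\<lambda>n. \<psi> (p - (\<eta> n, \<sigma> * \<eta> n))) \<longlonglongrightarrow> \<psi> p"
          by (rule continuous_on_tendsto_compose[OF cont]) auto
      qed
      thus "AE p in lborel. (\<lambda>n. u p * (\<psi> p - \<psi> (p - (\<eta> n, \<sigma> * \<eta> n)))) \<longlonglongrightarrow> 0" by simp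
    qed simp
    hence "(LBINT p. (u p - d p) * \<psi> p) \<le> 0"
      using LIMSEQ_le_const[of _ _ "LBINT p. (u p - d p) * \<psi> p"] le by auto
    moreover have nonneg: "0 \<le> (u p - d p) * \<psi> p" for p using ud[of p] \<psi>[of p] by simp
    hence "0 \<le> (LBINT p. (u p - d p) * \<psi> p)" by simp
    ultimately have "(LBINT p. (u p - d p) * \<psi> p) = 0" by simp
    hence "AE p in lborel. (u p - d p) * \<psi> p = 0"
      using integral_nonneg_eq_0_iff_AE[OF int0] nonneg by simp
    thus ?thesis by (simp add: \<psi>_def)
  qed
  \<comment> \<open>Countably many tents cover the plane, and each is positive inside its square, so
    u = d there up to a null set.\<close>
  have "AE p in lborel. \<forall>R::nat. (u p - d p) * (max 0 (real R - \<bar>fst p\<bar>) * max 0 (real R - \<bar>snd p\<bar>)) = 0"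
    using zero by (intro AE_all_countable[THEN iffD2] allI) auto
  hence "AE p in lborel. (\<lambda>n. f (\<rho> n) p) \<longlonglongrightarrow> u p"
  proof eventually_elim
    case (elim p)
    obtain R :: nat where R: "max \<bar>fst p\<bar> \<bar>snd p\<bar> < real R" using reals_Archimedean2 by blast
    hence "u p = d p" using elim[rule_format, of R] by (auto simp: max_def split: if_splits)
    hence "(\<lambda>n. ereal (f (\<rho> n) p)) \<longlonglongrightarrow> ereal (u p)"
      using u[of p] d[of p] by (intro Liminf_eq_Limsup) (auto simp: U_def D_def)
    thus ?case by simp
  qed
  moreover have "\<bar>u p\<bar> \<le> K" for p using ud[of p] by (simp add: abs_le_iff)
  ultimately show thesis using that \<rho> ud_meas(1) by blast
qed


subsection \<open>Test functions and weak limits\<close>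

text \<open>A bound uniform in the step and a pointwise limit, as dominated convergence requires.
  The minus sign stems from the backward shift left by summation by parts.\<close>

lemma backward_quotient:
  fixes f f' :: "real \<Rightarrow> real"
  assumes "\<And>y. (f has_real_derivative f' y) (at y)" "\<And>y. \<bar>f' y\<bar> \<le> B"
  shows "0 < h \<Longrightarrow> \<bar>(f (x - h) - f x) / h\<bar> \<le> B"
    and "(\<And>n. 0 < H n) \<Longrightarrow> H \<longlonglongrightarrow> 0 \<Longrightarrow> (\<lambda>n. (f (x - H n) - f x) / H n) \<longlonglongrightarrow> - f' x"
proof -
  assume h: "0 < h"
  have "norm (f (x - h) - f x) \<le> B * norm ((x - h) - x)"
    by (rule field_differentiable_bound[where S = UNIV and f' = f']) (use assms in auto)
  thus "\<bar>(f (x - h) - f x) / h\<bar> \<le> B" using h by (simp add: field_simps)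
next
  assume H: "\<And>n. 0 < H n" "H \<longlonglongrightarrow> 0"
  have "(\<lambda>n. (f (x + - H n) - f x) / (- H n)) \<longlonglongrightarrow> f' x"
  proof (rule filterlim_compose[of "\<lambda>y. (f (x + y) - f x) / y" _ "at 0"])
    show "(\<lambda>y. (f (x + y) - f x) / y) \<midarrow>0\<rightarrow> f' x" using assms(1)[of x] by (simp add: DERIV_def)
    show "filterlim (\<lambda>n. - H n) (at 0) sequentially"
      using tendsto_minus[OF H(2)] H(1) by (auto simp: filterlim_at less_imp_neq[symmetric])
  qed
  hence "(\<lambda>n. - ((f (x + - H n) - f x) / (- H n))) \<longlonglongrightarrow> - f' x" by (rule tendsto_minus)
  thus "(\<lambda>n. (f (x - H n) - f x) / H n) \<longlonglongrightarrow> - f' x" by simp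
qed

text \<open>Off the closed support the function vanishes in a neighbourhood, so its derivative
  vanishes too and the support does not grow.\<close>

lemma test_function_deriv:
  fixes \<phi> :: "'a::real_normed_vector \<Rightarrow> real"
  assumes "\<phi> \<in> test_functions"
  shows "(\<phi> has_derivative frechet_derivative \<phi> (at p)) (at p)"
    and "(\<lambda>p. frechet_derivative \<phi> (at p) e) \<in> test_functions"
proof -
  have C: "Ck n \<phi>" for n using assms by (auto simp: test_functions_def)
  have diff: "\<phi> differentiable (at x)" for x using C[of "Suc 0"] by simp
  thus D: "(\<phi> has_derivative frechet_derivative \<phi> (at p)) (at p)" for p by (simp add: frechet_derivative_works)
  have "Ck n (\<lambda>p. frechet_derivative \<phi> (at p) e)" for n using C[of "Suc n"] by simp
  moreover have "{p. frechet_derivative \<phi> (at p) e \<noteq> 0} \<subseteq> closure {x. \<phi> x \<noteq> 0}"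
  proof (rule ccontr)
    assume "\<not> ?thesis"
    then obtain p where p: "frechet_derivative \<phi> (at p) e \<noteq> 0" "p \<in> - closure {x. \<phi> x \<noteq> 0}" by auto
    have "\<forall>\<^sub>F x in nhds p. \<phi> x = 0"
      using eventually_nhds_in_open[OF _ p(2)] by (rule eventually_mono) (use closure_subset[of "{x. \<phi> x \<noteq> 0}"] in auto)
    hence "(\<phi> has_derivative (\<lambda>_. 0)) (at p)"
      using p(2) closure_subset[of "{x. \<phi> x \<noteq> 0}"]
      by (intro has_derivative_transform_eventually[of "\<lambda>_. 0" "\<lambda>_. 0" p UNIV \<phi>])
         (auto simp: eventually_at_filter elim: eventually_mono)
    hence "frechet_derivative \<phi> (at p) = (\<lambda>_. 0)" by (rule frechet_derivative_at[symmetric])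
    thus False using p(1) by simp
  qed
  hence "closure {p. frechet_derivative \<phi> (at p) e \<noteq> 0} \<subseteq> closure {x. \<phi> x \<noteq> 0}"
    by (rule closure_minimal) simp
  hence "compact (closure {p. frechet_derivative \<phi> (at p) e \<noteq> 0})"
    using assms compact_Int_closed[of "closure {x. \<phi> x \<noteq> 0}" "closure {p. frechet_derivative \<phi> (at p) e \<noteq> 0}"]
    by (simp add: test_functions_def Int_absorb1)
  ultimately show "(\<lambda>p. frechet_derivative \<phi> (at p) e) \<in> test_functions"
    by (simp add: test_functions_def)
qed

lemma test_function_continuous: "\<phi> \<in> test_functions \<Longrightarrow> continuous_on UNIV \<phi>"
proof -
  assume "\<phi> \<in> test_functions"
  hence "Ck 0 \<phi>" unfolding test_functions_def by blast
  thus ?thesis by simp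
qed

lemma test_function_bounded_support:
  fixes \<phi> :: "'a::real_normed_vector \<Rightarrow> real"
  assumes "\<phi> \<in> test_functions"
  obtains B R where "0 \<le> B" "0 < R" "\<And>p. \<bar>\<phi> p\<bar> \<le> B" "\<And>p. R < norm p \<Longrightarrow> \<phi> p = 0"
proof -
  let ?S = "closure {x. \<phi> x \<noteq> 0}"
  have S: "compact ?S" using assms by (simp add: test_functions_def)
  have z: "p \<notin> ?S \<Longrightarrow> \<phi> p = 0" for p using closure_subset[of "{x. \<phi> x \<noteq> 0}"] by auto
  have "compact (\<phi> ` ?S)"
    by (rule compact_continuous_image[OF continuous_on_subset[OF test_function_continuous[OF assms] subset_UNIV] S])
  then obtain B where B: "\<And>y. y \<in> \<phi> ` ?S \<Longrightarrow> \<bar>y\<bar> \<le> B"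
    using compact_imp_bounded[of "\<phi> ` ?S"] unfolding bounded_iff real_norm_def by blast
  obtain R where R: "\<And>p. p \<in> ?S \<Longrightarrow> norm p \<le> R"
    using compact_imp_bounded[OF S] unfolding bounded_iff by blast
  show thesis
  proof (rule that[of "max 0 B" "max 1 R"])
    show "\<bar>\<phi> p\<bar> \<le> max 0 B" for p using B[of "\<phi> p"] z[of p] by (cases "p \<in> ?S") (auto simp: max_def)
    show "\<phi> p = 0" if "max 1 R < norm p" for p using R[of p] z[of p] that by (cases "p \<in> ?S") auto
  qed auto
qed

text \<open>\<open>dx\<close> and \<open>dt\<close> are defined by one-variable derivatives, whereas
  smoothness is expressed by Frechet derivatives. Identifying the former with the latter in the
  directions (1, 0) and (0, 1) transfers smoothness and compact support.\<close>

lemma test_function_partial_derivatives: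
  assumes "\<phi> \<in> test_functions"
  shows "((\<lambda>x. \<phi> (x, t)) has_real_derivative dx \<phi> (x, t)) (at x)"
    and "((\<lambda>t. \<phi> (x, t)) has_real_derivative dt \<phi> (x, t)) (at t)"
    and "dx \<phi> \<in> test_functions" and "dt \<phi> \<in> test_functions"
proof -
  let ?D = "\<lambda>p. frechet_derivative \<phi> (at p)"
  have lin: "linear (?D p)" for p
    using test_function_deriv(1)[OF assms] by (rule has_derivative_linear)
  have along: "((\<lambda>r. \<phi> (\<gamma> r)) has_real_derivative ?D (\<gamma> r) e) (at r)"
    if "\<And>r. (\<gamma> has_derivative (\<lambda>h. h *\<^sub>R e)) (at r)" for \<gamma> :: "real \<Rightarrow> real \<times> real" and e r
  proof -
    have "((\<lambda>r. \<phi> (\<gamma> r)) has_derivative (\<lambda>h. ?D (\<gamma> r) (h *\<^sub>R e))) (at r)"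
      by (rule has_derivative_compose[OF that test_function_deriv(1)[OF assms]])
    moreover have "(\<lambda>h. ?D (\<gamma> r) (h *\<^sub>R e)) = (*) (?D (\<gamma> r) e)"
      by (simp add: linear_scale[OF lin] fun_eq_iff)
    ultimately show ?thesis by (simp only: has_field_derivative_def)
  qed
  have x: "((\<lambda>x. \<phi> (x, t)) has_real_derivative ?D (x, t) (1, 0)) (at x)" for x t
    by (rule along) (auto intro!: derivative_eq_intros)
  have t: "((\<lambda>t. \<phi> (x, t)) has_real_derivative ?D (x, t) (0, 1)) (at t)" for x t
    by (rule along) (auto intro!: derivative_eq_intros)
  have dx: "dx \<phi> = (\<lambda>p. ?D p (1, 0))"
  proof
    fix p show "dx \<phi> p = ?D p (1, 0)" using DERIV_imp_deriv[OF x[of "snd p" "fst p"]] by (simp add: dx_def)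
  qed
  have dt: "dt \<phi> = (\<lambda>p. ?D p (0, 1))"
  proof
    fix p show "dt \<phi> p = ?D p (0, 1)" using DERIV_imp_deriv[OF t[of "fst p" "snd p"]] by (simp add: dt_def)
  qed
  show "((\<lambda>x. \<phi> (x, t)) has_real_derivative dx \<phi> (x, t)) (at x)"
    "((\<lambda>t. \<phi> (x, t)) has_real_derivative dt \<phi> (x, t)) (at t)"
    using x t by (simp_all add: dx dt)
  show "dx \<phi> \<in> test_functions" "dt \<phi> \<in> test_functions"
    unfolding dx dt by (rule test_function_deriv(2)[OF assms])+
qed

text \<open>Both mixed derivatives are limits of the second difference quotient on small squares.\<close>

lemma mixed_partial_derivatives:
  assumes "\<phi> \<in> test_functions"
  shows "dx (dt \<phi>) = dt (dx \<phi>)"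
proof
  fix p :: "real \<times> real"
  obtain x t where p: "p = (x, t)" by force
  note D = test_function_partial_derivatives[OF assms]
  note Dx = test_function_partial_derivatives[OF D(3)]
  note Dt = test_function_partial_derivatives[OF D(4)]
  define \<eta> where "\<eta> = (\<lambda>n. 1 / real (Suc n))"
  have \<eta>: "0 < \<eta> n" for n by (auto simp: \<eta>_def)
  have \<eta>0: "\<eta> \<longlonglongrightarrow> 0" unfolding \<eta>_def by (rule LIMSEQ_Suc[OF lim_1_over_n])
  have sq: "\<exists>q r. fst q \<in> {x..x + e} \<and> snd q \<in> {t..t + e} \<and> fst r \<in> {x..x + e} \<and> snd r \<in> {t..t + e} \<and>
      dx (dt \<phi>) q = dt (dx \<phi>) r" if e: "0 < e" for e
  proof -
    have "((\<lambda>y. \<phi> (y, t + e) - \<phi> (y, t)) has_real_derivative dx \<phi> (y, t + e) - dx \<phi> (y, t)) (at y)" for y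
      by (intro derivative_intros D)
    from MVT2[of x "x + e" "\<lambda>y. \<phi> (y, t + e) - \<phi> (y, t)", OF _ this] e
    obtain a where a: "x < a" "a < x + e" and a':
      "(\<phi> (x + e, t + e) - \<phi> (x + e, t)) - (\<phi> (x, t + e) - \<phi> (x, t)) = e * (dx \<phi> (a, t + e) - dx \<phi> (a, t))"
      by auto
    from MVT2[of t "t + e" "\<lambda>y. dx \<phi> (a, y)", OF _ Dx(2)] e
    obtain b where b: "t < b" "b < t + e" and b': "dx \<phi> (a, t + e) - dx \<phi> (a, t) = e * dt (dx \<phi>) (a, b)"
      by auto
    have "((\<lambda>y. \<phi> (x + e, y) - \<phi> (x, y)) has_real_derivative dt \<phi> (x + e, y) - dt \<phi> (x, y)) (at y)" for y
      by (intro derivative_intros D)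
    from MVT2[of t "t + e" "\<lambda>y. \<phi> (x + e, y) - \<phi> (x, y)", OF _ this] e
    obtain a2 where c: "t < a2" "a2 < t + e" and c':
      "(\<phi> (x + e, t + e) - \<phi> (x, t + e)) - (\<phi> (x + e, t) - \<phi> (x, t)) = e * (dt \<phi> (x + e, a2) - dt \<phi> (x, a2))"
      by auto
    from MVT2[of x "x + e" "\<lambda>y. dt \<phi> (y, a2)", OF _ Dt(1)] e
    obtain b2 where d: "x < b2" "b2 < x + e" and d': "dt \<phi> (x + e, a2) - dt \<phi> (x, a2) = e * dx (dt \<phi>) (b2, a2)"
      by auto
    have "e * (e * dx (dt \<phi>) (b2, a2)) = e * (e * dt (dx \<phi>) (a, b))"
      unfolding b'[symmetric] d'[symmetric] a'[symmetric] c'[symmetric] by simp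
    hence "dx (dt \<phi>) (b2, a2) = dt (dx \<phi>) (a, b)" using e by simp
    thus ?thesis using a b c d by (intro exI[of _ "(b2, a2)"] exI[of _ "(a, b)"]) auto
  qed
  have "\<forall>n. \<exists>q r. fst q \<in> {x..x + \<eta> n} \<and> snd q \<in> {t..t + \<eta> n} \<and> fst r \<in> {x..x + \<eta> n} \<and>
      snd r \<in> {t..t + \<eta> n} \<and> dx (dt \<phi>) q = dt (dx \<phi>) r"
    using sq[OF \<eta>] by blast
  then obtain q r where qr: "\<And>n. fst (q n) \<in> {x..x + \<eta> n}" "\<And>n. snd (q n) \<in> {t..t + \<eta> n}"
      "\<And>n. fst (r n) \<in> {x..x + \<eta> n}" "\<And>n. snd (r n) \<in> {t..t + \<eta> n}"
      "\<And>n. dx (dt \<phi>) (q n) = dt (dx \<phi>) (r n)"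
    by metis
  have squeeze: "f \<longlonglongrightarrow> y" if "\<And>n. f n \<in> {y..y + \<eta> n}" for f y
  proof (rule real_tendsto_sandwich[where f = "\<lambda>_. y" and h = "\<lambda>n. y + \<eta> n"])
    show "(\<lambda>n. y + \<eta> n) \<longlonglongrightarrow> y" using tendsto_add[OF tendsto_const \<eta>0, of y] by simp
  qed (use that in auto)
  have lim: "q \<longlonglongrightarrow> p" "r \<longlonglongrightarrow> p"
    using tendsto_Pair[OF squeeze[OF qr(1)] squeeze[OF qr(2)]] tendsto_Pair[OF squeeze[OF qr(3)] squeeze[OF qr(4)]]
    by (simp_all add: p)
  have "(\<lambda>n. dx (dt \<phi>) (q n)) \<longlonglongrightarrow> dx (dt \<phi>) p"
    by (rule continuous_on_tendsto_compose[OF test_function_continuous[OF Dt(3)] lim(1)]) auto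
  moreover have "(\<lambda>n. dt (dx \<phi>) (r n)) \<longlonglongrightarrow> dt (dx \<phi>) p"
    by (rule continuous_on_tendsto_compose[OF test_function_continuous[OF Dx(4)] lim(2)]) auto
  ultimately show "dx (dt \<phi>) p = dt (dx \<phi>) p" using LIMSEQ_unique by (simp add: qr(5))
qed

text \<open>Passage from Lebesgue measure on the half plane to Borel functions on the whole plane,
  where translation invariance and Fubini apply directly.\<close>

lemma half_plane_integral:
  fixes f :: "real \<times> real \<Rightarrow> real"
  assumes "borel_fun f"
  shows "(LINT p|half_plane. f p) = (LBINT p. indicator {0<..} (snd p) * f p)"
proof -
  have S: "UNIV \<times> {0<..} \<in> sets (borel :: (real \<times> real) measure)"
    by (intro borel_open open_Times) auto
  hence S': "UNIV \<times> {0<..} \<in> sets (lebesgue :: (real \<times> real) measure)" by (rule lborelD[THEN sets_completionI_sets])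
  have m: "borel_fun (\<lambda>p. indicator (UNIV \<times> {0<..}) p *\<^sub>R f p)"
    using S assms by measurable
  have "(LINT p|half_plane. f p) = (LINT p|lebesgue. indicator (UNIV \<times> {0<..}) p *\<^sub>R f p)"
    unfolding half_plane_def using S' by (subst integral_restrict_space) auto
  also have "\<dots> = (LBINT p. indicator (UNIV \<times> {0<..}) p *\<^sub>R f p)"
    using m by (intro integral_completion) simp
  also have "\<dots> = (LBINT p. indicator {0<..} (snd p) * f p)"
    by (intro Bochner_Integration.integral_cong) (auto simp: indicator_def)
  finally show ?thesis .
qed


lemma cbox_norm_bound: "p \<notin> cbox (- r, - r) (r, r) \<Longrightarrow> r < norm p" for p :: "real \<times> real"
proof (rule ccontr)
  assume p: "p \<notin> cbox (- r, - r) (r, r)" and "\<not> r < norm p"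
  hence "\<bar>fst p\<bar> \<le> r" "\<bar>snd p\<bar> \<le> r"
    using norm_fst_le[of "fst p" "snd p"] norm_snd_le[of "snd p" "fst p"] by auto
  thus False using p by (cases p) auto
qed

lemma test_function_measurable: "\<phi> \<in> test_functions \<Longrightarrow> \<phi> \<in> borel_measurable borel"
  by (rule borel_measurable_continuous_onI[OF test_function_continuous])

section \<open>Passage to the limit in the discrete conservation laws\<close>

lemma summation_by_parts:
  fixes A \<phi> \<kappa> :: "real \<times> real \<Rightarrow> real"
  assumes A: "borel_fun A" "\<And>p. \<bar>A p\<bar> \<le> K"
    and \<phi>: "borel_fun \<phi>" "\<And>p. \<bar>\<phi> p\<bar> \<le> B" "\<And>p. R < norm p \<Longrightarrow> \<phi> p = 0"
    and \<kappa>: "borel_fun \<kappa>" "\<And>p. \<bar>\<kappa> p\<bar> \<le> (1::real)" "\<And>p. \<kappa> (p + e) = \<kappa> p"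
  shows "(LBINT p. \<kappa> p * (A (p + e) - A p) / k * \<phi> p)
       = (LBINT p. \<kappa> p * A p * ((\<phi> (p - e) - \<phi> p) / k))"
    and "integrable lborel (\<lambda>p. \<kappa> p * (A (p + e) - A p) / k * \<phi> p)"
proof -
  define R' where "R' = \<bar>R\<bar> + norm e"
  have K: "0 \<le> K" and B: "0 \<le> B" using A(2)[of 0] \<phi>(2)[of 0] by simp_all
  have int: "integrable lborel (\<lambda>p. \<kappa> p * F p * \<phi> (p + q))"
    if F: "borel_fun F" "\<And>p. \<bar>F p\<bar> \<le> K" and q: "norm q \<le> norm e" for F q
  proof (rule integrable_mult_bounded_support[where K = "1 * K" and B = B and R = R'])
    show "borel_fun (\<lambda>p. \<kappa> p * F p)" "borel_fun (\<lambda>p. \<phi> (p + q))"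
      using F(1) \<phi>(1) \<kappa>(1) by measurable
    show "\<bar>\<kappa> p * F p\<bar> \<le> 1 * K" for p
      unfolding abs_mult using F(2)[of p] \<kappa>(2)[of p] K by (intro mult_mono) auto
    fix p :: "real \<times> real" assume "R' < norm p"
    moreover have "norm p \<le> norm (p + q) + norm q" using norm_triangle_ineq4[of "p + q" q] by simp
    ultimately have "R < norm (p + q)" using q by (simp add: R'_def)
    thus "\<phi> (p + q) = 0" by (rule \<phi>(3))
  qed (rule \<phi>(2))
  have As: "borel_fun (\<lambda>p. A (p + e))" using A(1) by measurable
  have i1: "integrable lborel (\<lambda>p. \<kappa> p * A (p + e) * \<phi> p)" using int[OF As, of 0] A(2) by simp
  have i2: "integrable lborel (\<lambda>p. \<kappa> p * A p * \<phi> p)" using int[OF A(1), of 0] A(2) by simp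
  have i3: "integrable lborel (\<lambda>p. \<kappa> p * A p * \<phi> (p - e))" using int[OF A(1), of "- e"] A(2) by simp
  have eq: "(\<lambda>p. \<kappa> p * (A (p + e) - A p) / k * \<phi> p)
      = (\<lambda>p. (\<kappa> p * A (p + e) * \<phi> p - \<kappa> p * A p * \<phi> p) / k)"
    by (auto simp: algebra_simps diff_divide_distrib)
  show "integrable lborel (\<lambda>p. \<kappa> p * (A (p + e) - A p) / k * \<phi> p)"
    unfolding eq by (intro integrable_divide Bochner_Integration.integrable_diff i1 i2)
  have m: "borel_fun (\<lambda>p. \<kappa> p * A p * \<phi> (p - e))" using A(1) \<phi>(1) \<kappa>(1) by measurable
  have "(LBINT p. \<kappa> p * A (p + e) * \<phi> p) = (LBINT p. \<kappa> p * A p * \<phi> (p - e))"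
    using integral_translate[OF m, of e] by (simp add: add.commute[of e] \<kappa>(3))
  hence "(LBINT p. \<kappa> p * (A (p + e) - A p) / k * \<phi> p)
      = (LBINT p. (\<kappa> p * A p * \<phi> (p - e) - \<kappa> p * A p * \<phi> p) / k)"
    unfolding eq using i1 i2 i3 by simp
  also have "\<dots> = (LBINT p. \<kappa> p * A p * ((\<phi> (p - e) - \<phi> p) / k))"
    by (intro Bochner_Integration.integral_cong) (auto simp: algebra_simps diff_divide_distrib)
  finally show "(LBINT p. \<kappa> p * (A (p + e) - A p) / k * \<phi> p)
       = (LBINT p. \<kappa> p * A p * ((\<phi> (p - e) - \<phi> p) / k))" .
qed

lemma integral_difference_tendsto:
  fixes A :: "nat \<Rightarrow> real \<times> real \<Rightarrow> real" and \<phi> \<psi> :: "real \<times> real \<Rightarrow> real"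
  assumes A: "\<And>n. borel_fun (A n)" "\<And>n p. \<bar>A n p\<bar> \<le> K"
    and A': "borel_fun A'" "AE p in lborel. (\<lambda>n. A n p) \<longlonglongrightarrow> A' p"
    and \<phi>: "borel_fun \<phi>" "\<And>p. R < norm p \<Longrightarrow> \<phi> p = 0"
    and e: "\<And>n. norm (e n) \<le> 1"
    and \<psi>: "borel_fun \<psi>" "\<And>p. (\<lambda>n. (\<phi> (p - e n) - \<phi> p) / k n) \<longlonglongrightarrow> - \<psi> p"
      "\<And>n p. \<bar>(\<phi> (p - e n) - \<phi> p) / k n\<bar> \<le> B"
  shows "(\<lambda>n. LBINT p. A n p * ((\<phi> (p - e n) - \<phi> p) / k n)) \<longlonglongrightarrow> (LBINT p. A' p * - \<psi> p)"
proof (rule integral_tendsto_bounded_support[where B = "K * B" and a = "(- (\<bar>R\<bar> + 1), - (\<bar>R\<bar> + 1))" and b = "(\<bar>R\<bar> + 1, \<bar>R\<bar> + 1)"])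
  show "borel_fun (\<lambda>p. A n p * ((\<phi> (p - e n) - \<phi> p) / k n))" for n
    using A \<phi> by measurable
  show "borel_fun (\<lambda>p. A' p * - \<psi> p)" using A' \<psi> by measurable
  have K: "0 \<le> K" using A(2)[of 0 0] by simp
  show "\<bar>A n p * ((\<phi> (p - e n) - \<phi> p) / k n)\<bar> \<le> K * B" for n p
    unfolding abs_mult[of "A n p"] using A(2)[of n p] \<psi>(3)[of p n] K by (intro mult_mono) auto
  show "A n p * ((\<phi> (p - e n) - \<phi> p) / k n) = 0"
    if "p \<notin> cbox (- (\<bar>R\<bar> + 1), - (\<bar>R\<bar> + 1)) (\<bar>R\<bar> + 1, \<bar>R\<bar> + 1)" for n p
  proof -
    have "\<bar>R\<bar> + 1 < norm p" using that by (rule cbox_norm_bound)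
    moreover have "norm p \<le> norm (p - e n) + norm (e n)" using norm_triangle_ineq[of "p - e n" "e n"] by simp
    ultimately have "R < norm (p - e n)" "R < norm p" using e[of n] by linarith+
    thus ?thesis using \<phi>(2) by simp
  qed
  show "AE p in lborel. (\<lambda>n. A n p * ((\<phi> (p - e n) - \<phi> p) / k n)) \<longlonglongrightarrow> A' p * - \<psi> p"
    using A'(2) by eventually_elim (intro tendsto_mult \<psi>(2))
qed

text \<open>The initial term of the weak formulation is the contribution of the half \<open>t \<le> 0\<close> of the plane, where
  the solution is extended by its initial value.\<close>

lemma initial_term:
  fixes a :: "real \<Rightarrow> real"
  assumes a: "borel_fun a" "\<And>x. \<bar>a x\<bar> \<le> K" and \<phi>: "\<phi> \<in> test_functions"
  shows "(LBINT p. indicator {..0} (snd p) * (a (fst p) * dt \<phi> p)) = (LBINT x. a x * \<phi> (x, 0))"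
proof -
  note D = test_function_partial_derivatives[OF \<phi>]
  obtain B R where BR: "0 \<le> B" "0 < R" "\<And>p. \<bar>dt \<phi> p\<bar> \<le> B" "\<And>p. R < norm p \<Longrightarrow> dt \<phi> p = 0"
    using test_function_bounded_support[OF D(4)] by metis
  obtain B1 R1 where BR1: "0 < R1" "\<And>p. R1 < norm p \<Longrightarrow> \<phi> p = 0"
    using test_function_bounded_support[OF \<phi>] by metis
  let ?f = "\<lambda>p::real \<times> real. indicator {..0} (snd p) * (a (fst p) * dt \<phi> p)"
  have K: "0 \<le> K" using a(2)[of 0] by simp
  have int: "integrable lborel ?f"
    unfolding mult.assoc[symmetric]
  proof (rule integrable_mult_bounded_support[where K = "1 * K", OF _ _ test_function_measurable[OF D(4)] BR(3,4)])
    show "borel_fun (\<lambda>p::real \<times> real. indicator {..0} (snd p) * a (fst p))"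
      using a(1) by (simp add: borel_prod[symmetric])
    show "\<bar>indicator {..0} (snd p) * a (fst p)\<bar> \<le> 1 * K" for p :: "real \<times> real"
      unfolding abs_mult using a(2)[of "fst p"] K by (intro mult_mono) (auto simp: indicator_def)
  qed
  have inner: "(LBINT t. ?f (x, t)) = a x * \<phi> (x, 0)" for x
  proof -
    \<comment> \<open>Below time - T both \<phi> and its time derivative vanish on this vertical
      line, so the fundamental theorem leaves only the value at t = 0.\<close>
    define T where "T = max R R1 + 1"
    have T: "0 \<le> T" "R < T" "R1 < T" using BR(2) by (auto simp: T_def)
    have big: "T \<le> norm (x, t)" if "t \<le> - T" for t
      using norm_snd_le[of t x] that by simp
    have "(LBINT t. indicator {- T..0} t *\<^sub>R dt \<phi> (x, t)) = \<phi> (x, 0) - \<phi> (x, - T)"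
    proof (rule integral_FTC_atLeastAtMost)
      show "((\<lambda>t. \<phi> (x, t)) has_vector_derivative dt \<phi> (x, t)) (at t within {- T..0})" for t
        using D(2)[of x t] by (auto intro: has_vector_derivative_at_within simp: has_real_derivative_iff_has_vector_derivative)
      show "continuous_on {- T..0} (\<lambda>t. dt \<phi> (x, t))"
        by (rule continuous_on_compose2[OF test_function_continuous[OF D(4)]]) (auto intro!: continuous_intros)
    qed (use T in simp)
    moreover have "\<phi> (x, - T) = 0" using BR1(2)[of "(x, - T)"] big[of "- T"] T by simp
    moreover have "(LBINT t. ?f (x, t)) = (LBINT t. a x * (indicator {- T..0} t *\<^sub>R dt \<phi> (x, t)))"
    proof (intro Bochner_Integration.integral_cong refl)
      fix t
      have "dt \<phi> (x, t) = 0" if "t < - T" using BR(4)[of "(x, t)"] big[of t] T that by simp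
      thus "?f (x, t) = a x * (indicator {- T..0} t *\<^sub>R dt \<phi> (x, t))"
        by (cases "t < - T") (auto simp: indicator_def)
    qed
    ultimately show ?thesis by simp
  qed
  have "integrable (lborel \<Otimes>\<^sub>M lborel) ?f" using int by (simp add: lborel_prod)
  from lborel_pair.integral_fst'[OF this]
  have "(LBINT x. LBINT t. ?f (x, t)) = (LBINT p. ?f p)" by (simp only: lborel_prod)
  thus ?thesis by (simp only: inner)
qed

text \<open>The discrete law is multiplied by \<phi> and integrated over the whole plane; summation
  by parts then puts the differences on \<phi>, at a total cost of \<epsilon> times the integral of
  |\<phi>|. In the limit the time term lives on the whole plane and the flux term on t > 0 only, and
  the time term on t \<le> 0 is the initial term.\<close>

lemma weak_limit:
  fixes A F :: "nat \<Rightarrow> real \<times> real \<Rightarrow> real" and A' F' :: "real \<times> real \<Rightarrow> real" and a :: "real \<Rightarrow> real"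
  assumes A: "\<And>n. borel_fun (A n)" "\<And>n p. \<bar>A n p\<bar> \<le> K"
    and F: "\<And>n p. \<bar>F n p\<bar> \<le> K"
    and A': "borel_fun A'" "\<And>p. \<bar>A' p\<bar> \<le> K" "AE p in lborel. (\<lambda>n. A n p) \<longlonglongrightarrow> A' p"
    and F': "borel_fun F'" "\<And>p. \<bar>F' p\<bar> \<le> K" "AE p in lborel. (\<lambda>n. F n p) \<longlonglongrightarrow> F' p"
    and hk: "\<And>n. 0 < h n" "\<And>n. h n \<le> 1" "h \<longlonglongrightarrow> 0" "\<And>n. 0 < k n" "\<And>n. k n \<le> 1" "k \<longlonglongrightarrow> 0"
    and \<epsilon>: "\<And>n. \<epsilon> n \<le> 1" "\<epsilon> \<longlonglongrightarrow> 0"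
    and con: "\<And>n. consistent (\<epsilon> n) (h n) (k n) (A n) (F n)"
    and a: "borel_fun a" "\<And>x. \<bar>a x\<bar> \<le> K" "AE p in lborel. snd p \<le> 0 \<longrightarrow> A' p = a (fst p)"
    and \<phi>: "\<phi> \<in> test_functions"
  shows "(LINT p|half_plane. A' p * dt \<phi> p - F' p * dx \<phi> p) + (LINT x|lebesgue. a x * \<phi> (x, 0)) = 0"
proof -
  note D = test_function_partial_derivatives[OF \<phi>]
  obtain B R where BR: "0 \<le> B" "0 < R" "\<And>p. \<bar>\<phi> p\<bar> \<le> B" "\<And>p. R < norm p \<Longrightarrow> \<phi> p = 0"
    using test_function_bounded_support[OF \<phi>] by metis
  obtain Bx Rx where BRx: "0 \<le> Bx" "0 < Rx" "\<And>p. \<bar>dx \<phi> p\<bar> \<le> Bx" "\<And>p. Rx < norm p \<Longrightarrow> dx \<phi> p = 0"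
    using test_function_bounded_support[OF D(3)] by metis
  obtain Bt Rt where BRt: "0 \<le> Bt" "0 < Rt" "\<And>p. \<bar>dt \<phi> p\<bar> \<le> Bt" "\<And>p. Rt < norm p \<Longrightarrow> dt \<phi> p = 0"
    using test_function_bounded_support[OF D(4)] by metis
  have meas\<phi>: "borel_fun \<phi>" "borel_fun (dx \<phi>)" "borel_fun (dt \<phi>)"
    using \<phi> D(3,4) test_function_measurable by auto
  have K: "0 \<le> K" using a(2)[of 0] by simp
  \<comment> \<open>The cut-off of the flux at t = 0 is invariant under the horizontal shift (h, 0),
    so it passes through summation by parts in x. The time term carries no cut-off, which spares a
    boundary layer at t = 0.\<close>
  define \<kappa> where "\<kappa> = (\<lambda>p::real \<times> real. indicator {0<..} (snd p) :: real)"
  have \<kappa>_meas: "borel_fun \<kappa>" unfolding \<kappa>_def by (simp add: borel_prod[symmetric])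
  have "\<forall>n. \<exists>G. G \<in> borel_measurable borel \<and> (\<forall>x t. \<bar>G (x, t) - F n (x, t)\<bar> \<le> \<epsilon> n \<and>
     \<bar>(A n (x, t + k n) - A n (x, t)) / k n - (if 0 < t then (G (x + h n, t) - G (x, t)) / h n else 0)\<bar> \<le> \<epsilon> n)"
    using con unfolding consistent_def by blast
  then obtain G where G: "\<And>n. G n \<in> borel_measurable borel" "\<And>n x t. \<bar>G n (x, t) - F n (x, t)\<bar> \<le> \<epsilon> n"
    "\<And>n x t. \<bar>(A n (x, t + k n) - A n (x, t)) / k n - (if 0 < t then (G n (x + h n, t) - G n (x, t)) / h n else 0)\<bar> \<le> \<epsilon> n"
    by metis
  have GK: "\<bar>G n p\<bar> \<le> K + 1" for n p
    using G(2)[of n "fst p" "snd p"] F[of n p] \<epsilon>(1)[of n] by simp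
  have G_lim: "AE p in lborel. (\<lambda>n. G n p) \<longlonglongrightarrow> F' p"
    using F'(3)
  proof eventually_elim
    case (elim p)
    have "(\<lambda>n. G n p - F n p) \<longlonglongrightarrow> 0"
      by (rule Lim_null_comparison[OF _ \<epsilon>(2)]) (use G(2)[of _ "fst p" "snd p"] in auto)
    from tendsto_add[OF this elim] show ?case by simp
  qed
  have bq_t: "\<bar>(\<phi> (p - (0, k n)) - \<phi> p) / k n\<bar> \<le> Bt"
    "(\<lambda>n. (\<phi> (p - (0, k n)) - \<phi> p) / k n) \<longlonglongrightarrow> - dt \<phi> p" for p n
  proof -
    obtain x t where p: "p = (x, t)" by force
    show "\<bar>(\<phi> (p - (0, k n)) - \<phi> p) / k n\<bar> \<le> Bt"
      unfolding p diff_Pair diff_zero by (rule backward_quotient(1)[OF D(2) BRt(3) hk(4)])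
    show "(\<lambda>n. (\<phi> (p - (0, k n)) - \<phi> p) / k n) \<longlonglongrightarrow> - dt \<phi> p"
      unfolding p diff_Pair diff_zero by (rule backward_quotient(2)[OF D(2) BRt(3) hk(4,6)])
  qed
  have bq_x: "\<bar>(\<phi> (p - (h n, 0)) - \<phi> p) / h n\<bar> \<le> Bx"
    "(\<lambda>n. (\<phi> (p - (h n, 0)) - \<phi> p) / h n) \<longlonglongrightarrow> - dx \<phi> p" for p n
  proof -
    obtain x t where p: "p = (x, t)" by force
    show "\<bar>(\<phi> (p - (h n, 0)) - \<phi> p) / h n\<bar> \<le> Bx"
      unfolding p diff_Pair diff_zero by (rule backward_quotient(1)[OF D(1) BRx(3) hk(1)])
    show "(\<lambda>n. (\<phi> (p - (h n, 0)) - \<phi> p) / h n) \<longlonglongrightarrow> - dx \<phi> p"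
      unfolding p diff_Pair diff_zero by (rule backward_quotient(2)[OF D(1) BRx(3) hk(1,3)])
  qed
  define T where "T = (\<lambda>n. LBINT p. A n p * ((\<phi> (p - (0, k n)) - \<phi> p) / k n))"
  define X where "X = (\<lambda>n. LBINT p. (\<kappa> p * G n p) * ((\<phi> (p - (h n, 0)) - \<phi> p) / h n))"
  have T_lim: "T \<longlonglongrightarrow> (LBINT p. A' p * - dt \<phi> p)" unfolding T_def
    by (rule integral_difference_tendsto[where K = K and R = R and B = Bt])
       (use A A' meas\<phi> BR(4) hk bq_t in \<open>auto simp: less_imp_le\<close>)
  have X_lim: "X \<longlonglongrightarrow> (LBINT p. (\<kappa> p * F' p) * - dx \<phi> p)" unfolding X_def
  proof (rule integral_difference_tendsto[where K = "1 * (K + 1)" and R = R and B = Bx])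
    show "borel_fun (\<lambda>p. \<kappa> p * G n p)" for n using \<kappa>_meas G(1) by measurable
    show "borel_fun (\<lambda>p. \<kappa> p * F' p)" using \<kappa>_meas F'(1) by measurable
    show "\<bar>\<kappa> p * G n p\<bar> \<le> 1 * (K + 1)" for n p
      unfolding abs_mult using GK K by (intro mult_mono) (auto simp: \<kappa>_def indicator_def)
    show "AE p in lborel. (\<lambda>n. \<kappa> p * G n p) \<longlonglongrightarrow> \<kappa> p * F' p"
      using G_lim by eventually_elim (intro tendsto_intros)
  qed (use meas\<phi> BR(4) hk bq_x in \<open>auto simp: less_imp_le\<close>)
  have "(\<lambda>n. T n - X n) \<longlonglongrightarrow> 0"
  proof (rule Lim_null_comparison)
    have int\<phi>: "integrable lborel (\<lambda>p. \<bar>\<phi> p\<bar>)"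
      by (rule integrable_bounded_support[where B = B and a = "(- R, - R)" and b = "(R, R)"])
         (use meas\<phi> BR(3) BR(4)[OF cbox_norm_bound] in auto)
    show "\<forall>\<^sub>F n in sequentially. norm (T n - X n) \<le> \<epsilon> n * (LBINT p. \<bar>\<phi> p\<bar>)"
    proof (intro always_eventually allI)
      fix n
      let ?T = "\<lambda>p. 1 * (A n (p + (0, k n)) - A n p) / k n * \<phi> p"
      let ?X = "\<lambda>p. \<kappa> p * (G n (p + (h n, 0)) - G n p) / h n * \<phi> p"
      have p1: "(LBINT p. ?T p) = (LBINT p. 1 * A n p * ((\<phi> (p - (0, k n)) - \<phi> p) / k n))"
        "integrable lborel ?T"
        by - (rule summation_by_parts[OF A meas\<phi>(1) BR(3,4)]; simp)+
      have p2: "(LBINT p. ?X p) = (LBINT p. \<kappa> p * G n p * ((\<phi> (p - (h n, 0)) - \<phi> p) / h n))"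
        "integrable lborel ?X"
        by - (rule summation_by_parts[OF G(1) GK meas\<phi>(1) BR(3,4) \<kappa>_meas]; simp add: \<kappa>_def indicator_def)+
      have "T n - X n = (LBINT p. ?T p - ?X p)"
        unfolding Bochner_Integration.integral_diff[OF p1(2) p2(2)] p1(1) p2(1) T_def X_def by simp
      also have "norm \<dots> \<le> (LBINT p. \<epsilon> n * \<bar>\<phi> p\<bar>)"
      proof (rule Bochner_Integration.integral_norm_bound_integral)
        fix p :: "real \<times> real"
        obtain x t where p: "p = (x, t)" by force
        have "?T p - ?X p
          = ((A n (x, t + k n) - A n (x, t)) / k n - (if 0 < t then (G n (x + h n, t) - G n (x, t)) / h n else 0)) * \<phi> p"
          by (simp add: p \<kappa>_def algebra_simps)
        thus "norm (?T p - ?X p) \<le> \<epsilon> n * \<bar>\<phi> p\<bar>"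
          using G(3)[of n x t] by (simp add: abs_mult mult_right_mono del: if_split)
      qed (use p1 p2 int\<phi> in auto)
      finally show "norm (T n - X n) \<le> \<epsilon> n * (LBINT p. \<bar>\<phi> p\<bar>)" by simp
    qed
    show "(\<lambda>n. \<epsilon> n * (LBINT p. \<bar>\<phi> p\<bar>)) \<longlonglongrightarrow> 0" using tendsto_mult_left_zero[OF \<epsilon>(2)] .
  qed
  with tendsto_diff[OF T_lim X_lim]
  have "(LBINT p. A' p * - dt \<phi> p) - (LBINT p. (\<kappa> p * F' p) * - dx \<phi> p) = 0"
    using LIMSEQ_unique by blast
  hence main: "(LBINT p. A' p * dt \<phi> p) = (LBINT p. (\<kappa> p * F' p) * dx \<phi> p)" by simp
  have int: "integrable lborel (\<lambda>p. \<xi> p * F p * \<phi>' p)"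
    if "borel_fun \<xi>" "\<And>p. \<bar>\<xi> p\<bar> \<le> 1" "borel_fun F" "\<And>p. \<bar>F p\<bar> \<le> K"
      "borel_fun \<phi>'" "\<And>p. \<bar>\<phi>' p\<bar> \<le> B'" "\<And>p. R' < norm p \<Longrightarrow> \<phi>' p = 0"
    for \<xi> F \<phi>' :: "real \<times> real \<Rightarrow> real" and B' R'
  proof (rule integrable_mult_bounded_support[where K = "1 * K", OF _ _ that(5-7)])
    show "borel_fun (\<lambda>p. \<xi> p * F p)" using that(1,3) by measurable
    show "\<bar>\<xi> p * F p\<bar> \<le> 1 * K" for p
      unfolding abs_mult using that(2)[of p] that(4)[of p] K by (intro mult_mono) auto
  qed
  define \<kappa>' where "\<kappa>' = (\<lambda>p::real \<times> real. indicator {..0} (snd p) :: real)"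
  have \<kappa>'_meas: "borel_fun \<kappa>'" unfolding \<kappa>'_def by (simp add: borel_prod[symmetric])
  have i1: "integrable lborel (\<lambda>p. \<kappa> p * A' p * dt \<phi> p)"
    by (rule int[OF \<kappa>_meas _ A'(1,2) meas\<phi>(3) BRt(3,4)]) (auto simp: \<kappa>_def indicator_def)
  have i2: "integrable lborel (\<lambda>p. \<kappa>' p * A' p * dt \<phi> p)"
    by (rule int[OF \<kappa>'_meas _ A'(1,2) meas\<phi>(3) BRt(3,4)]) (auto simp: \<kappa>'_def indicator_def)
  have i3: "integrable lborel (\<lambda>p. \<kappa> p * F' p * dx \<phi> p)"
    by (rule int[OF \<kappa>_meas _ F'(1,2) meas\<phi>(2) BRx(3,4)]) (auto simp: \<kappa>_def indicator_def)
  \<comment> \<open>The plane is split at t = 0; on the lower half \<open>A'\<close> is the initial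
    value, and \<open>initial_term\<close> evaluates the integral.\<close>
  have "(LBINT p. A' p * dt \<phi> p) = (LBINT p. \<kappa> p * A' p * dt \<phi> p + \<kappa>' p * A' p * dt \<phi> p)"
    by (intro Bochner_Integration.integral_cong) (auto simp: \<kappa>_def \<kappa>'_def indicator_def)
  also have "\<dots> = (LBINT p. \<kappa> p * A' p * dt \<phi> p) + (LBINT p. \<kappa>' p * A' p * dt \<phi> p)"
    using i1 i2 by simp
  also have "(LBINT p. \<kappa>' p * A' p * dt \<phi> p) = (LBINT p. indicator {..0} (snd p) * (a (fst p) * dt \<phi> p))"
  proof (rule integral_cong_AE)
    show "(\<lambda>p. \<kappa>' p * A' p * dt \<phi> p) \<in> borel_measurable lborel" using i2 by simp
    show "(\<lambda>p. indicator {..0} (snd p) * (a (fst p) * dt \<phi> p)) \<in> borel_measurable lborel"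
      using a(1) meas\<phi>(3) by (simp add: borel_prod[symmetric])
    show "AE p in lborel. \<kappa>' p * A' p * dt \<phi> p = indicator {..0} (snd p) * (a (fst p) * dt \<phi> p)"
      using a(3) by eventually_elim (auto simp: \<kappa>'_def indicator_def)
  qed
  also have "\<dots> = (LBINT x. a x * \<phi> (x, 0))" by (rule initial_term[OF a(1,2) \<phi>])
  finally have eq: "(LBINT p. \<kappa> p * A' p * dt \<phi> p) + (LBINT x. a x * \<phi> (x, 0)) = (LBINT p. \<kappa> p * F' p * dx \<phi> p)"
    using main by simp
  have m: "borel_fun (\<lambda>p. A' p * dt \<phi> p - F' p * dx \<phi> p)" using A'(1) F'(1) meas\<phi> by measurable
  have "(LINT p|half_plane. A' p * dt \<phi> p - F' p * dx \<phi> p)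
      = (LBINT p. \<kappa> p * A' p * dt \<phi> p - \<kappa> p * F' p * dx \<phi> p)"
    unfolding half_plane_integral[OF m] by (simp add: \<kappa>_def algebra_simps)
  also have "\<dots> = (LBINT p. \<kappa> p * A' p * dt \<phi> p) - (LBINT p. \<kappa> p * F' p * dx \<phi> p)"
    using i1 i3 by simp
  also have "(LBINT x. a x * \<phi> (x, 0)) = (LINT x|lebesgue. a x * \<phi> (x, 0))"
  proof -
    have "borel_fun (\<lambda>x. \<phi> (x, 0))"
      by (rule measurable_compose[OF _ meas\<phi>(1)]) (simp add: borel_prod[symmetric])
    hence "(\<lambda>x. a x * \<phi> (x, 0)) \<in> borel_measurable lborel" using a(1) by simp
    thus ?thesis by (rule integral_completion[symmetric])
  qed
  hence "(LINT x|lebesgue. a x * \<phi> (x, 0)) = (LBINT x. a x * \<phi> (x, 0))" by simp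
  ultimately show ?thesis using eq by simp
qed


subsection \<open>Solution of the system\<close>

text \<open>For decreasing \<open>f\<close> and L \<ge> 0 this is the infimal convolution with L
  |t|, the largest L-Lipschitz minorant: points to the left of x cannot lower the infimum. With t
  \<ge> 0 only, monotonicity is inherited at once.\<close>

definition lipschitz_minorant :: "real \<Rightarrow> (real \<Rightarrow> real) \<Rightarrow> real \<Rightarrow> real" where
  "lipschitz_minorant L f x = (INF t\<in>{0..}. f (x + t) + L * t)"

context
  fixes f :: "real \<Rightarrow> real" and lo hi L :: real
  assumes f: "antimono f" and bounds: "\<And>x. lo \<le> f x \<and> f x \<le> hi"
begin

lemma lipschitz_minorant_bdd: "0 \<le> L \<Longrightarrow> bdd_below ((\<lambda>t. f (x + t) + L * t) ` {0..})"
proof (rule bdd_belowI2[of _ lo])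
  fix t :: real assume "0 \<le> L" "t \<in> {0..}"
  hence "0 \<le> L * t" by simp
  thus "lo \<le> f (x + t) + L * t" using bounds[of "x + t"] by simp
qed

lemma lipschitz_minorant_le: "0 \<le> L \<Longrightarrow> lipschitz_minorant L f x \<le> f x"
  using cINF_lower[OF lipschitz_minorant_bdd, of 0] by (simp add: lipschitz_minorant_def)

lemma lipschitz_minorant_greatest:
  "(\<And>t. 0 \<le> t \<Longrightarrow> b \<le> f (x + t) + L * t) \<Longrightarrow> b \<le> lipschitz_minorant L f x"
  unfolding lipschitz_minorant_def by (rule cINF_greatest) auto

lemma lipschitz_minorant_ge: "0 \<le> L \<Longrightarrow> lo \<le> lipschitz_minorant L f x"
proof (rule lipschitz_minorant_greatest)
  fix t :: real assume "0 \<le> L" "0 \<le> t"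
  hence "0 \<le> L * t" by simp
  thus "lo \<le> f (x + t) + L * t" using bounds[of "x + t"] by simp
qed

lemma lipschitz_minorant_antimono: "0 \<le> L \<Longrightarrow> antimono (lipschitz_minorant L f)"
proof (rule antimonoI)
  fix x y :: real assume "0 \<le> L" "x \<le> y"
  show "lipschitz_minorant L f y \<le> lipschitz_minorant L f x"
  proof (rule lipschitz_minorant_greatest)
    fix t :: real assume "0 \<le> t"
    hence "lipschitz_minorant L f y \<le> f (y + t) + L * t"
      unfolding lipschitz_minorant_def using \<open>0 \<le> L\<close> by (intro cINF_lower lipschitz_minorant_bdd) auto
    also have "f (y + t) \<le> f (x + t)" using f \<open>x \<le> y\<close> by (auto simp: antimono_def)
    finally show "lipschitz_minorant L f y \<le> f (x + t) + L * t" by simp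
  qed
qed

lemma lipschitz_minorant_slope:
  assumes "0 \<le> L" "0 \<le> a"
  shows "lipschitz_minorant L f x - lipschitz_minorant L f (x + a) \<le> L * a"
proof -
  have "lipschitz_minorant L f x - L * a \<le> lipschitz_minorant L f (x + a)"
  proof (rule lipschitz_minorant_greatest)
    fix t :: real assume "0 \<le> t"
    hence "lipschitz_minorant L f x \<le> f (x + (a + t)) + L * (a + t)"
      unfolding lipschitz_minorant_def using assms by (intro cINF_lower lipschitz_minorant_bdd) auto
    thus "lipschitz_minorant L f x - L * a \<le> f (x + a + t) + L * t"
      by (simp add: algebra_simps)
  qed
  thus ?thesis by simp
qed

end

text \<open>Shifts up to \<tau> lower f by at most \<epsilon> / 2, by continuity and monotonicity.
  For longer shifts and large n the penalty alone exceeds hi - lo, the largest possible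
  gain.\<close>

lemma lipschitz_minorant_tendsto:
  fixes f :: "real \<Rightarrow> real"
  assumes f: "antimono f" and bounds: "\<And>x. lo \<le> f x \<and> f x \<le> hi" and x: "isCont f x"
  shows "(\<lambda>n. lipschitz_minorant (real (Suc n)) f x) \<longlonglongrightarrow> f x"
proof (rule LIMSEQ_I)
  fix \<epsilon> :: real assume \<epsilon>: "0 < \<epsilon>"
  have "(\<lambda>y. f (x + y)) \<midarrow>0\<rightarrow> f x" using x by (simp add: isCont_def LIM_offset_zero)
  then obtain \<tau>' where \<tau>': "0 < \<tau>'" "\<And>y. y \<noteq> 0 \<Longrightarrow> norm (y - 0) < \<tau>' \<Longrightarrow> norm (f (x + y) - f x) < \<epsilon> / 2"
    using LIM_D[of _ "f x" 0 "\<epsilon> / 2"] half_gt_zero[OF \<epsilon>] by blast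
  define \<tau> where "\<tau> = \<tau>' / 2"
  have \<tau>: "0 < \<tau>" "f x - \<epsilon> / 2 \<le> f (x + \<tau>)" 
  proof -
    show "0 < \<tau>" using \<tau>'(1) by (simp add: \<tau>_def)
    hence "\<bar>f (x + \<tau>) - f x\<bar> < \<epsilon> / 2" using \<tau>'(1) \<tau>'(2)[of \<tau>] by (simp add: \<tau>_def)
    thus "f x - \<epsilon> / 2 \<le> f (x + \<tau>)" by linarith
  qed
  obtain N :: nat where N: "(hi - lo) / \<tau> < real N" using reals_Archimedean2 by blast
  have "norm (lipschitz_minorant (real (Suc n)) f x - f x) < \<epsilon>" if n: "n \<ge> N" for n
  proof -
    have "f x - \<epsilon> / 2 \<le> lipschitz_minorant (real (Suc n)) f x"
    proof (rule lipschitz_minorant_greatest)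
      fix t :: real assume t: "0 \<le> t"
      show "f x - \<epsilon> / 2 \<le> f (x + t) + real (Suc n) * t"
      proof (cases "t \<le> \<tau>")
        case True
        hence "f (x + \<tau>) \<le> f (x + t)" using f by (auto simp: antimono_def)
        moreover have "0 \<le> real (Suc n) * t" using t by simp
        ultimately show ?thesis using \<tau> by linarith
      next
        case False
        have "hi - lo \<le> real N * \<tau>" using N \<tau>(1) by (simp add: field_simps)
        also have "\<dots> \<le> real (Suc n) * t" using n False \<tau>(1) by (intro mult_mono) auto
        finally show ?thesis using bounds[of x] bounds[of "x + t"] \<epsilon> by linarith
      qed
    qed (use f bounds in auto)
    moreover have "lipschitz_minorant (real (Suc n)) f x \<le> f x"
      by (rule lipschitz_minorant_le[OF f bounds]) simp
    ultimately show ?thesis using \<epsilon> by simp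
  qed
  thus "\<exists>N. \<forall>n\<ge>N. norm (lipschitz_minorant (real (Suc n)) f x - f x) < \<epsilon>" by blast
qed

lemma antimono_AE_isCont:
  fixes f :: "real \<Rightarrow> real"
  assumes "antimono f"
  shows "AE x in lborel. isCont f x"
proof -
  have "mono (\<lambda>x. - f x)" using assms by (auto simp: mono_def antimono_def)
  hence "countable {x. \<not> isCont (\<lambda>x. - f x) x}" by (rule mono_ctble_discont)
  hence "{x. \<not> isCont (\<lambda>x. - f x) x} \<in> null_sets lborel" by (rule countable_imp_null_set_lborel)
  hence "AE x in lborel. x \<notin> {x. \<not> isCont (\<lambda>x. - f x) x}" by (rule AE_not_in)
  thus ?thesis
  proof eventually_elim
    case (elim x)
    thus ?case using isCont_minus[of x "\<lambda>x. - f x"] by simp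
  qed
qed

lemma AE_lborel_fst:
  assumes "AE x in lborel. P (x :: real)"
  shows "AE p in lborel. P (fst (p :: real \<times> real))"
proof -
  obtain N where "{x \<in> space lborel. \<not> P x} \<subseteq> N" "emeasure lborel N = 0" "N \<in> sets lborel"
    using assms by (rule AE_E)
  hence N: "N \<in> null_sets lborel" "{x. \<not> P x} \<subseteq> N" by (simp_all add: null_sets_def)
  have "N \<times> UNIV \<in> null_sets (lborel \<Otimes>\<^sub>M lborel :: (real \<times> real) measure)"
    using N(1) by (intro lborel.times_in_null_sets1) auto
  hence "N \<times> UNIV \<in> null_sets (lborel :: (real \<times> real) measure)" by (simp only: lborel_prod)
  hence "AE p in lborel. p \<notin> N \<times> (UNIV :: real set)" by (rule AE_not_in)
  thus ?thesis by eventually_elim (use N(2) in auto)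
qed

lemma L_infinity_half_plane:
  assumes "borel_fun f" "\<And>p. \<bar>f p\<bar> \<le> K"
  shows "f \<in> L_infinity half_plane"
proof -
  have "f \<in> borel_measurable lebesgue" using assms(1) by (simp add: measurable_completion)
  hence "f \<in> borel_measurable half_plane" unfolding half_plane_def by (rule measurable_restrict_space1)
  moreover have "AE p in half_plane. \<bar>f p\<bar> \<le> K" using assms(2) by (intro AE_I2)
  ultimately show ?thesis unfolding L_infinity_def mem_Collect_eq by blast
qed


context
  fixes s \<theta> c :: real
  assumes s: "s > 1" and \<theta>: "\<theta> = (s + 1) / 2" and c: "c = \<theta>\<^sup>2 / s"
begin

text \<open>The exponents add up as (s - 1) / \<theta> + 1 / \<theta> = s / \<theta>. At the vacuum
  both sides vanish, since 0 \<open>powr\<close> a is 0.\<close>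

lemma pressure_of_powr:
  assumes "0 \<le> d"
  shows "c * \<bar>d powr (1 / \<theta>)\<bar> powr (s - 1) * d powr (1 / \<theta>) = c * d powr (s / \<theta>)"
proof (cases "d = 0")
  case False
  have "(d powr (1 / \<theta>)) powr (s - 1) * d powr (1 / \<theta>) = d powr (1 / \<theta> * (s - 1) + 1 / \<theta>)"
    by (simp add: powr_powr powr_add)
  also have "1 / \<theta> * (s - 1) + 1 / \<theta> = s / \<theta>" using s \<theta> by (simp add: field_simps)
  finally show ?thesis by (simp add: mult.assoc)
qed simp

lemma system_solution:
  fixes z0 w0 :: "real \<Rightarrow> real" and c0 c1 c2 :: real
  assumes z0: "antimono z0" and w0: "antimono w0"
    and bounds: "\<And>x. c1 \<le> w0 x \<and> w0 x \<le> c0 \<and> c0 \<le> z0 x \<and> z0 x \<le> c2"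
  obtains v u :: "real \<times> real \<Rightarrow> real" and K :: real
  where "borel_fun v" "borel_fun u" "\<And>p. \<bar>v p\<bar> \<le> K" "\<And>p. \<bar>u p\<bar> \<le> K"
    "generalized_solution_system c s (\<lambda>x. ((z0 x - w0 x) / 2) powr (1 / \<theta>)) (\<lambda>x. (z0 x + w0 x) / 2) v u"
proof -
  define e where "e = (\<lambda>n. 1 / real (Suc n))"
  have e: "0 < e n" "e n \<le> 1" for n by (auto simp: e_def)
  have e0: "e \<longlonglongrightarrow> 0" unfolding e_def by (rule LIMSEQ_Suc[OF lim_1_over_n])
  \<comment> \<open>Raising z by \<open>2 * e n\<close> while w stays below \<open>c0\<close> keeps
    d at least \<open>e n\<close>, away from the vacuum. The minorant supplies the slope bound n + 1
    and converges at continuity points, where the lift disappears as well.\<close>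
  define zn where "zn = (\<lambda>n x. lipschitz_minorant (real (Suc n)) z0 x + 2 * e n)"
  define wn where "wn = (\<lambda>n. lipschitz_minorant (real (Suc n)) w0)"
  have zb: "c0 \<le> z0 x \<and> z0 x \<le> c2" and wb: "c1 \<le> w0 x \<and> w0 x \<le> c0" for x using bounds by auto
  have c12: "c1 \<le> c0" "c0 \<le> c2" using bounds[of 0] by auto
  note mz = lipschitz_minorant_le[OF z0 zb] lipschitz_minorant_ge[OF z0 zb] lipschitz_minorant_antimono[OF z0 zb]
    lipschitz_minorant_slope[OF z0 zb]
  note mw = lipschitz_minorant_le[OF w0 wb] lipschitz_minorant_ge[OF w0 wb] lipschitz_minorant_antimono[OF w0 wb]
    lipschitz_minorant_slope[OF w0 wb]
  have "\<exists>h k Z W. approximate_flow \<theta> c s (e n) (c0 + 2 * e n) (c2 + 2 * e n) c1 c0 (zn n) (wn n) h k Z W" for n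
  proof (rule approximate_solution[OF s \<theta> c, where L = "real (Suc n)" and \<delta> = "e n"])
    show "0 < real (Suc n)" "0 < e n" "0 < e n" "2 * e n \<le> c0 + 2 * e n - c0" using e by simp_all
    show "antimono (zn n)" "antimono (wn n)"
      using mz(3)[of "real (Suc n)"] mw(3)[of "real (Suc n)"] by (auto simp: zn_def wn_def antimono_def)
    show "c0 + 2 * e n \<le> zn n x \<and> zn n x \<le> c2 + 2 * e n" for x
      using mz(1,2)[of "real (Suc n)" x] zb[of x] by (auto simp: zn_def)
    show "c1 \<le> wn n x \<and> wn n x \<le> c0" for x
      using mw(1,2)[of "real (Suc n)" x] wb[of x] by (auto simp: wn_def)
    show "zn n x - zn n (x + a) \<le> real (Suc n) * a" "wn n x - wn n (x + a) \<le> real (Suc n) * a" if "0 \<le> a" for x a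
      using mz(4)[OF _ that, of "real (Suc n)" x] mw(4)[OF _ that, of "real (Suc n)" x] by (auto simp: zn_def wn_def)
  qed
  then obtain h k Z W where
    "\<And>n. approximate_flow \<theta> c s (e n) (c0 + 2 * e n) (c2 + 2 * e n) c1 c0 (zn n) (wn n) (h n) (k n) (Z n) (W n)"
    by metis
  note g = this[unfolded approximate_flow_def]
  note g1 = g[THEN conjunct2]
  note g2 = g1[THEN conjunct2]
  note g3 = g2[THEN conjunct2]
  note g4 = g3[THEN conjunct2]
  note g5 = g4[THEN conjunct2]
  note g6 = g5[THEN conjunct2]
  note g7 = g6[THEN conjunct2]
  note g8 = g7[THEN conjunct2]
  note g9 = g8[THEN conjunct2]
  note g10 = g9[THEN conjunct2]
  note g11 = g10[THEN conjunct2]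
  note g12 = g11[THEN conjunct2]
  note g13 = g12[THEN conjunct2]
  have hk: "0 < h n" "h n < e n" "0 < k n" "k n < e n" for n
    by (rule g[THEN conjunct1] g1[THEN conjunct1] g2[THEN conjunct1] g3[THEN conjunct1])+
  have meas: "borel_fun (Z n)" "borel_fun (W n)" for n
    by (rule g4[THEN conjunct1] g5[THEN conjunct1])+
  have ZW: "c0 + 2 * e n \<le> Z n p" "Z n p \<le> c2 + 2 * e n" "c1 \<le> W n p" "W n p \<le> c0" for n p
    using g6[of n, THEN conjunct1, THEN spec, of p] g7[of n, THEN conjunct1, THEN spec, of p] by simp_all
  have Zmono: "x \<le> x' \<Longrightarrow> t \<le> t' \<Longrightarrow> Z n (x', t') \<le> Z n (x, t)" for n x x' t t'
    by (rule g8[THEN conjunct1, rule_format])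
  have Wmono: "x \<le> x' \<Longrightarrow> t' \<le> t \<Longrightarrow> W n (x', t') \<le> W n (x, t)" for n x x' t t'
    by (rule g9[THEN conjunct1, rule_format])
  have init: "t \<le> 0 \<Longrightarrow> Z n (x, t) = zn n x" "t \<le> 0 \<Longrightarrow> W n (x, t) = wn n x" for n x t
    by (rule g10[THEN conjunct1, rule_format] g11[THEN conjunct1, rule_format]; assumption)+
  have con: "consistent (e n) (h n) (k n) (\<lambda>p. ((Z n p - W n p) / 2) powr (1 / \<theta>)) (\<lambda>p. (Z n p + W n p) / 2)"
    "consistent (e n) (h n) (k n) (\<lambda>p. (Z n p + W n p) / 2) (\<lambda>p. c * ((Z n p - W n p) / 2) powr (s / \<theta>))" for n
    by (rule g12[THEN conjunct1] g13)+
  let ?d = "\<lambda>n p. (Z n p - W n p) / 2"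
  define Kz where "Kz = \<bar>c0\<bar> + \<bar>c1\<bar> + \<bar>c2\<bar> + 2"
  have ZK: "\<bar>Z n p\<bar> \<le> Kz" and WK: "\<bar>W n p\<bar> \<le> Kz" for n p
    using ZW[of n p] e[of n] by (auto simp: Kz_def)
  obtain \<rho>1 Z' where \<rho>1: "strict_mono \<rho>1" "borel_fun Z'" "\<And>p. \<bar>Z' p\<bar> \<le> Kz"
    "AE p in lborel. (\<lambda>n. Z (\<rho>1 n) p) \<longlonglongrightarrow> Z' p"
    using bimonotone_subsequence[of Z Kz 1] meas ZK Zmono by auto
  \<comment> \<open>W decreases in x but increases in t, hence the sign -1. The extraction is made
    from the subsequence already found for Z.\<close>
  obtain \<rho>2 W' where \<rho>2: "strict_mono \<rho>2" "borel_fun W'" "\<And>p. \<bar>W' p\<bar> \<le> Kz"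
    "AE p in lborel. (\<lambda>n. W (\<rho>1 (\<rho>2 n)) p) \<longlonglongrightarrow> W' p"
    using bimonotone_subsequence[of "\<lambda>n. W (\<rho>1 n)" Kz "-1"] meas WK Wmono by auto
  define \<rho> where "\<rho> = \<rho>1 \<circ> \<rho>2"
  have \<rho>: "strict_mono \<rho>" unfolding \<rho>_def by (rule strict_mono_o[OF \<rho>1(1) \<rho>2(1)])
  have lim: "AE p in lborel. (\<lambda>n. Z (\<rho> n) p) \<longlonglongrightarrow> Z' p" "AE p in lborel. (\<lambda>n. W (\<rho> n) p) \<longlonglongrightarrow> W' p"
  proof -
    show "AE p in lborel. (\<lambda>n. Z (\<rho> n) p) \<longlonglongrightarrow> Z' p"
      using \<rho>1(4) by eventually_elim (use LIMSEQ_subseq_LIMSEQ[OF _ \<rho>2(1)] in \<open>auto simp: \<rho>_def o_def\<close>)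
    show "AE p in lborel. (\<lambda>n. W (\<rho> n) p) \<longlonglongrightarrow> W' p" using \<rho>2(4) by (simp add: \<rho>_def)
  qed
  \<comment> \<open>Convergence is known almost everywhere only. The cut-off makes d nonnegative at
    every point, so that the bounds and the formula for the pressure hold without exceptional
    set.\<close>
  define d where "d = (\<lambda>p. max 0 ((Z' p - W' p) / 2))"
  define v u where "v = (\<lambda>p. d p powr (1 / \<theta>))" and "u = (\<lambda>p. (Z' p + W' p) / 2)"
  define P where "P = (\<lambda>p. c * d p powr (s / \<theta>))"
  have pos: "0 < \<theta>" "0 < c" "0 < 1 / \<theta>" "0 < s / \<theta>" using s \<theta> c by auto
  define K where "K = Kz + Kz powr (1 / \<theta>) + c * Kz powr (s / \<theta>)"
  have Kz0: "0 \<le> Kz" by (simp add: Kz_def)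
  have K: "Kz \<le> K" "Kz powr (1 / \<theta>) \<le> K" "c * Kz powr (s / \<theta>) \<le> K"
    using Kz0 pos by (auto simp: K_def)
  have dn: "0 \<le> ?d n p" "?d n p \<le> Kz" for n p
    using ZW[of n p] e[of n] ZK[of n p] WK[of n p] by (auto simp: abs_le_iff)
  have d_bounds: "0 \<le> d p" "d p \<le> Kz" for p
    using \<rho>1(3)[of p] \<rho>2(3)[of p] Kz0 by (auto simp: d_def abs_le_iff max_def)
  have powr_bound: "\<bar>y powr a\<bar> \<le> Kz powr a" if "0 \<le> y" "y \<le> Kz" "0 < a" for y a
    using that by (simp add: powr_mono2)
  have bnd: "\<bar>?d n p powr (1 / \<theta>)\<bar> \<le> K" "\<bar>(Z n p + W n p) / 2\<bar> \<le> K"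
      "\<bar>c * ?d n p powr (s / \<theta>)\<bar> \<le> K" for n p
  proof -
    show "\<bar>?d n p powr (1 / \<theta>)\<bar> \<le> K" using powr_bound[OF dn pos(3), of n p] K by linarith
    show "\<bar>(Z n p + W n p) / 2\<bar> \<le> K" using ZK[of n p] WK[of n p] K by (auto simp: abs_le_iff)
    show "\<bar>c * ?d n p powr (s / \<theta>)\<bar> \<le> K"
      unfolding abs_mult using order.trans[OF mult_left_mono[OF powr_bound[OF dn pos(4), of n p]] K(3)] pos(2) by simp
  qed
  have bnd': "\<bar>v p\<bar> \<le> K" "\<bar>u p\<bar> \<le> K" "\<bar>P p\<bar> \<le> K" for p
  proof -
    show "\<bar>v p\<bar> \<le> K" using powr_bound[OF d_bounds pos(3), of p] K unfolding v_def by linarith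
    show "\<bar>u p\<bar> \<le> K" using \<rho>1(3)[of p] \<rho>2(3)[of p] K by (auto simp: abs_le_iff u_def)
    show "\<bar>P p\<bar> \<le> K"
      unfolding P_def abs_mult using order.trans[OF mult_left_mono[OF powr_bound[OF d_bounds pos(4), of p]] K(3)] pos(2) by simp
  qed
  have meas': "borel_fun v" "borel_fun u" "borel_fun P"
    using \<rho>1(2) \<rho>2(2) unfolding v_def u_def P_def d_def by measurable
  have d_lim: "AE p in lborel. (\<lambda>n. ?d (\<rho> n) p) \<longlonglongrightarrow> d p"
    using lim
  proof eventually_elim
    case (elim p)
    have l: "(\<lambda>n. ?d (\<rho> n) p) \<longlonglongrightarrow> (Z' p - W' p) / 2"
      using elim by (intro tendsto_intros) auto
    hence "0 \<le> (Z' p - W' p) / 2" by (rule LIMSEQ_le_const) (use dn in auto)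
    thus ?case using l by (simp add: d_def max_def)
  qed
  \<comment> \<open>Both exponents used are positive, so the powers are continuous up to d = 0 and
    the limit may reach the vacuum.\<close>
  have powr_lim: "(\<lambda>n. ?d (\<rho> n) p) \<longlonglongrightarrow> y \<Longrightarrow> 0 < a \<Longrightarrow>
      (\<lambda>n. ?d (\<rho> n) p powr a) \<longlonglongrightarrow> y powr a" for p y a
    using dn by (intro tendsto_powr') (auto intro: always_eventually)
  have v_lim: "AE p in lborel. (\<lambda>n. ?d (\<rho> n) p powr (1 / \<theta>)) \<longlonglongrightarrow> v p"
    using d_lim by eventually_elim (unfold v_def, rule powr_lim[OF _ pos(3)])
  have P_lim: "AE p in lborel. (\<lambda>n. c * ?d (\<rho> n) p powr (s / \<theta>)) \<longlonglongrightarrow> P p"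
    using d_lim by eventually_elim (unfold P_def, intro tendsto_mult tendsto_const powr_lim pos(4))
  have u_lim: "AE p in lborel. (\<lambda>n. (Z (\<rho> n) p + W (\<rho> n) p) / 2) \<longlonglongrightarrow> u p"
    using lim by eventually_elim (auto simp: u_def intro!: tendsto_intros)
  let ?v0 = "\<lambda>x. ((z0 x - w0 x) / 2) powr (1 / \<theta>)" and ?u0 = "\<lambda>x. (z0 x + w0 x) / 2"
  \<comment> \<open>The minorants converge where \<open>z0\<close> and \<open>w0\<close> are both
    continuous, that is on almost every vertical line. For t \<le> 0 the approximations do not
    depend on t.\<close>
  have init_lim: "AE p in lborel. snd p \<le> 0 \<longrightarrow> (\<lambda>n. Z (\<rho> n) p) \<longlonglongrightarrow> z0 (fst p) \<and> (\<lambda>n. W (\<rho> n) p) \<longlonglongrightarrow> w0 (fst p)"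
    using AE_lborel_fst[OF antimono_AE_isCont[OF z0]] AE_lborel_fst[OF antimono_AE_isCont[OF w0]]
  proof eventually_elim
    case (elim p)
    have "(\<lambda>n. zn n (fst p)) \<longlonglongrightarrow> z0 (fst p) + 2 * 0" unfolding zn_def
      by (intro tendsto_intros lipschitz_minorant_tendsto[OF z0 zb] elim e0)
    moreover have "(\<lambda>n. wn n (fst p)) \<longlonglongrightarrow> w0 (fst p)" unfolding wn_def
      by (rule lipschitz_minorant_tendsto[OF w0 wb elim(2)])
    ultimately have "(\<lambda>n. zn (\<rho> n) (fst p)) \<longlonglongrightarrow> z0 (fst p)" "(\<lambda>n. wn (\<rho> n) (fst p)) \<longlonglongrightarrow> w0 (fst p)"
      using LIMSEQ_subseq_LIMSEQ[OF _ \<rho>] by (auto simp: o_def)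
    thus ?case using init[of "snd p" _ "fst p"] by simp
  qed
  have v_init: "AE p in lborel. snd p \<le> 0 \<longrightarrow> v p = ?v0 (fst p)"
    using init_lim v_lim
  proof eventually_elim
    case (elim p)
    show ?case
    proof
      assume "snd p \<le> 0"
      with elim(1) have "(\<lambda>n. ?d (\<rho> n) p) \<longlonglongrightarrow> (z0 (fst p) - w0 (fst p)) / 2"
        by (intro tendsto_intros) auto
      from LIMSEQ_unique[OF elim(2) powr_lim[OF this pos(3)]] show "v p = ?v0 (fst p)" .
    qed
  qed
  have u_init: "AE p in lborel. snd p \<le> 0 \<longrightarrow> u p = ?u0 (fst p)"
    using init_lim u_lim
  proof eventually_elim
    case (elim p)
    show ?case
    proof
      assume "snd p \<le> 0"
      with elim(1) have "(\<lambda>n. (Z (\<rho> n) p + W (\<rho> n) p) / 2) \<longlonglongrightarrow> (z0 (fst p) + w0 (fst p)) / 2"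
        by (intro tendsto_intros) auto
      from LIMSEQ_unique[OF elim(2) this] show "u p = ?u0 (fst p)" .
    qed
  qed
  have init_meas: "borel_fun ?v0" "borel_fun ?u0"
    using measurable_antimono[OF z0] measurable_antimono[OF w0] by measurable
  have init_bnd: "\<bar>?v0 x\<bar> \<le> K" "\<bar>?u0 x\<bar> \<le> K" for x
  proof -
    have "0 \<le> (z0 x - w0 x) / 2" "(z0 x - w0 x) / 2 \<le> Kz" using bounds[of x] by (auto simp: Kz_def)
    from powr_bound[OF this pos(3)] K show "\<bar>?v0 x\<bar> \<le> K" by linarith
    show "\<bar>?u0 x\<bar> \<le> K" 
    proof -
      have "\<bar>z0 x\<bar> \<le> K" "\<bar>w0 x\<bar> \<le> K" using bounds[of x] K(1) unfolding Kz_def by linarith+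
      thus ?thesis by (simp add: abs_le_iff)
    qed
  qed
  have hk_lim: "(\<lambda>n. h (\<rho> n)) \<longlonglongrightarrow> 0" "(\<lambda>n. k (\<rho> n)) \<longlonglongrightarrow> 0" "(\<lambda>n. e (\<rho> n)) \<longlonglongrightarrow> 0"
  proof -
    have "h \<longlonglongrightarrow> 0" by (rule real_tendsto_sandwich[OF _ _ tendsto_const e0]) (use hk in \<open>auto intro!: always_eventually less_imp_le\<close>)
    moreover have "k \<longlonglongrightarrow> 0" by (rule real_tendsto_sandwich[OF _ _ tendsto_const e0]) (use hk in \<open>auto intro!: always_eventually less_imp_le\<close>)
    ultimately show "(\<lambda>n. h (\<rho> n)) \<longlonglongrightarrow> 0" "(\<lambda>n. k (\<rho> n)) \<longlonglongrightarrow> 0" "(\<lambda>n. e (\<rho> n)) \<longlonglongrightarrow> 0"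
      using LIMSEQ_subseq_LIMSEQ[OF _ \<rho>] e0 by (auto simp: o_def)
  qed
  have hk1: "h (\<rho> n) \<le> 1" "k (\<rho> n) \<le> 1" for n using hk[of "\<rho> n"] e[of "\<rho> n"] by auto
  have measn: "borel_fun (\<lambda>p. ?d n p powr (1 / \<theta>))"
    "borel_fun (\<lambda>p. (Z n p + W n p) / 2)" for n
    using meas by measurable
  have eq_v: "(LINT p|half_plane. v p * dt \<phi> p - u p * dx \<phi> p) + (LINT x|lebesgue. ?v0 x * \<phi> (x, 0)) = 0"
    if \<phi>: "\<phi> \<in> test_functions" for \<phi>
    by (rule weak_limit[OF measn(1) bnd(1) bnd(2) meas'(1) bnd'(1) v_lim meas'(2) bnd'(2) u_lim
          hk(1) hk1(1) hk_lim(1) hk(3) hk1(2) hk_lim(2) e(2) hk_lim(3) con(1) init_meas(1) init_bnd(1) v_init \<phi>])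
  have eq_u: "(LINT p|half_plane. u p * dt \<phi> p - P p * dx \<phi> p) + (LINT x|lebesgue. ?u0 x * \<phi> (x, 0)) = 0"
    if \<phi>: "\<phi> \<in> test_functions" for \<phi>
    by (rule weak_limit[OF measn(2) bnd(2) bnd(3) meas'(2) bnd'(2) u_lim meas'(3) bnd'(3) P_lim
          hk(1) hk1(1) hk_lim(1) hk(3) hk1(2) hk_lim(2) e(2) hk_lim(3) con(2) init_meas(2) init_bnd(2) u_init \<phi>])
  have P_eq: "P p = c * \<bar>v p\<bar> powr (s - 1) * v p" for p
    unfolding P_def v_def by (rule pressure_of_powr[OF d_bounds(1), symmetric])
  have "generalized_solution_system c s ?v0 ?u0 v u"
    unfolding generalized_solution_system_def
    using L_infinity_half_plane[OF meas'(1) bnd'(1)] L_infinity_half_plane[OF meas'(2) bnd'(2)] eq_v eq_u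
    by (simp add: P_eq)
  thus thesis using that meas' bnd' by blast
qed

end


subsection \<open>Monotone representatives\<close>

lemma Ck_SucI:
  fixes f f' :: "real \<Rightarrow> real"
  assumes f: "\<And>x. (f has_real_derivative f' x) (at x)" and C: "\<And>h. Ck n (\<lambda>x. f' x * h)"
  shows "Ck (Suc n) f"
proof -
  have "(f has_derivative (*) (f' x)) (at x)" for x using f by (simp add: has_field_derivative_def)
  hence "f differentiable (at x)" "frechet_derivative f (at x) = (*) (f' x)" for x
    using frechet_derivative_at[of f "(*) (f' x)" x] by (auto simp: differentiable_def)
  thus ?thesis using C by simp
qed

lemma Ck_diff: "Ck n f \<Longrightarrow> Ck n g \<Longrightarrow> Ck n (\<lambda>x. f x - g x)"
proof (induction n arbitrary: f g)
  case 0
  thus ?case by (auto intro: continuous_intros)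
next
  case (Suc n)
  have d: "(f has_derivative frechet_derivative f (at x)) (at x)" "(g has_derivative frechet_derivative g (at x)) (at x)" for x
    using Suc.prems by (simp_all add: frechet_derivative_works)
  have D: "((\<lambda>x. f x - g x) has_derivative (\<lambda>h. frechet_derivative f (at x) h - frechet_derivative g (at x) h)) (at x)" for x
    using d by (intro derivative_intros)
  have "Ck n (\<lambda>x. frechet_derivative f (at x) h - frechet_derivative g (at x) h)" for h
    using Suc.prems by (intro Suc.IH) auto
  moreover have "frechet_derivative (\<lambda>x. f x - g x) (at x) = (\<lambda>h. frechet_derivative f (at x) h - frechet_derivative g (at x) h)" for x
    using frechet_derivative_at[OF D] by simp
  ultimately show ?case using D by (auto simp: differentiable_def)
qed

text \<open>This family of functions is closed under differentiation; it contains the standard bump function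
  \<open>exp (- 1 / (x - x\<^sup>2))\<close>.\<close>

definition bump :: "real poly \<Rightarrow> nat \<Rightarrow> real \<Rightarrow> real" where
  "bump q m x = (if 0 < x \<and> x < 1 then poly q x * inverse (x - x\<^sup>2) ^ m * exp (- inverse (x - x\<^sup>2)) else 0)"

text \<open>With X = x - x^2, given by the coefficients [0, 1, -1], and X' = 1 - 2 x, this is the
  numerator q' X^2 - m q X' X + q X' of the derivative of q X^(-m) exp (- 1 / X) over the
  denominator X^(m + 2).\<close>

definition bump_next :: "real poly \<Rightarrow> nat \<Rightarrow> real poly" where
  "bump_next q m = pderiv q * [:0, 1, -1:]\<^sup>2 - smult (real m) (q * [:1, -2:] * [:0, 1, -1:]) + q * [:1, -2:]"

text \<open>From (1 + y / n)^n \<le> exp y with y = 1 / X one gets exp (- 1 / X) \<le> (n X)^n. The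
  choice n = m + 2 cancels the pole of order m and leaves X^2, which yields derivative 0 at the end
  points.\<close>

lemma bump_quadratic_bound:
  obtains C where "\<And>x. 0 < x \<Longrightarrow> x < 1 \<Longrightarrow> \<bar>bump q m x\<bar> \<le> C * (x - x\<^sup>2)\<^sup>2"
proof -
  have "compact (poly q ` {0..1})" by (intro compact_continuous_image continuous_intros) auto
  then obtain Q where Q: "\<And>y. y \<in> poly q ` {0..1} \<Longrightarrow> \<bar>y\<bar> \<le> Q"
    using compact_imp_bounded[of "poly q ` {0..1}"] unfolding bounded_iff real_norm_def by blast
  define n where "n = m + 2"
  have "\<bar>bump q m x\<bar> \<le> (Q * real n ^ n) * (x - x\<^sup>2)\<^sup>2" if x: "0 < x" "x < 1" for x
  proof -
    define X where "X = x - x\<^sup>2"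
    have X: "0 < X" using x mult_strict_left_mono[OF x(2,1)] by (simp add: X_def power2_eq_square)
    have "inverse (real n * X) = inverse X / real n" by (simp add: divide_inverse mult.commute)
    hence "inverse (real n * X) ^ n \<le> (1 + inverse X / real n) ^ n"
      using X by (intro power_mono) (auto simp: n_def)
    also have "\<dots> \<le> exp (inverse X)"
      using X by (intro exp_ge_one_plus_x_over_n_power_n) (auto simp: n_def intro: order.trans[of _ 0])
    finally have "inverse (exp (inverse X)) \<le> inverse (inverse (real n * X) ^ n)"
      using X by (intro le_imp_inverse_le) (auto simp: n_def)
    hence e: "exp (- inverse X) \<le> real n ^ n * X ^ n"
      by (simp add: exp_minus power_inverse power_mult_distrib)
    have "\<bar>poly q x\<bar> \<le> Q" using Q x by auto
    hence "\<bar>bump q m x\<bar> \<le> Q * (inverse X ^ m * (real n ^ n * X ^ n))"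
      unfolding bump_def using x X e by (auto simp: abs_mult X_def[symmetric] mult.assoc intro!: mult_mono)
    also have "inverse X ^ m * (real n ^ n * X ^ n) = real n ^ n * X\<^sup>2 * (inverse X * X) ^ m"
    proof -
      have "X ^ n = X ^ m * X\<^sup>2" by (simp add: n_def power_add power2_eq_square)
      thus ?thesis by (simp add: power_mult_distrib)
    qed
    also have "inverse X * X = 1" using X by simp
    finally show ?thesis by (simp add: X_def algebra_simps)
  qed
  thus thesis using that by blast
qed

lemma bump_deriv: "(bump q m has_real_derivative bump (bump_next q m) (m + 2) x) (at x)"
proof (cases "0 < x \<and> x < 1")
  case True
  define X where "X = x - x\<^sup>2"
  have X: "0 < X" using True mult_strict_left_mono[of x 1 x] by (simp add: X_def power2_eq_square)
  define Y where "Y = inverse X"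
  have Yx: "inverse (x - x\<^sup>2) = Y" by (simp add: Y_def X_def)
  have XY: "X * Y = 1" using X by (simp add: Y_def)
  have dY: "((\<lambda>x. inverse (x - x\<^sup>2)) has_real_derivative - ((1 - 2 * x) * Y\<^sup>2)) (at x)"
    using X by (auto intro!: derivative_eq_intros simp: Y_def X_def power2_eq_square)
  have dYm: "((\<lambda>x. inverse (x - x\<^sup>2) ^ m) has_real_derivative - (real m * (1 - 2 * x) * Y ^ (m + 1))) (at x)"
  proof (cases m)
    case (Suc k)
    show ?thesis
      by (rule DERIV_cong[OF DERIV_power[OF dY]], unfold Yx)
         (simp add: Suc power2_eq_square algebra_simps)
  qed simp
  have d: "((\<lambda>x. poly q x * inverse (x - x\<^sup>2) ^ m * exp (- inverse (x - x\<^sup>2))) has_real_derivative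
      (poly (pderiv q) x * Y ^ m - poly q x * (real m * (1 - 2 * x) * Y ^ (m + 1))) * exp (- Y)
       + poly q x * Y ^ m * (exp (- Y) * ((1 - 2 * x) * Y\<^sup>2))) (at x)"
    by (rule DERIV_cong[OF DERIV_mult[OF DERIV_mult[OF poly_DERIV dYm] DERIV_chain2[OF DERIV_exp DERIV_minus[OF dY]]]], unfold Yx)
       (simp add: algebra_simps)
  have "(poly (pderiv q) x * Y ^ m - poly q x * (real m * (1 - 2 * x) * Y ^ (m + 1))) * exp (- Y)
       + poly q x * Y ^ m * (exp (- Y) * ((1 - 2 * x) * Y\<^sup>2))
     = (poly (pderiv q) x * (X * Y)\<^sup>2 * Y ^ m - poly q x * (real m * (1 - 2 * x) * (X * Y) * Y ^ (m + 1))) * exp (- Y)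
       + poly q x * Y ^ m * (exp (- Y) * ((1 - 2 * x) * Y\<^sup>2))" by (simp add: XY)
  also have "\<dots> = bump (bump_next q m) (m + 2) x"
  proof -
    have p: "poly [:0, 1, -1:] x = X" "poly [:1, -2:] x = 1 - 2 * x" by (simp_all add: X_def power2_eq_square algebra_simps)
    have "poly (bump_next q m) x = poly (pderiv q) x * X\<^sup>2 - real m * (poly q x * (1 - 2 * x) * X) + poly q x * (1 - 2 * x)"
      by (simp only: bump_next_def poly_add poly_diff poly_mult poly_smult poly_power p)
    moreover have "bump (bump_next q m) (m + 2) x = poly (bump_next q m) x * (Y ^ m * Y\<^sup>2) * exp (- Y)"
      using True unfolding bump_def Yx by (simp add: power_add power2_eq_square)
    ultimately show ?thesis by (simp only: power2_eq_square) (simp add: algebra_simps)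
  qed
  finally have "((\<lambda>x. poly q x * inverse (x - x\<^sup>2) ^ m * exp (- inverse (x - x\<^sup>2))) has_real_derivative
      bump (bump_next q m) (m + 2) x) (at x)" using d by simp
  thus ?thesis
    by (rule has_field_derivative_transform_within_open[where S = "{0<..<1}"]) (use True in \<open>auto simp: bump_def\<close>)
next
  case False
  obtain C where C: "\<And>x. 0 < x \<Longrightarrow> x < 1 \<Longrightarrow> \<bar>bump q m x\<bar> \<le> C * (x - x\<^sup>2)\<^sup>2"
    using bump_quadratic_bound[of q m] by blast
  \<comment> \<open>Since x lies outside (0, 1), a point x + h inside it is within |h| of an end
    point, and there y - y^2 \<le> |h|.\<close>
  have bound: "\<bar>bump q m (x + h)\<bar> \<le> \<bar>C\<bar> * h\<^sup>2" for h
  proof (cases "0 < x + h \<and> x + h < 1")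
    case True
    define y where "y = x + h"
    have y: "0 < y" "y < 1" using True by (auto simp: y_def)
    have "0 \<le> y - y\<^sup>2" "y - y\<^sup>2 \<le> y" "y - y\<^sup>2 \<le> 1 - y"
    proof -
      have "y - y\<^sup>2 = y * (1 - y)" by (simp add: power2_eq_square algebra_simps)
      moreover have "y * (1 - y) \<le> 1 * (1 - y)" "0 \<le> y * (1 - y)" using y by (auto intro!: mult_right_mono)
      ultimately show "0 \<le> y - y\<^sup>2" "y - y\<^sup>2 \<le> 1 - y" by auto
    qed simp
    moreover have "y \<le> \<bar>h\<bar> \<or> 1 - y \<le> \<bar>h\<bar>" using False by (auto simp: y_def)
    ultimately have "0 \<le> y - y\<^sup>2" "y - y\<^sup>2 \<le> \<bar>h\<bar>" by linarith+
    hence "(y - y\<^sup>2)\<^sup>2 \<le> \<bar>h\<bar>\<^sup>2" by (intro power_mono)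
    hence "\<bar>C\<bar> * (y - y\<^sup>2)\<^sup>2 \<le> \<bar>C\<bar> * h\<^sup>2" by (intro mult_left_mono) auto
    moreover have "C * (y - y\<^sup>2)\<^sup>2 \<le> \<bar>C\<bar> * (y - y\<^sup>2)\<^sup>2" by (intro mult_right_mono) auto
    ultimately show ?thesis using C[OF y] by (simp add: y_def)
  qed (auto simp: bump_def)
  have "((\<lambda>h. (bump q m (x + h) - bump q m x) / h) \<longlongrightarrow> 0) (at 0)"
  proof (rule Lim_null_comparison[where g = "\<lambda>h. \<bar>C\<bar> * \<bar>h\<bar>"])
    have "norm ((bump q m (x + h) - bump q m x) / h) \<le> \<bar>C\<bar> * \<bar>h\<bar>" if "h \<noteq> 0" for h
    proof -
      have "\<bar>bump q m (x + h)\<bar> \<le> \<bar>C\<bar> * (\<bar>h\<bar> * \<bar>h\<bar>)" using bound[of h] by (simp add: power2_eq_square)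
      moreover have "bump q m x = 0" using False by (auto simp: bump_def)
      ultimately show ?thesis using that by (simp add: divide_le_eq mult.assoc)
    qed
    thus "\<forall>\<^sub>F h in at 0. norm ((bump q m (x + h) - bump q m x) / h) \<le> \<bar>C\<bar> * \<bar>h\<bar>"
      by (auto simp: eventually_at_filter)
    have "((\<lambda>h. \<bar>C\<bar> * \<bar>h\<bar>) \<longlongrightarrow> \<bar>C\<bar> * \<bar>0\<bar>) (at 0)" by (intro tendsto_intros)
    thus "((\<lambda>h. \<bar>C\<bar> * \<bar>h\<bar>) \<longlongrightarrow> 0) (at 0)" by simp
  qed
  moreover have "bump (bump_next q m) (m + 2) x = 0" using False by (auto simp: bump_def)
  ultimately show ?thesis by (simp add: DERIV_def)
qed

lemma scaled_deriv: "((\<lambda>x. (x - a) / r) has_real_derivative 1 / r) (at x)" for a r x :: real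
proof -
  have "((\<lambda>x. x - a) has_real_derivative 1) (at x)" by (auto intro!: derivative_eq_intros)
  thus ?thesis by (rule DERIV_cdivide)
qed

text \<open>The induction runs over all q and m at once; the factor from rescaling and from the
  direction of the derivative is absorbed into the polynomial.\<close>

lemma Ck_bump: "Ck n (\<lambda>x. bump q m ((x - a) / r))"
proof (induction n arbitrary: q m)
  case 0
  have "continuous_on UNIV (bump q m)"
    by (rule DERIV_continuous_on[OF has_field_derivative_at_within[OF bump_deriv]])
  moreover have "continuous_on UNIV (\<lambda>x. (x - a) / r)"
    by (rule DERIV_continuous_on[OF has_field_derivative_at_within[OF scaled_deriv]])
  ultimately have "continuous_on UNIV (\<lambda>x. bump q m ((x - a) / r))"
    by (rule continuous_on_compose2[of UNIV "bump q m" UNIV "\<lambda>x. (x - a) / r"]) simp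
  thus ?case by simp
next
  case (Suc n)
  show ?case
  proof (rule Ck_SucI)
    show "((\<lambda>x. bump q m ((x - a) / r)) has_real_derivative
        bump (bump_next q m) (m + 2) ((x - a) / r) * (1 / r)) (at x)" for x
      by (rule DERIV_chain2[OF bump_deriv scaled_deriv])
    fix h
    have "(\<lambda>x. bump (bump_next q m) (m + 2) ((x - a) / r) * (1 / r) * h)
        = (\<lambda>x. bump (smult (h / r) (bump_next q m)) (m + 2) ((x - a) / r))"
      by (auto simp: bump_def fun_eq_iff)
    thus "Ck n (\<lambda>x. bump (bump_next q m) (m + 2) ((x - a) / r) * (1 / r) * h)"
      using Suc.IH by simp
  qed
qed

text \<open>Differences of rescaled translates of \<open>S\<close> will serve as nonnegative test
  functions, and the derivative of \<open>S\<close> is a probability density, that is an averaging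
  kernel.\<close>

lemma smooth_step:
  obtains \<rho> S :: "real \<Rightarrow> real"
  where "continuous_on UNIV \<rho>" "\<And>x. 0 \<le> \<rho> x" "\<And>x. x \<notin> {0..1} \<Longrightarrow> \<rho> x = 0"
    "(LBINT x. \<rho> x) = 1"
    "\<And>x. (S has_real_derivative \<rho> x) (at x)" "\<And>x. x \<le> 0 \<Longrightarrow> S x = 0" "\<And>x. 1 \<le> x \<Longrightarrow> S x = 1"
    "\<And>n a r. Ck n (\<lambda>x. S ((x - a) / r))"
proof -
  define \<beta> where "\<beta> = bump [:1:] 0"
  have \<beta>: "0 \<le> \<beta> x" "x \<notin> {0<..<1} \<Longrightarrow> \<beta> x = 0" "x \<in> {0<..<1} \<Longrightarrow> 0 < \<beta> x" for x by (auto simp: \<beta>_def bump_def)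
  have cont: "continuous_on A \<beta>" for A
    unfolding \<beta>_def by (rule DERIV_continuous_on[OF has_field_derivative_at_within[OF bump_deriv]])
  \<comment> \<open>The lower limit -1 lies to the left of the support, so 0 is interior to the
    interval of integration and has a two-sided derivative.\<close>
  define T where "T = (\<lambda>x. integral {-1..x} \<beta>)"
  have T0: "T x = 0" if "x \<le> 0" for x
  proof -
    have "integral {-1..x} \<beta> = integral {-1..x} (\<lambda>_. 0)" using that \<beta>(2) by (intro integral_cong) auto
    thus ?thesis by (simp add: T_def)
  qed
  have T: "(T has_real_derivative \<beta> x) (at x)" for x
  proof (cases "x < 0")
    case True
    have "((\<lambda>_. 0) has_real_derivative \<beta> x) (at x)" using \<beta>(2)[of x] True by simp
    thus ?thesis
      by (rule has_field_derivative_transform_within_open[where S = "{..<0}"]) (use True T0 in auto)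
  next
    case False
    have "(T has_real_derivative \<beta> x) (at x within {-1..x + 1})"
      unfolding T_def by (rule integral_has_real_derivative[OF cont]) (use False in simp)
    moreover have "at x within {-1..x + 1} = at x" using False by (intro at_within_Icc_at) auto
    ultimately show ?thesis by (simp only:)
  qed
  \<comment> \<open>The total mass \<open>T 1\<close> is a value of \<beta> inside (0, 1), hence
    positive, and may be divided by.\<close>
  have "\<exists>z>0. z < 1 \<and> T 1 - T 0 = (1 - 0) * \<beta> z"
    by (rule MVT2[of 0 1 T \<beta>]) (simp_all add: T)
  then obtain \<xi> where \<xi>: "0 < \<xi>" "\<xi> < 1" "T 1 = \<beta> \<xi>" using T0 by auto
  hence N: "0 < T 1" using \<beta>(3) by auto
  have T1: "T x = T 1" if "1 \<le> x" for x
  proof (cases "x = 1")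
    case False
    have "\<exists>z>1. z < x \<and> T x - T 1 = (x - 1) * \<beta> z"
      by (rule MVT2[of 1 x T \<beta>]) (use that False in \<open>simp_all add: T\<close>)
    then obtain z where "1 < z" "T x - T 1 = (x - 1) * \<beta> z" by blast
    thus ?thesis using \<beta>(2)[of z] by simp
  qed simp
  show thesis
  proof (rule that[of "\<lambda>x. \<beta> x / T 1" "\<lambda>x. T x / T 1"])
    show "continuous_on UNIV (\<lambda>x. \<beta> x / T 1)" using cont N by (intro continuous_intros) auto
    show "0 \<le> \<beta> x / T 1" for x using \<beta>(1) N by simp
    show "\<beta> x / T 1 = 0" if "x \<notin> {0..1}" for x using \<beta>(2)[of x] that by auto
    have "(LBINT x. indicator {0..1} x *\<^sub>R \<beta> x) = T 1 - T 0"
      by (rule integral_FTC_atLeastAtMost)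
         (use T cont in \<open>auto simp: has_real_derivative_iff_has_vector_derivative[symmetric] intro: has_field_derivative_at_within\<close>)
    moreover have "(LBINT x. indicator {0..1} x *\<^sub>R \<beta> x) = (LBINT x. \<beta> x)"
    proof (intro Bochner_Integration.integral_cong refl)
      fix x show "indicator {0..1} x *\<^sub>R \<beta> x = \<beta> x" using \<beta>(2)[of x] by (cases "x \<in> {0..1}") auto
    qed
    ultimately show "(LBINT x. \<beta> x / T 1) = 1" using N T0[of 0] by simp
    show D: "((\<lambda>x. T x / T 1) has_real_derivative \<beta> x / T 1) (at x)" for x by (rule DERIV_cdivide[OF T])
    show "T x / T 1 = 0" if "x \<le> 0" for x using T0[OF that] by simp
    show "T x / T 1 = 1" if "1 \<le> x" for x using T1[OF that] N by simp
    fix n :: nat and a r :: real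
    have D': "((\<lambda>x. T ((x - a) / r) / T 1) has_real_derivative \<beta> ((x - a) / r) / T 1 * (1 / r)) (at x)" for x
      by (rule DERIV_chain2[OF D scaled_deriv])
    show "Ck n (\<lambda>x. T ((x - a) / r) / T 1)"
    proof (cases n)
      case 0
      thus ?thesis using DERIV_continuous_on[OF has_field_derivative_at_within[OF D']] by simp
    next
      case (Suc k)
      have "(\<lambda>x. \<beta> ((x - a) / r) / T 1 * (1 / r) * h) = (\<lambda>x. bump [:h / (T 1 * r):] 0 ((x - a) / r))" for h
        by (auto simp: \<beta>_def bump_def fun_eq_iff)
      thus ?thesis unfolding Suc by (intro Ck_SucI[OF D']) (simp add: Ck_bump)
    qed
  qed
qed


section \<open>Interval integrals and averaging\<close>

abbreviation Ioc_integral :: "real \<Rightarrow> real \<Rightarrow> (real \<Rightarrow> real) \<Rightarrow> real" where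
  "Ioc_integral a b F \<equiv> LBINT x. indicator {a<..b} x * F x"

lemma indicator_Ioc_split:
  fixes a b c x :: real
  assumes "a \<le> b" "b \<le> c"
  shows "(indicator {a<..c} x :: real) = indicator {a<..b} x + indicator {b<..c} x"
proof -
  have "{a<..b} \<union> {b<..c} = {a<..c}" using assms by auto
  moreover have "(indicator ({a<..b} \<union> {b<..c}) x :: real) = indicator {a<..b} x + indicator {b<..c} x"
    by (rule indicator_disj_union) force
  ultimately show ?thesis by (simp only:)
qed

lemma integrable_bounded_Ioc:
  fixes f :: "real \<Rightarrow> real"
  assumes "borel_fun f" "\<And>x. \<bar>f x\<bar> \<le> K"
  shows "integrable lborel (\<lambda>x. indicator {a<..b} x * f x)"
proof (rule integrable_bounded_support[where B = K and a = a and b = b])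
  show "\<bar>indicator {a<..b} x * f x\<bar> \<le> K" for x
    using assms(2)[of x] by (auto simp: indicator_def)
qed (use assms in \<open>auto simp: indicator_def\<close>)

text \<open>Adding \<open>K\<close> turns both functions into densities of measures. These agree on
  half-open intervals, an intersection-stable generator of the Borel sets, and densities are unique
  almost everywhere.\<close>

lemma AE_eq_from_Ioc_integrals:
  fixes f g :: "real \<Rightarrow> real"
  assumes f: "borel_fun f" "\<And>x. \<bar>f x\<bar> \<le> K"
    and g: "borel_fun g" "\<And>x. \<bar>g x\<bar> \<le> K"
    and eq: "\<And>a b. a \<le> b \<Longrightarrow>
      Ioc_integral a b f = Ioc_integral a b g"
  shows "AE x in lborel. f x = g x"
proof -
  have em: "emeasure (density lborel (\<lambda>x. ennreal (k x + K))) {a<..b}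
      = ennreal (Ioc_integral a b (\<lambda>x. (k x + K)))"
    if k: "borel_fun k" "\<And>x. \<bar>k x\<bar> \<le> K" for k :: "real \<Rightarrow> real" and a b
  proof -
    have pos: "0 \<le> k x + K" "\<bar>k x + K\<bar> \<le> 2 * K" for x using k(2)[of x] by (auto simp: abs_le_iff)
    have "emeasure (density lborel (\<lambda>x. ennreal (k x + K))) {a<..b}
        = (\<integral>\<^sup>+x. ennreal (indicator {a<..b} x * (k x + K)) \<partial>lborel)"
      using k by (subst emeasure_density) (auto intro!: nn_integral_cong simp: indicator_def)
    also have "\<dots> = ennreal (Ioc_integral a b (\<lambda>x. (k x + K)))"
    proof (rule nn_integral_eq_integral)
      show "integrable lborel (\<lambda>x. indicator {a<..b} x * (k x + K))"
        using k by (intro integrable_bounded_Ioc[OF _ pos(2)]) auto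
    qed (use pos in auto)
    finally show ?thesis .
  qed
  have shift: "Ioc_integral a b (\<lambda>x. (k x + K))
      = Ioc_integral a b k + Ioc_integral a b (\<lambda>x. K)"
    if k: "borel_fun k" "\<And>x. \<bar>k x\<bar> \<le> K" for k :: "real \<Rightarrow> real" and a b
  proof -
    have "integrable lborel (\<lambda>x. indicator {a<..b} x * K)"
      by (rule integrable_bounded_Ioc[where K = "\<bar>K\<bar>"]) auto
    from Bochner_Integration.integral_add[OF integrable_bounded_Ioc[OF k] this]
    show ?thesis by (simp only: distrib_left)
  qed
  have "density lborel (\<lambda>x. ennreal (f x + K)) = density lborel (\<lambda>x. ennreal (g x + K))"
  proof (rule measure_eqI_generator_eq[where \<Omega> = UNIV and E = "range (\<lambda>(a, b). {a<..b::real})"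
        and A = "\<lambda>i. {- real i<..real i}"])
    fix X assume "X \<in> range (\<lambda>(a, b). {a<..b::real})"
    then obtain a b where X: "X = {a<..b}" by auto
    show "emeasure (density lborel (\<lambda>x. ennreal (f x + K))) X = emeasure (density lborel (\<lambda>x. ennreal (g x + K))) X"
    proof (cases "a \<le> b")
      case True
      thus ?thesis unfolding X em[OF f] em[OF g] shift[OF f] shift[OF g] eq[OF True] by simp
    qed (simp add: X)
  next
    have b: "sets (borel :: real measure) = sigma_sets UNIV (range (\<lambda>(a, b). {a<..b::real}))"
      by (subst borel_sigma_sets_Ioc) (auto intro: sets_measure_of)
    thus "sets (density lborel (\<lambda>x. ennreal (f x + K))) = sigma_sets UNIV (range (\<lambda>(a, b). {a<..b::real}))"
      "sets (density lborel (\<lambda>x. ennreal (g x + K))) = sigma_sets UNIV (range (\<lambda>(a, b). {a<..b::real}))"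
      by simp_all
    show "Int_stable (range (\<lambda>(a, b). {a<..b::real}))"
    proof (rule Int_stableI)
      fix A B assume "A \<in> range (\<lambda>(a, b). {a<..b::real})" "B \<in> range (\<lambda>(a, b). {a<..b::real})"
      then obtain a b c d where "A = {a<..b}" "B = {c<..d}" by auto
      hence "A \<inter> B = (\<lambda>(a, b). {a<..b}) (max a c, min b d)" by auto
      thus "A \<inter> B \<in> range (\<lambda>(a, b). {a<..b::real})" by (rule range_eqI)
    qed
    show "range (\<lambda>i. {- real i<..real i}) \<subseteq> range (\<lambda>(a, b). {a<..b::real})" by auto
    show "(\<Union>i. {- real (i::nat)<..real i}) = UNIV"
    proof (intro equalityI subset_UNIV subsetI)
      fix x :: real
      obtain i :: nat where "\<bar>x\<bar> < real i" using reals_Archimedean2 by blast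
      hence "x \<in> {- real i<..real i}" by auto
      thus "x \<in> (\<Union>i. {- real (i::nat)<..real i})" by blast
    qed
    show "emeasure (density lborel (\<lambda>x. ennreal (f x + K))) {- real i<..real i} \<noteq> \<infinity>" for i :: nat
      unfolding em[OF f] by simp
  qed simp
  moreover have "sigma_finite_measure (lborel :: real measure)" by (rule sigma_finite_lborel)
  ultimately have "AE x in lborel. ennreal (f x + K) = ennreal (g x + K)"
    using f(1) g(1) by (intro sigma_finite_measure.density_unique) auto
  thus ?thesis
  proof eventually_elim
    case (elim x)
    have "0 \<le> f x + K" "0 \<le> g x + K" using f(2)[of x] g(2)[of x] by auto
    thus ?case using elim by simp
  qed
qed

text \<open>For a kernel on [0, 1] and r > 0 this averages F over [a, a + r], to the right of a. It
  is used with the smooth density, for which it can be tested against a distributional inequality,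
  and with the indicator of (0, 1], the plain average.\<close>

definition smear :: "(real \<Rightarrow> real) \<Rightarrow> real \<Rightarrow> (real \<Rightarrow> real) \<Rightarrow> real \<Rightarrow> real" where
  "smear \<rho> r F a = (LBINT y. F (a + r * y) * \<rho> y)"

context
  fixes \<rho> F :: "real \<Rightarrow> real" and B K :: real
  assumes \<rho>: "borel_fun \<rho>" "\<And>y. 0 \<le> \<rho> y" "\<And>y. \<rho> y \<le> B"
      "\<And>y. y \<notin> {0..1} \<Longrightarrow> \<rho> y = 0" "(LBINT y. \<rho> y) = 1"
    and F: "borel_fun F" "\<And>x. \<bar>F x\<bar> \<le> K"
begin

lemma kernel_integrable: "integrable lborel \<rho>"
  by (rule integrable_bounded_support[where B = B and a = 0 and b = 1]) (use \<rho> in auto)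

lemma smear_integrable: "integrable lborel (\<lambda>y. F (a + r * y) * \<rho> y)"
proof (rule integrable_mult_bounded_support[OF _ F(2) \<rho>(1), where B = B and R = 1])
  show "borel_fun (\<lambda>y. F (a + r * y))" using F(1) by measurable
  show "\<bar>\<rho> y\<bar> \<le> B" for y using \<rho>(2,3)[of y] by simp
  show "\<rho> y = 0" if "1 < norm y" for y using that by (intro \<rho>(4)) auto
qed

lemma smear_bounded: "\<bar>smear \<rho> r F a\<bar> \<le> K"
proof -
  have "norm (smear \<rho> r F a) \<le> (LBINT y. K * \<rho> y)" unfolding smear_def
  proof (rule Bochner_Integration.integral_norm_bound_integral[OF smear_integrable])
    show "integrable lborel (\<lambda>y. K * \<rho> y)" using kernel_integrable by simp
    show "norm (F (a + r * y) * \<rho> y) \<le> K * \<rho> y" for y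
      using F(2)[of "a + r * y"] \<rho>(2)[of y] by (simp add: abs_mult mult_right_mono)
  qed
  thus ?thesis using \<rho>(5) by simp
qed

lemma smear_measurable: "borel_fun (smear \<rho> r F)"
proof -
  have "(\<lambda>p. F (fst p + r * snd p) * \<rho> (snd p)) \<in> borel_measurable (borel \<Otimes>\<^sub>M borel)"
    using F(1) \<rho>(1) by measurable
  hence "(\<lambda>(a, y). F (a + r * y) * \<rho> y) \<in> borel_measurable (borel \<Otimes>\<^sub>M lborel)"
    by (simp add: case_prod_beta cong: measurable_cong_sets)
  from lborel.borel_measurable_lebesgue_integral[OF this]
  show ?thesis unfolding smear_def[abs_def] by simp
qed

text \<open>After translation the two integrals run over intervals that differ by pieces of length h
  at the two ends, each contributing at most K h.\<close>

lemma Ioc_integral_translate: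
  assumes "\<alpha> \<le> \<beta>" "0 \<le> h"
  shows "\<bar>Ioc_integral \<alpha> \<beta> (\<lambda>a. F (a + h)) - Ioc_integral \<alpha> \<beta> F\<bar> \<le> 2 * K * h"
proof -
  have K: "0 \<le> K" using F(2)[of 0] by simp
  have Ioc_const: "Ioc_integral e (e + h) (\<lambda>a. K) = h * K" for e
  proof -
    have "Ioc_integral e (e + h) (\<lambda>a. K) = measure lborel ({e<..e + h} \<inter> space lborel) * K"
      by (subst Bochner_Integration.integral_mult_left_zero, subst Bochner_Integration.integral_indicator) (rule refl)
    also have "{e<..e + h} \<inter> space lborel = {e<..e + h}" by simp
    also have "measure lborel {e<..e + h} = h" using assms(2) measure_lborel_Ioc[of e "e + h"] by linarith
    finally show ?thesis .
  qed
  have m: "borel_fun (\<lambda>a. indicator {\<alpha> + h<..\<beta> + h} a * F a)" using F by measurable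
  have "Ioc_integral \<alpha> \<beta> (\<lambda>a. F (a + h)) = (LBINT a. indicator {\<alpha> + h<..\<beta> + h} (h + a) * F (h + a))"
    by (intro Bochner_Integration.integral_cong) (auto simp: indicator_def add.commute)
  also have "\<dots> = Ioc_integral (\<alpha> + h) (\<beta> + h) F" by (rule integral_translate[OF m])
  finally have "Ioc_integral \<alpha> \<beta> (\<lambda>a. F (a + h)) - Ioc_integral \<alpha> \<beta> F
      = (LBINT a. indicator {\<alpha> + h<..\<beta> + h} a * F a - indicator {\<alpha><..\<beta>} a * F a)"
    by (simp add: integrable_bounded_Ioc[OF F])
  hence "\<bar>Ioc_integral \<alpha> \<beta> (\<lambda>a. F (a + h)) - Ioc_integral \<alpha> \<beta> F\<bar>
      = \<bar>LBINT a. indicator {\<alpha> + h<..\<beta> + h} a * F a - indicator {\<alpha><..\<beta>} a * F a\<bar>" by (rule arg_cong)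
  also have "\<dots> \<le> (LBINT a. indicator {\<alpha><..\<alpha> + h} a * K + indicator {\<beta><..\<beta> + h} a * K)"
    unfolding real_norm_def[symmetric]
  proof (rule Bochner_Integration.integral_norm_bound_integral)
    show "integrable lborel (\<lambda>a. indicator {\<alpha> + h<..\<beta> + h} a * F a - indicator {\<alpha><..\<beta>} a * F a)"
      by (intro Bochner_Integration.integrable_diff integrable_bounded_Ioc[OF F])
    show "integrable lborel (\<lambda>a. indicator {\<alpha><..\<alpha> + h} a * K + indicator {\<beta><..\<beta> + h} a * K)"
      by (intro Bochner_Integration.integrable_add integrable_bounded_Ioc[where K = K]) (use K in auto)
    show "norm (indicator {\<alpha> + h<..\<beta> + h} a * F a - indicator {\<alpha><..\<beta>} a * F a)
        \<le> indicator {\<alpha><..\<alpha> + h} a * K + indicator {\<beta><..\<beta> + h} a * K" for a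
    proof -
      have "\<bar>indicator {\<alpha> + h<..\<beta> + h} a - indicator {\<alpha><..\<beta>} a :: real\<bar> \<le> indicator {\<alpha><..\<alpha> + h} a + indicator {\<beta><..\<beta> + h} a"
      proof -
        have "(indicator {\<alpha><..\<beta> + h} a :: real) = indicator {\<alpha><..\<beta>} a + indicator {\<beta><..\<beta> + h} a"
          "(indicator {\<alpha><..\<beta> + h} a :: real) = indicator {\<alpha><..\<alpha> + h} a + indicator {\<alpha> + h<..\<beta> + h} a"
          using assms by (intro indicator_Ioc_split; linarith)+
        moreover have "0 \<le> (indicator {\<alpha><..\<alpha> + h} a :: real)" "0 \<le> (indicator {\<beta><..\<beta> + h} a :: real)" by simp_all
        ultimately show ?thesis by linarith
      qed
      hence "\<bar>indicator {\<alpha> + h<..\<beta> + h} a - indicator {\<alpha><..\<beta>} a\<bar> * \<bar>F a\<bar>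
          \<le> (indicator {\<alpha><..\<alpha> + h} a + indicator {\<beta><..\<beta> + h} a) * K"
        by (rule mult_mono[OF _ F(2)]) (simp_all add: indicator_def)
      thus ?thesis by (simp only: real_norm_def left_diff_distrib[symmetric] abs_mult distrib_right)
    qed
  qed
  also have "\<dots> = Ioc_integral \<alpha> (\<alpha> + h) (\<lambda>a. K) + Ioc_integral \<beta> (\<beta> + h) (\<lambda>a. K)"
    by (intro Bochner_Integration.integral_add integrable_bounded_Ioc[where K = K]) (use K in auto)
  also have "\<dots> = h * K + h * K" by (simp only: Ioc_const)
  also have "h * K + h * K = 2 * K * h" by (simp add: algebra_simps)
  finally show ?thesis .
qed

text \<open>By Fubini the first integral is the average over y in [0, 1] of the integrals of F
  shifted by r y. Comparing integrals over intervals avoids any statement on pointwise convergence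
  of averages.\<close>

lemma smear_Ioc_integral:
  assumes "\<alpha> \<le> \<beta>" "0 < r"
  shows "\<bar>Ioc_integral \<alpha> \<beta> (smear \<rho> r F) - Ioc_integral \<alpha> \<beta> F\<bar> \<le> 2 * K * r"
proof -
  define J where "J = (\<lambda>y. LBINT a. indicator {\<alpha><..\<beta>} a * F (a + r * y))"
  let ?I = "LBINT a. indicator {\<alpha><..\<beta>} a * F a"
  let ?f = "\<lambda>p. indicator {\<alpha><..\<beta>} (fst p) * (F (fst p + r * snd p) * \<rho> (snd p))"
  have K: "0 \<le> K" using F(2)[of 0] by simp
  have "integrable lborel ?f"
  proof (rule integrable_bounded_support[where B = "1 * (K * B)" and a = "(\<alpha>, 0)" and b = "(\<beta>, 1)"])
    show "borel_fun ?f" using F \<rho> by (simp add: borel_prod[symmetric])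
    show "\<bar>?f p\<bar> \<le> 1 * (K * B)" for p
      unfolding abs_mult using F(2)[of "fst p + r * snd p"] \<rho>(2,3)[of "snd p"] K
      by (intro mult_mono) (auto simp: indicator_def)
    show "?f p = 0" if "p \<notin> cbox (\<alpha>, 0) (\<beta>, 1)" for p
      using that \<rho>(4)[of "snd p"] by (cases p) (auto simp: indicator_def)
  qed
  hence int: "integrable (lborel \<Otimes>\<^sub>M lborel) (\<lambda>(a, y). indicator {\<alpha><..\<beta>} a * (F (a + r * y) * \<rho> y))"
    unfolding case_prod_unfold lborel_prod .
  have "Ioc_integral \<alpha> \<beta> (smear \<rho> r F)
      = (LBINT a. LBINT y. indicator {\<alpha><..\<beta>} a * (F (a + r * y) * \<rho> y))"
    by (simp add: smear_def)
  also have "\<dots> = (LBINT y. LBINT a. indicator {\<alpha><..\<beta>} a * (F (a + r * y) * \<rho> y))"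
    by (rule lborel_pair.Fubini_integral[OF int, symmetric])
  also have "\<dots> = (LBINT y. J y * \<rho> y)" by (simp add: J_def mult.assoc[symmetric])
  finally have eq: "Ioc_integral \<alpha> \<beta> (smear \<rho> r F) = (LBINT y. J y * \<rho> y)" .
  have intJ: "integrable lborel (\<lambda>y. J y * \<rho> y)"
  proof -
    have "integrable lborel (\<lambda>y. LBINT a. indicator {\<alpha><..\<beta>} a * (F (a + r * y) * \<rho> y))"
      using lborel_pair.integrable_snd[OF int] by simp
    thus ?thesis by (simp add: J_def mult.assoc[symmetric])
  qed
  have "(LBINT y. J y * \<rho> y) - ?I = (LBINT y. J y * \<rho> y) - (LBINT y. ?I * \<rho> y)"
    using \<rho>(5) by simp
  also have "\<dots> = (LBINT y. J y * \<rho> y - ?I * \<rho> y)"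
    using intJ kernel_integrable by simp
  finally have "norm ((LBINT y. J y * \<rho> y) - ?I) = norm (LBINT y. J y * \<rho> y - ?I * \<rho> y)"
    by (rule arg_cong)
  also have "\<dots> \<le> (LBINT y. (2 * K * r) * \<rho> y)"
  proof (rule Bochner_Integration.integral_norm_bound_integral)
    show "integrable lborel (\<lambda>y. J y * \<rho> y - ?I * \<rho> y)" "integrable lborel (\<lambda>y. (2 * K * r) * \<rho> y)"
      using intJ kernel_integrable by simp_all
    show "norm (J y * \<rho> y - ?I * \<rho> y) \<le> (2 * K * r) * \<rho> y" for y
    proof (cases "y \<in> {0..1}")
      case True
      have "\<bar>J y - ?I\<bar> \<le> 2 * K * (r * y)" unfolding J_def
        using True assms by (intro Ioc_integral_translate) auto
      also have "\<dots> \<le> 2 * K * (r * 1)" using True assms K by (intro mult_left_mono) auto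
      finally have "\<bar>J y - ?I\<bar> * \<rho> y \<le> (2 * K * r) * \<rho> y" using \<rho>(2) by (intro mult_right_mono) auto
      moreover have "norm (J y * \<rho> y - ?I * \<rho> y) = \<bar>J y - ?I\<bar> * \<rho> y"
        using \<rho>(2)[of y] by (simp add: left_diff_distrib[symmetric] abs_mult)
      ultimately show ?thesis by simp
    qed (use \<rho>(4) in simp)
  qed
  also have "\<dots> = 2 * K * r" using \<rho>(5) by simp
  finally show ?thesis by (simp add: eq)
qed

end


text \<open>G is the limit of the averages of F over (x, x + 2^(-m)]. If F decreases in the sense of
  distributions, these averages decrease in x and increase with m, so they converge at every point
  and the limit is decreasing. Differentiation of integrals almost everywhere is thereby
  avoided.\<close>

lemma antimono_representative:
  fixes F :: "real \<Rightarrow> real" and K :: real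
  assumes F: "borel_fun F" "\<And>x. \<bar>F x\<bar> \<le> K"
    and dec: "\<And>\<psi>. \<psi> \<in> test_functions \<Longrightarrow> (\<And>x. 0 \<le> \<psi> x) \<Longrightarrow> 0 \<le> (LBINT x. F x * deriv \<psi> x)"
  obtains G where "antimono G" "\<And>x. \<bar>G x\<bar> \<le> K" "AE x in lborel. F x = G x"
proof -
  obtain \<rho> S :: "real \<Rightarrow> real" where \<rho>: "continuous_on UNIV \<rho>" "\<And>x. 0 \<le> \<rho> x" "\<And>x. x \<notin> {0..1} \<Longrightarrow> \<rho> x = 0"
    "(LBINT x. \<rho> x) = 1"
    and S: "\<And>x. (S has_real_derivative \<rho> x) (at x)" "\<And>x. x \<le> 0 \<Longrightarrow> S x = 0" "\<And>x. 1 \<le> x \<Longrightarrow> S x = 1"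
    "\<And>n a r. Ck n (\<lambda>x. S ((x - a) / r))"
    by (rule smooth_step, rule that)
  have \<rho>_meas: "borel_fun \<rho>" by (rule borel_measurable_continuous_onI[OF \<rho>(1)])
  have "compact (\<rho> ` {0..1})" by (rule compact_continuous_image[OF continuous_on_subset[OF \<rho>(1) subset_UNIV] compact_Icc])
  then obtain B where B': "\<And>y. y \<in> \<rho> ` {0..1} \<Longrightarrow> \<bar>y\<bar> \<le> B"
    using compact_imp_bounded[of "\<rho> ` {0..1}"] unfolding bounded_iff real_norm_def by blast
  have B: "\<rho> x \<le> B" for x
    using B'[of "\<rho> x"] B'[of "\<rho> 0"] \<rho>(2)[of 0] \<rho>(3)[of x] by (cases "x \<in> {0..1}") auto
  note kernel = \<rho>_meas \<rho>(2) B \<rho>(3,4) F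
  have S_mono: "S x \<le> S y" if "x \<le> y" for x y
    by (rule DERIV_nonneg_imp_nondecreasing[OF that]) (use S(1) \<rho>(2) in blast)
  have smear_affine: "(LBINT x. F x * (\<rho>' ((x - a) / r) * (1 / r))) = smear \<rho>' r F a"
    if "0 < r" for a r and \<rho>' :: "real \<Rightarrow> real"
  proof -
    have "(LBINT x. F x * (\<rho>' ((x - a) / r) * (1 / r)))
        = \<bar>r\<bar> *\<^sub>R (LBINT y. F (a + r * y) * (\<rho>' ((a + r * y - a) / r) * (1 / r)))"
      using that by (intro lborel_integral_real_affine) simp
    also have "\<dots> = (LBINT y. \<bar>r\<bar> * (F (a + r * y) * (\<rho>' ((a + r * y - a) / r) * (1 / r))))" by simp
    also have "\<dots> = smear \<rho>' r F a"
      unfolding smear_def using that by (intro Bochner_Integration.integral_cong) auto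
    finally show ?thesis .
  qed
  have smear_antimono: "smear \<rho> r F b \<le> smear \<rho> r F a" if r: "0 < r" and ab: "a \<le> b" for a b r
  proof -
    let ?k = "\<lambda>e x. F x * (\<rho> ((x - e) / r) * (1 / r))"
    \<comment> \<open>The derivative of this difference of steps is the kernel at a minus the kernel
      at b, so testing with it compares the two averages.\<close>
    define \<psi> where "\<psi> = (\<lambda>x. S ((x - a) / r) - S ((x - b) / r))"
    have D: "(\<psi> has_real_derivative \<rho> ((x - a) / r) * (1 / r) - \<rho> ((x - b) / r) * (1 / r)) (at x)" for x
      unfolding \<psi>_def by (rule DERIV_diff[OF DERIV_chain2[OF S(1) scaled_deriv] DERIV_chain2[OF S(1) scaled_deriv]])
    have pos: "0 \<le> \<psi> x" for x
      unfolding \<psi>_def using S_mono[of "(x - b) / r" "(x - a) / r"] r ab by (simp add: divide_right_mono)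
    have zero: "\<psi> x = 0" if "x \<notin> {a..b + r}" for x
    proof (cases "x < a")
      case True
      hence "(x - a) / r \<le> 0" "(x - b) / r \<le> 0" using r ab by (auto simp: divide_le_0_iff)
      thus ?thesis using S(2) by (simp add: \<psi>_def)
    next
      case False
      hence "1 \<le> (x - a) / r" "1 \<le> (x - b) / r" using r ab that by auto
      thus ?thesis using S(3) by (simp add: \<psi>_def)
    qed
    have "{x. \<psi> x \<noteq> 0} \<subseteq> {a..b + r}" using zero by blast
    hence "closure {x. \<psi> x \<noteq> 0} \<subseteq> {a..b + r}" by (rule closure_minimal) simp
    hence "compact (closure {x. \<psi> x \<noteq> 0})"
      using compact_Int_closed[of "{a..b + r}" "closure {x. \<psi> x \<noteq> 0}"] by (simp add: Int_absorb1)
    moreover have "Ck n \<psi>" for n unfolding \<psi>_def by (intro Ck_diff S(4))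
    ultimately have "\<psi> \<in> test_functions" by (simp add: test_functions_def)
    from dec[OF this pos]
    have "0 \<le> (LBINT x. ?k a x - ?k b x)"
      by (simp only: DERIV_imp_deriv[OF D] right_diff_distrib)
    also have "\<dots> = (LBINT x. ?k a x) - (LBINT x. ?k b x)"
    proof (rule Bochner_Integration.integral_diff)
      have "integrable lborel (?k e)" for e
      proof (rule integrable_bounded_support[where B = "K * (B * (1 / r))" and a = e and b = "e + r"])
        show "borel_fun (?k e)" using F \<rho>_meas by measurable
        have "0 \<le> K" using F(2)[of 0] by simp
        thus "\<bar>?k e x\<bar> \<le> K * (B * (1 / r))" for x
          unfolding abs_mult using F(2)[of x] \<rho>(2)[of "(x - e) / r"] B[of "(x - e) / r"] r
          by (intro mult_mono) auto
        show "?k e x = 0" if "x \<notin> cbox e (e + r)" for x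
        proof -
          have "(x - e) / r \<notin> {0..1}" using that r by (auto simp: field_simps)
          thus ?thesis using \<rho>(3) by simp
        qed
      qed
      thus "integrable lborel (?k a)"
        "integrable lborel (?k b)" by blast+
    qed
    also have "\<dots> = smear \<rho> r F a - smear \<rho> r F b" by (simp only: smear_affine[OF r])
    finally show ?thesis by simp
  qed
  define I where "I = (\<lambda>a \<tau>. LBINT x. indicator {a<..a + \<tau>} x * F x)"
  \<comment> \<open>For smeared functions the comparison holds pointwise and integrates to
    intervals; undoing the smearing costs 2 K r on each side.\<close>
  have I_le: "I b \<tau> \<le> I a \<tau>" if ab: "a \<le> b" and \<tau>: "0 \<le> \<tau>" for a b \<tau>
  proof (rule field_le_epsilon)
    fix e :: real assume e: "0 < e"
    have K: "0 \<le> K" using F(2)[of 0] by simp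
    \<comment> \<open>Makes the two errors of size 2 K r add up to at most e; K + 1 covers the case
      K = 0.\<close>
    define r where "r = e / (4 * (K + 1))"
    have r: "0 < r" using e K by (simp add: r_def)
    have "4 * K * r = e * (K / (K + 1))" using K by (simp add: r_def field_simps)
    also have "\<dots> \<le> e * 1" using K e by (intro mult_left_mono) auto
    finally have small: "4 * K * r \<le> e" by simp
    have sm: "borel_fun (smear \<rho> r F)" "\<bar>smear \<rho> r F x\<bar> \<le> K" for x
      by (rule smear_measurable[OF kernel] smear_bounded[OF kernel]; assumption)+
    have smb: "borel_fun (\<lambda>x. smear \<rho> r F ((b - a) + x))"
      "borel_fun (\<lambda>x. indicator {b<..b + \<tau>} x * smear \<rho> r F x)"
      using sm(1) by measurable
    have "Ioc_integral b (b + \<tau>) (smear \<rho> r F)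
        = (LBINT x. indicator {b<..b + \<tau>} ((b - a) + x) * smear \<rho> r F ((b - a) + x))"
      by (rule integral_translate[OF smb(2), symmetric])
    also have "\<dots> \<le> Ioc_integral a (a + \<tau>) (smear \<rho> r F)"
    proof (rule integral_mono)
      have "integrable lborel (\<lambda>x. indicator {a<..a + \<tau>} x * smear \<rho> r F ((b - a) + x))"
        by (rule integrable_bounded_Ioc[OF smb(1) sm(2)])
      moreover have "(\<lambda>x. indicator {b<..b + \<tau>} ((b - a) + x) * smear \<rho> r F ((b - a) + x))
          = (\<lambda>x. indicator {a<..a + \<tau>} x * smear \<rho> r F ((b - a) + x))"
        by (auto simp: indicator_def fun_eq_iff)
      ultimately show "integrable lborel (\<lambda>x. indicator {b<..b + \<tau>} ((b - a) + x) * smear \<rho> r F ((b - a) + x))" by simp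
      show "integrable lborel (\<lambda>x. indicator {a<..a + \<tau>} x * smear \<rho> r F x)" by (rule integrable_bounded_Ioc[OF sm])
      show "indicator {b<..b + \<tau>} ((b - a) + x) * smear \<rho> r F ((b - a) + x) \<le> indicator {a<..a + \<tau>} x * smear \<rho> r F x" for x
        using smear_antimono[OF r, of x "(b - a) + x"] ab by (auto simp: indicator_def)
    qed
    finally have "Ioc_integral b (b + \<tau>) (smear \<rho> r F) \<le> Ioc_integral a (a + \<tau>) (smear \<rho> r F)" .
    moreover have "\<bar>Ioc_integral e (e + \<tau>) (smear \<rho> r F) - I e \<tau>\<bar> \<le> 2 * K * r" for e
      unfolding I_def by (rule smear_Ioc_integral[OF kernel]) (use \<tau> r in auto)
    from this[of a] this[of b] have "Ioc_integral a (a + \<tau>) (smear \<rho> r F) \<le> I a \<tau> + 2 * K * r"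
      "I b \<tau> \<le> Ioc_integral b (b + \<tau>) (smear \<rho> r F) + 2 * K * r"
      by (simp_all add: abs_le_iff)
    ultimately show "I b \<tau> \<le> I a \<tau> + e" using small by simp
  qed
  \<comment> \<open>With this kernel \<open>smear\<close> is the plain average, and half-open
    intervals split without overlap when they are halved.\<close>
  define \<kappa> where "\<kappa> = (indicator {0<..1} :: real \<Rightarrow> real)"
  have \<kappa>: "borel_fun \<kappa>" "\<And>y. 0 \<le> \<kappa> y" "\<And>y. \<kappa> y \<le> 1" "\<And>y. y \<notin> {0..1} \<Longrightarrow> \<kappa> y = 0"
    "(LBINT y. \<kappa> y) = 1"
  proof -
    show "(LBINT y. \<kappa> y) = 1" by (simp add: \<kappa>_def)
  qed (auto simp: \<kappa>_def indicator_def)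
  note kernel' = \<kappa> F
  define \<eta> where "\<eta> = (\<lambda>m. (1 / 2) ^ m :: real)"
  have \<eta>: "0 < \<eta> m" "\<eta> m = 2 * \<eta> (Suc m)" for m by (auto simp: \<eta>_def)
  have \<eta>0: "\<eta> \<longlonglongrightarrow> 0" unfolding \<eta>_def by (rule LIMSEQ_power_zero) simp
  define Gm where "Gm = (\<lambda>m. smear \<kappa> (\<eta> m) F)"
  have Gm_eq: "Gm m a = I a (\<eta> m) / \<eta> m" for m a
  proof -
    have "indicator {a<..a + \<eta> m} x * F x / \<eta> m = F x * (\<kappa> ((x - a) / \<eta> m) * (1 / \<eta> m))" for x
      using \<eta>(1)[of m] by (auto simp: \<kappa>_def indicator_def field_simps)
    hence "(LBINT x. indicator {a<..a + \<eta> m} x * F x / \<eta> m) = (LBINT x. F x * (\<kappa> ((x - a) / \<eta> m) * (1 / \<eta> m)))"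
      by (simp only:)
    hence "I a (\<eta> m) / \<eta> m = (LBINT x. F x * (\<kappa> ((x - a) / \<eta> m) * (1 / \<eta> m)))"
      unfolding I_def by (simp only: Bochner_Integration.integral_divide_zero)
    thus ?thesis unfolding Gm_def smear_affine[OF \<eta>(1)] by (rule sym)
  qed
  have Gm_antimono: "Gm m y \<le> Gm m x" if "x \<le> y" for m x y
    unfolding Gm_eq using I_le[OF that, of "\<eta> m"] \<eta>(1)[of m] by (intro divide_right_mono) auto
  have Gm_bound: "\<bar>Gm m x\<bar> \<le> K" for m x unfolding Gm_def by (rule smear_bounded[OF kernel']; assumption)
  have Gm_meas: "borel_fun (Gm m)" for m unfolding Gm_def by (rule smear_measurable[OF kernel']; assumption)
  \<comment> \<open>The right half of an interval has the smaller integral, so passing to the left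
    half raises the average.\<close>
  have "incseq (\<lambda>m. Gm m x)" for x
  proof (rule incseq_SucI)
    fix m
    let ?h = "\<eta> (Suc m)"
    have h: "0 < ?h" by (rule \<eta>)
    have "I x (2 * ?h) = (LBINT y. indicator {x<..x + ?h} y * F y + indicator {x + ?h<..x + ?h + ?h} y * F y)"
      unfolding I_def using h by (intro Bochner_Integration.integral_cong) (auto simp: indicator_def)
    also have "\<dots> = I x ?h + I (x + ?h) ?h"
      unfolding I_def by (intro Bochner_Integration.integral_add integrable_bounded_Ioc[OF F])
    also have "\<dots> \<le> 2 * I x ?h" using I_le[of x "x + ?h" ?h] h by simp
    finally have "I x (2 * ?h) / (2 * ?h) \<le> 2 * I x ?h / (2 * ?h)" using h by (intro divide_right_mono) auto
    thus "Gm m x \<le> Gm (Suc m) x" unfolding Gm_eq \<eta>(2)[of m] using h by simp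
  qed
  moreover have "bdd_above (range (\<lambda>m. Gm m x))" for x
    by (rule bdd_aboveI2[where M = K]) (use Gm_bound in \<open>simp add: abs_le_iff\<close>)
  ultimately have "convergent (\<lambda>m. Gm m x)" for x
    by (intro convergentI[OF LIMSEQ_incseq_SUP])
  then obtain G where G: "\<And>x. (\<lambda>m. Gm m x) \<longlonglongrightarrow> G x" unfolding convergent_def by metis
  have G_anti: "antimono G"
  proof (rule antimonoI)
    fix x y :: real assume "x \<le> y"
    thus "G y \<le> G x" using LIMSEQ_le[OF G G] Gm_antimono by blast
  qed
  have G_bound: "\<bar>G x\<bar> \<le> K" for x
    using LIMSEQ_le_const2[OF tendsto_rabs[OF G]] Gm_bound by blast
  have "AE x in lborel. F x = G x"
  proof (rule AE_eq_from_Ioc_integrals[OF F measurable_antimono[OF G_anti] G_bound])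
    fix a b :: real assume ab: "a \<le> b"
    \<comment> \<open>One sequence, two limits: dominated convergence leads to the integral of G,
      and the rate 2 K \<eta> of \<open>smear_Ioc_integral\<close> to that of F.\<close>
    have "(\<lambda>m. LBINT x. indicator {a<..b} x * Gm m x) \<longlonglongrightarrow> Ioc_integral a b G"
    proof (rule integral_tendsto_bounded_support[where B = K and a = a and b = b])
      show "\<bar>indicator {a<..b} x * Gm m x\<bar> \<le> K" for m x
        using Gm_bound[of m x] F(2)[of x] by (auto simp: indicator_def)
      show "AE x in lborel. (\<lambda>m. indicator {a<..b} x * Gm m x) \<longlonglongrightarrow> indicator {a<..b} x * G x"
        by (intro AE_I2 tendsto_intros G)
    qed (use Gm_meas measurable_antimono[OF G_anti] in \<open>auto simp: indicator_def\<close>)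
    moreover have "(\<lambda>m. LBINT x. indicator {a<..b} x * Gm m x) \<longlonglongrightarrow> Ioc_integral a b F"
    proof (rule LIM_zero_cancel, rule Lim_null_comparison)
      show "\<forall>\<^sub>F m in sequentially. norm (Ioc_integral a b (Gm m) - Ioc_integral a b F) \<le> 2 * K * \<eta> m"
        unfolding Gm_def real_norm_def by (intro always_eventually allI smear_Ioc_integral[OF kernel' ab \<eta>(1)])
      show "(\<lambda>m. 2 * K * \<eta> m) \<longlonglongrightarrow> 0" using tendsto_mult_right_zero[OF \<eta>0] .
    qed
    ultimately show "Ioc_integral a b F = Ioc_integral a b G"
      by (intro LIMSEQ_unique)
  qed
  thus thesis using that G_anti G_bound by blast
qed


subsection \<open>The wave equation\<close>

lemma test_function_real_deriv:
  fixes \<psi> :: "real \<Rightarrow> real"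
  assumes "\<psi> \<in> test_functions"
  shows "(\<psi> has_real_derivative deriv \<psi> x) (at x)" and "deriv \<psi> \<in> test_functions"
proof -
  let ?D = "\<lambda>x. frechet_derivative \<psi> (at x)"
  have D: "(\<psi> has_real_derivative ?D x 1) (at x)" for x
  proof -
    have lin: "linear (?D x)" using test_function_deriv(1)[OF assms] by (rule has_derivative_linear)
    have "?D x = (*) (?D x 1)"
    proof
      fix h show "?D x h = ?D x 1 * h" using linear_scale[OF lin, of h 1] by (simp add: mult.commute)
    qed
    thus ?thesis using test_function_deriv(1)[OF assms, of x] by (simp only: has_field_derivative_def)
  qed
  have eq: "deriv \<psi> = (\<lambda>x. ?D x 1)" using DERIV_imp_deriv[OF D] by blast
  show "(\<psi> has_real_derivative deriv \<psi> x) (at x)" unfolding eq by (rule D)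
  show "deriv \<psi> \<in> test_functions" unfolding eq by (rule test_function_deriv(2)[OF assms])
qed

text \<open>Used to find sequences tending to infinity along which almost everywhere identities hold
  exactly.\<close>

lemma AE_lborel_Ex_interval:
  assumes "AE x in lborel. P (x :: real)" "a < b"
  shows "\<exists>y. a < y \<and> y < b \<and> P y"
proof (rule ccontr)
  assume no: "\<not> ?thesis"
  obtain N where N: "{x \<in> space lborel. \<not> P x} \<subseteq> N" "emeasure lborel N = 0" "N \<in> sets lborel"
    using assms(1) by (rule AE_E)
  have "{a<..<b} \<subseteq> N" using no N(1) by auto
  hence "emeasure lborel {a<..<b} \<le> emeasure lborel N" using N(3) by (rule emeasure_mono)
  thus False using N(2) assms(2) by simp
qed

text \<open>The data of the wave equation are only Lebesgue measurable; this replaces them by Borel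
  representatives, as Fubini arguments require.\<close>

lemma lebesgue_integral_AE_borel:
  fixes f f' \<psi> :: "real \<Rightarrow> real"
  assumes "f \<in> borel_measurable lebesgue" "borel_fun f'" "AE x in lborel. f x = f' x"
    and "borel_fun \<psi>"
  shows "(LINT x|lebesgue. f x * \<psi> x) = (LBINT x. f' x * \<psi> x)"
proof -
  have m: "\<psi> \<in> borel_measurable lebesgue" "f' \<in> borel_measurable lebesgue"
    using assms(2,4) by (simp_all add: measurable_completion)
  have "AE x in lebesgue. f x = f' x" using assms(3) by (rule AE_completion)
  hence "AE x in lebesgue. f x * \<psi> x = f' x * \<psi> x" by eventually_elim simp
  hence "(LINT x|lebesgue. f x * \<psi> x) = (LINT x|lebesgue. f' x * \<psi> x)"
    using assms(1) m by (intro integral_cong_AE borel_measurable_times)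
  also have "\<dots> = (LBINT x. f' x * \<psi> x)"
    using assms(2,4) by (intro integral_completion) simp
  finally show ?thesis .
qed

section \<open>Primitives of integrable functions\<close>

definition primitive :: "(real \<Rightarrow> real) \<Rightarrow> real \<Rightarrow> real" where
  "primitive f x = (LBINT y. indicator {..x} y * f y)"

context
  fixes f :: "real \<Rightarrow> real"
  assumes f: "integrable lborel f"
begin

lemma primitive_integrand: "integrable lborel (\<lambda>y. indicator {..x} y * f y)"
  using integrable_mult_indicator[OF _ f, of "{..x}"] by simp

lemma primitive_bound: "\<bar>primitive f x\<bar> \<le> (LBINT y. \<bar>f y\<bar>)"
proof -
  have "norm (primitive f x) \<le> (LBINT y. \<bar>f y\<bar>)" unfolding primitive_def
    by (rule Bochner_Integration.integral_norm_bound_integral[OF primitive_integrand])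
       (use f in \<open>auto simp: indicator_def\<close>)
  thus ?thesis by simp
qed

lemma primitive_measurable: "borel_fun (primitive f)"
proof -
  have fm: "borel_fun f" using f by simp
  have "(\<lambda>p. (if snd p \<le> fst p then 1 else 0) * f (snd p)) \<in> borel_measurable (borel \<Otimes>\<^sub>M borel)"
    using fm by measurable
  hence "(\<lambda>(x, y). indicator {..x} y * f y) \<in> borel_measurable (borel \<Otimes>\<^sub>M lborel)"
    by (simp add: case_prod_unfold indicator_def of_bool_def cong: measurable_cong_sets)
  from lborel.borel_measurable_lebesgue_integral[OF this]
  show ?thesis unfolding primitive_def[abs_def] by simp
qed

lemma primitive_tendsto:
  fixes y :: "nat \<Rightarrow> real"
  shows "filterlim y at_top sequentially \<Longrightarrow> (\<lambda>n. primitive f (y n)) \<longlonglongrightarrow> (LBINT x. f x)"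
    and "filterlim y at_bot sequentially \<Longrightarrow> (\<lambda>n. primitive f (y n)) \<longlonglongrightarrow> 0"
proof -
  have dom: "(\<lambda>n. primitive f (y n)) \<longlonglongrightarrow> (LBINT x. g x)"
    if "\<And>x. (\<lambda>n. indicator {..y n} x * f x) \<longlonglongrightarrow> g x" "borel_fun g" for g
    unfolding primitive_def
    by (rule integral_dominated_convergence[where w = "\<lambda>x. \<bar>f x\<bar>"])
       (use f that in \<open>auto simp: indicator_def\<close>)
  show "(\<lambda>n. primitive f (y n)) \<longlonglongrightarrow> (LBINT x. f x)" if y: "filterlim y at_top sequentially"
  proof (rule dom)
    fix x
    have "\<forall>\<^sub>F n in sequentially. x \<le> y n" using y by (simp add: filterlim_at_top)
    hence "\<forall>\<^sub>F n in sequentially. indicator {..y n} x * f x = f x" by eventually_elim simp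
    thus "(\<lambda>n. indicator {..y n} x * f x) \<longlonglongrightarrow> f x" by (rule tendsto_eventually)
  qed (use f in simp)
  show "(\<lambda>n. primitive f (y n)) \<longlonglongrightarrow> 0" if y: "filterlim y at_bot sequentially"
  proof -
    have "(\<lambda>n. primitive f (y n)) \<longlonglongrightarrow> (LINT x::real|lborel. (0::real))"
    proof (rule dom)
      fix x :: real
      have "\<forall>\<^sub>F n in sequentially. y n \<le> x - 1" using y by (simp add: filterlim_at_bot)
      hence "\<forall>\<^sub>F n in sequentially. indicator {..y n} x * f x = 0" by eventually_elim simp
      thus "(\<lambda>n. indicator {..y n} x * f x) \<longlonglongrightarrow> 0" by (rule tendsto_eventually)
    qed simp
    thus ?thesis by simp
  qed
qed

text \<open>Fubini on the triangle y \<le> x, since \<open>primitive f\<close> need not be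
  differentiable for integrable f. Integrability follows by comparison with the product of \<psi>'
  and f, and the inner integral of \<psi>' from y onwards is - \<psi> y.\<close>

lemma primitive_by_parts:
  fixes \<psi> \<psi>' :: "real \<Rightarrow> real"
  assumes D: "\<And>x. (\<psi> has_real_derivative \<psi>' x) (at x)" and cont: "continuous_on UNIV \<psi>'"
    and bound: "\<And>x. \<bar>\<psi>' x\<bar> \<le> B" and zero: "\<And>x. R < \<bar>x\<bar> \<Longrightarrow> \<psi> x = 0" "\<And>x. R < \<bar>x\<bar> \<Longrightarrow> \<psi>' x = 0"
  shows "(LBINT x. primitive f x * \<psi>' x) = - (LBINT x. f x * \<psi> x)"
proof -
  have fm: "borel_fun f" using f by simp
  have \<psi>m: "borel_fun \<psi>'" by (rule borel_measurable_continuous_onI[OF cont])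
  have int\<psi>: "integrable lborel \<psi>'"
    by (rule integrable_bounded_support[OF \<psi>m bound, of "- R" R]) (use zero(2) in auto)
  define k where "k = (\<lambda>x y. indicator {..x} y * f y * \<psi>' x)"
  have g: "integrable (lborel \<Otimes>\<^sub>M lborel) (\<lambda>(x, y). \<psi>' x * f y)"
  proof (rule lborel_pair.Fubini_integrable)
    show "(\<lambda>(x, y). \<psi>' x * f y) \<in> borel_measurable (lborel \<Otimes>\<^sub>M lborel)" using fm \<psi>m by measurable
    have "(\<lambda>x. LBINT y. norm (case (x, y) of (x, y) \<Rightarrow> \<psi>' x * f y)) = (\<lambda>x. \<bar>\<psi>' x\<bar> * (LBINT y. \<bar>f y\<bar>))"
      by (simp add: abs_mult)
    thus "integrable lborel (\<lambda>x. LBINT y. norm (case (x, y) of (x, y) \<Rightarrow> \<psi>' x * f y))" using int\<psi> by simp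
    show "AE x in lborel. integrable lborel (\<lambda>y. case (x, y) of (x, y) \<Rightarrow> \<psi>' x * f y)" using f by simp
  qed
  have k: "integrable (lborel \<Otimes>\<^sub>M lborel) (\<lambda>(x, y). k x y)"
  proof (rule Bochner_Integration.integrable_bound[OF g])
    have "(\<lambda>p. (if snd p \<le> fst p then 1 else 0) * f (snd p) * \<psi>' (fst p)) \<in> borel_measurable (lborel \<Otimes>\<^sub>M lborel)"
      using fm \<psi>m by measurable
    thus "(\<lambda>(x, y). k x y) \<in> borel_measurable (lborel \<Otimes>\<^sub>M lborel)"
      by (simp add: case_prod_unfold k_def indicator_def of_bool_def)
    show "AE p in lborel \<Otimes>\<^sub>M lborel. norm (case p of (x, y) \<Rightarrow> k x y) \<le> norm (case p of (x, y) \<Rightarrow> \<psi>' x * f y)"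
      by (intro AE_I2) (auto simp: k_def indicator_def abs_mult)
  qed
  have inner: "(LBINT x. k x y) = - (f y * \<psi> y)" for y
  proof -
    define T where "T = max y R + 1"
    have T: "y \<le> T" "R < T" by (auto simp: T_def)
    have "(LBINT x. indicator {y..T} x *\<^sub>R \<psi>' x) = \<psi> T - \<psi> y"
      by (rule integral_FTC_atLeastAtMost[OF T(1)])
         (use D cont in \<open>auto simp: has_real_derivative_iff_has_vector_derivative[symmetric]
            intro: has_field_derivative_at_within continuous_on_subset\<close>)
    moreover have "\<psi> T = 0" using zero(1)[of T] T(2) by simp
    moreover have "k x y = f y * (indicator {y..T} x *\<^sub>R \<psi>' x)" for x
      using zero(2)[of x] T by (cases "x \<le> T") (auto simp: k_def indicator_def)
    ultimately show ?thesis by simp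
  qed
  have "(LBINT x. primitive f x * \<psi>' x) = (LBINT x. LBINT y. k x y)"
    by (simp add: primitive_def k_def)
  also have "\<dots> = (LBINT y. LBINT x. k x y)"
    by (rule lborel_pair.Fubini_integral[OF k, symmetric])
  also have "\<dots> = - (LBINT x. f x * \<psi> x)" unfolding inner by simp
  finally show ?thesis .
qed

end

lemma integrable_bounded_test:
  fixes F :: "real \<times> real \<Rightarrow> real"
  assumes "borel_fun F" "\<And>p. \<bar>F p\<bar> \<le> K" "\<phi> \<in> test_functions"
  shows "integrable lborel (\<lambda>p. F p * \<phi> p)"
proof -
  obtain B R where BR: "0 \<le> B" "\<And>p. \<bar>\<phi> p\<bar> \<le> B" "\<And>p. R < norm p \<Longrightarrow> \<phi> p = 0"
    using test_function_bounded_support[OF assms(3)] by metis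
  show ?thesis
    by (rule integrable_mult_bounded_support[OF assms(1,2) test_function_measurable[OF assms(3)] BR(2,3)])
qed

lemma half_plane_integral_add:
  fixes f g :: "real \<times> real \<Rightarrow> real"
  assumes "integrable lborel f" "integrable lborel g"
  shows "(LINT p|half_plane. f p + g p) = (LINT p|half_plane. f p) + (LINT p|half_plane. g p)"
proof -
  have m: "borel_fun f" "borel_fun g" using assms by simp_all
  have i: "integrable lborel (\<lambda>p. indicator {0<..} (snd p) * k p)" if "integrable lborel k" for k :: "real \<times> real \<Rightarrow> real"
  proof (rule Bochner_Integration.integrable_bound[OF that])
    have "borel_fun k" using that by simp
    thus "(\<lambda>p. indicator {0<..} (snd p) * k p) \<in> borel_measurable lborel" by (simp add: borel_prod[symmetric])
  qed (auto simp: indicator_def)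
  have "(LINT p|half_plane. f p + g p) = (LBINT p. indicator {0<..} (snd p) * (f p + g p))"
    using m by (intro half_plane_integral) measurable
  also have "\<dots> = (LBINT p. indicator {0<..} (snd p) * f p + indicator {0<..} (snd p) * g p)"
    by (simp only: distrib_left)
  also have "\<dots> = (LBINT p. indicator {0<..} (snd p) * f p) + (LBINT p. indicator {0<..} (snd p) * g p)"
    by (rule Bochner_Integration.integral_add[OF i[OF assms(1)] i[OF assms(2)]])
  finally show ?thesis by (simp only: half_plane_integral[OF m(1)] half_plane_integral[OF m(2)])
qed

text \<open>The system tested with \<open>\<partial>\<^sub>t \<phi>\<close> and \<open>\<partial>\<^sub>x \<phi>\<close>: the terms with \<open>u\<close> cancel.\<close>

lemma wave_from_system:
  assumes v: "borel_fun v" "\<And>p. \<bar>v p\<bar> \<le> K" and u: "borel_fun u" "\<And>p. \<bar>u p\<bar> \<le> K"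
    and s: "1 < s" and sys: "generalized_solution_system c s v0 u0 v u"
    and initial: "\<And>\<phi>. \<phi> \<in> test_functions \<Longrightarrow>
      (LINT x|lebesgue. v0' x * dt \<phi> (x, 0) - v1 x * \<phi> (x, 0))
        = (LINT x|lebesgue. v0 x * dt \<phi> (x, 0)) + (LINT x|lebesgue. u0 x * dx \<phi> (x, 0))"
  shows "generalized_solution_wave c s v0' v1 v"
  unfolding generalized_solution_wave_def
proof (intro conjI ballI)
  show "v \<in> L_infinity half_plane" using sys by (simp add: generalized_solution_system_def)
  fix \<phi> :: "real \<times> real \<Rightarrow> real" assume \<phi>: "\<phi> \<in> test_functions"
  define P where "P = (\<lambda>p. c * \<bar>v p\<bar> powr (s - 1) * v p)"
  have P_meas: "borel_fun P" unfolding P_def using v(1) by measurable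
  have P_bound: "\<bar>P p\<bar> \<le> \<bar>c\<bar> * K powr (s - 1) * K" for p
  proof -
    have "\<bar>v p\<bar> powr (s - 1) \<le> K powr (s - 1)" using v(2)[of p] s by (intro powr_mono2) auto
    thus ?thesis unfolding P_def abs_mult using v(2)[of p] by (intro mult_mono) auto
  qed
  note d1 = test_function_partial_derivatives(3,4)[OF \<phi>]
  note d2 = test_function_partial_derivatives(3,4)[OF d1(1)] test_function_partial_derivatives(3,4)[OF d1(2)]
  let ?f = "\<lambda>p. v p * dt (dt \<phi>) p - u p * dx (dt \<phi>) p" and ?g = "\<lambda>p. u p * dt (dx \<phi>) p - P p * dx (dx \<phi>) p"
  have "\<forall>\<phi>1\<in>test_functions. \<forall>\<phi>2\<in>test_functions.
      (LINT p|half_plane. v p * dt \<phi>1 p - u p * dx \<phi>1 p) + (LINT x|lebesgue. v0 x * \<phi>1 (x, 0)) = 0 \<and>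
      (LINT p|half_plane. u p * dt \<phi>2 p - P p * dx \<phi>2 p) + (LINT x|lebesgue. u0 x * \<phi>2 (x, 0)) = 0"
    using sys unfolding generalized_solution_system_def P_def by blast
  from this[rule_format, OF d1(2) d1(1)]
  have eqs: "(LINT p|half_plane. ?f p) + (LINT x|lebesgue. v0 x * dt \<phi> (x, 0)) = 0"
    "(LINT p|half_plane. ?g p) + (LINT x|lebesgue. u0 x * dx \<phi> (x, 0)) = 0" by blast+
  have "(LINT p|half_plane. ?f p + ?g p) = (LINT p|half_plane. ?f p) + (LINT p|half_plane. ?g p)"
    by (intro half_plane_integral_add Bochner_Integration.integrable_diff
        integrable_bounded_test[OF v] integrable_bounded_test[OF u] integrable_bounded_test[OF P_meas P_bound] d2)
  moreover have "(\<lambda>p. ?f p + ?g p) = (\<lambda>p. v p * dt (dt \<phi>) p - P p * dx (dx \<phi>) p)"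
    by (simp add: mixed_partial_derivatives[OF \<phi>])
  ultimately have "(LINT p|half_plane. v p * dt (dt \<phi>) p - P p * dx (dx \<phi>) p)
      = (LINT p|half_plane. ?f p) + (LINT p|half_plane. ?g p)" by (simp only:)
  thus "(LINT p|half_plane. v p * dt (dt \<phi>) p - c * \<bar>v p\<bar> powr (s - 1) * v p * dx (dx \<phi>) p)
      + (LINT x|lebesgue. v0' x * dt \<phi> (x, 0) - v1 x * \<phi> (x, 0)) = 0"
    using eqs initial[OF \<phi>] by (simp add: P_def)
qed


context
  fixes s \<theta> c :: real
  assumes s: "s > 1" and \<theta>: "\<theta> = (s + 1) / 2" and c: "c = \<theta>\<^sup>2 / s"
begin

text \<open>U + v0^\<theta> and U - v0^\<theta> are decreasing only after a change on a null set, so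
  the system is solved for data rebuilt from the representatives \<open>Z\<close> and
  \<open>W\<close>. The separating constant c0 is - Lminus, the limit of \<open>W\<close> at -oo,
  since the primitive vanishes there.\<close>

lemma wave_solution:
  fixes v0 v1 :: "real \<Rightarrow> real" and Lplus Lminus :: real
  assumes v0: "v0 \<in> borel_measurable lebesgue" "bounded (range v0)" "\<And>x. 0 \<le> v0 x"
    and v1: "integrable lebesgue v1"
    and lim: "((\<lambda>x. v0 x powr \<theta>) \<longlongrightarrow> Lplus) at_top" "((\<lambda>x. v0 x powr \<theta>) \<longlongrightarrow> Lminus) at_bot"
    and mass: "0 \<le> (LINT x|lebesgue. v1 x) + Lplus + Lminus"
    and dec: "distr_nonpos (\<lambda>\<psi>. distr_of v1 \<psi> + distr_deriv (distr_of (\<lambda>x. v0 x powr \<theta>)) \<psi>)"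
      "distr_nonpos (\<lambda>\<psi>. distr_of v1 \<psi> - distr_deriv (distr_of (\<lambda>x. v0 x powr \<theta>)) \<psi>)"
  shows "\<exists>v. generalized_solution_wave c s v0 v1 v"
proof -
  have \<theta>_pos: "0 < \<theta>" using s \<theta> by simp
  define a where "a = (\<lambda>x. v0 x powr \<theta>)"
  obtain B where B: "\<And>x. \<bar>v0 x\<bar> \<le> B" using v0(2) unfolding bounded_iff real_norm_def by blast
  define A where "A = B powr \<theta>"
  have aA: "0 \<le> a x" "a x \<le> A" for x
    using powr_mono2[of \<theta> "v0 x" B] \<theta>_pos v0(3)[of x] B[of x] by (auto simp: a_def A_def)
  have a_meas: "a \<in> borel_measurable lebesgue" unfolding a_def using v0(1) by measurable
  obtain b0 where b0: "b0 \<in> borel_measurable lborel" "AE x in lborel. a x = b0 x"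
    using completion_ex_borel_measurable_real[OF a_meas] by blast
  \<comment> \<open>The Borel representative may leave [0, A] on a null set; clipping restores the
    bounds at every point without affecting the almost everywhere identity.\<close>
  define b where "b = (\<lambda>x. max 0 (min A (b0 x)))"
  have b: "borel_fun b" "AE x in lborel. a x = b x"
  proof -
    show "borel_fun b" unfolding b_def using b0(1) by simp
    show "AE x in lborel. a x = b x" using b0(2)
    proof eventually_elim
      case (elim x)
      thus ?case using aA[of x] by (simp add: b_def)
    qed
  qed
  have A0: "0 \<le> A" using aA[of 0] by simp
  hence bA: "0 \<le> b x" "b x \<le> A" for x by (auto simp: b_def)
  have v1_meas: "v1 \<in> borel_measurable lebesgue" using v1 by simp
  obtain f where f0: "f \<in> borel_measurable lborel" "AE x in lborel. v1 x = f x"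
    using completion_ex_borel_measurable_real[OF v1_meas] by blast
  have fm: "borel_fun f" "f \<in> borel_measurable lebesgue" using f0(1) by (simp_all add: measurable_completion)
  have f_leb: "integrable lebesgue f"
    using v1 integrable_cong_AE[OF v1_meas fm(2) AE_completion[OF f0(2)]] by simp
  have f: "integrable lborel f" using f_leb integrable_completion[of f lborel] f0(1) by simp
  have f_int: "(LINT x|lebesgue. v1 x) = (LBINT x. f x)"
    using lebesgue_integral_AE_borel[OF v1_meas fm(1) f0(2), of "\<lambda>_. 1"] by simp
  define U where "U = primitive f"
  define K where "K = (LBINT y. \<bar>f y\<bar>) + A"
  have U: "borel_fun U" "\<bar>U x\<bar> \<le> (LBINT y. \<bar>f y\<bar>)" for x
    unfolding U_def by (rule primitive_measurable[OF f], rule primitive_bound[OF f])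
  have I0: "0 \<le> (LBINT y. \<bar>f y\<bar>)" by simp
  have FK: "\<bar>U x + b x\<bar> \<le> K" "\<bar>U x - b x\<bar> \<le> K" for x
    using U(2)[of x] bA[of x] unfolding K_def by linarith+
  have Fm: "borel_fun (\<lambda>x. U x + b x)" "borel_fun (\<lambda>x. U x - b x)"
    using U(1) b(1) by measurable
  have tests: "0 \<le> (LBINT x. (U x + b x) * deriv \<psi> x)" "0 \<le> (LBINT x. (U x - b x) * deriv \<psi> x)"
    if \<psi>: "\<psi> \<in> test_functions" "\<And>x. 0 \<le> \<psi> x" for \<psi> :: "real \<Rightarrow> real"
  proof -
    note D = test_function_real_deriv[OF \<psi>(1)]
    have m: "borel_fun \<psi>" "borel_fun (deriv \<psi>)"
      using test_function_continuous[OF \<psi>(1)] test_function_continuous[OF D(2)] borel_measurable_continuous_onI by auto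
    obtain B0 R0 where BR0: "\<And>x. R0 < norm x \<Longrightarrow> \<psi> x = 0" using test_function_bounded_support[OF \<psi>(1)] by metis
    obtain B1 R1 where BR1: "\<And>x. \<bar>deriv \<psi> x\<bar> \<le> B1" "\<And>x. R1 < norm x \<Longrightarrow> deriv \<psi> x = 0"
      using test_function_bounded_support[OF D(2)] by metis
    have parts: "(LBINT x. U x * deriv \<psi> x) = - (LBINT x. f x * \<psi> x)" unfolding U_def
      by (rule primitive_by_parts[OF f D(1) test_function_continuous[OF D(2)] BR1(1), of "max R0 R1"])
         (use BR0 BR1(2) in auto)
    have int: "integrable lborel (\<lambda>x. F x * deriv \<psi> x)" if F: "borel_fun F" "\<And>x. \<bar>F x\<bar> \<le> C" for F C
      by (rule integrable_mult_bounded_support[OF F m(2) BR1])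
    have bA': "\<bar>b x\<bar> \<le> A" for x using bA[of x] by simp
    have sum: "(LBINT x. (U x + b x) * deriv \<psi> x) = - (LBINT x. f x * \<psi> x) + (LBINT x. b x * deriv \<psi> x)"
      "(LBINT x. (U x - b x) * deriv \<psi> x) = - (LBINT x. f x * \<psi> x) - (LBINT x. b x * deriv \<psi> x)"
      unfolding parts[symmetric] distrib_right left_diff_distrib
      by (rule Bochner_Integration.integral_add[OF int[OF U] int[OF b(1) bA']]
               Bochner_Integration.integral_diff[OF int[OF U] int[OF b(1) bA']])+
    have conv: "distr_of v1 \<psi> = (LBINT x. f x * \<psi> x)"
      "distr_deriv (distr_of (\<lambda>x. v0 x powr \<theta>)) \<psi> = - (LBINT x. b x * deriv \<psi> x)"
      unfolding distr_of_def distr_deriv_def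
      using lebesgue_integral_AE_borel[OF v1_meas fm(1) f0(2) m(1)] lebesgue_integral_AE_borel[OF a_meas b m(2)]
      by (simp_all add: a_def)
    have "distr_of v1 \<psi> + distr_deriv (distr_of (\<lambda>x. v0 x powr \<theta>)) \<psi> \<le> 0"
      "distr_of v1 \<psi> - distr_deriv (distr_of (\<lambda>x. v0 x powr \<theta>)) \<psi> \<le> 0"
      using dec \<psi> unfolding distr_nonpos_def by blast+
    thus "0 \<le> (LBINT x. (U x + b x) * deriv \<psi> x)" "0 \<le> (LBINT x. (U x - b x) * deriv \<psi> x)"
      unfolding sum conv by linarith+
  qed
  obtain Z where Z: "antimono Z" "\<And>x. \<bar>Z x\<bar> \<le> K" "AE x in lborel. U x + b x = Z x"
    by (rule antimono_representative[OF Fm(1) FK(1) tests(1)]; assumption?) blast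
  obtain W where W: "antimono W" "\<And>x. \<bar>W x\<bar> \<le> K" "AE x in lborel. U x - b x = W x"
    by (rule antimono_representative[OF Fm(2) FK(2) tests(2)]; assumption?) blast
  \<comment> \<open>A decreasing function is bounded by its limit at -oo. \<open>W\<close> agrees
    with U - a only almost everywhere, so that limit is computed along points where the identity
    holds.\<close>
  have W_le: "W x \<le> - Lminus" for x
  proof -
    have ae: "AE y in lborel. a y = b y \<and> U y - b y = W y" using b(2) W(3) by eventually_elim simp
    have "\<forall>n. \<exists>y. x - real n - 1 < y \<and> y < x - real n \<and> a y = b y \<and> U y - b y = W y"
      by (intro allI AE_lborel_Ex_interval[OF ae]) simp
    from choice[OF this] obtain y where y: "\<And>n. y n < x - real n" "\<And>n. a (y n) = b (y n)" "\<And>n. U (y n) - b (y n) = W (y n)" by blast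
    have yb: "filterlim y at_bot sequentially" unfolding filterlim_at_bot
    proof
      fix C :: real
      obtain N :: nat where N: "x - C < real N" using reals_Archimedean2 by blast
      show "\<forall>\<^sub>F n in sequentially. y n \<le> C"
      proof (rule eventually_sequentiallyI)
        fix n assume "N \<le> n"
        hence "real N \<le> real n" by simp
        thus "y n \<le> C" using y(1)[of n] N by linarith
      qed
    qed
    have "(\<lambda>n. U (y n) - a (y n)) \<longlonglongrightarrow> 0 - Lminus"
      unfolding U_def a_def by (intro tendsto_diff primitive_tendsto(2)[OF f yb] filterlim_compose[OF lim(2) yb])
    moreover have "W x \<le> U (y n) - a (y n)" for n
    proof -
      have "W x \<le> W (y n)" using W(1) y(1)[of n] by (auto simp: antimono_def)
      thus ?thesis using y(2,3)[of n] by simp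
    qed
    ultimately have "W x \<le> 0 - Lminus" by (intro LIMSEQ_le_const) auto
    thus ?thesis by simp
  qed
  \<comment> \<open>The limit of \<open>Z\<close> at +oo is a lower bound and equals the integral of
    v1 plus \<open>Lplus\<close>; the mass condition says that this is at least - Lminus.\<close>
  have Z_ge: "- Lminus \<le> Z x" for x
  proof -
    have ae: "AE y in lborel. a y = b y \<and> U y + b y = Z y" using b(2) Z(3) by eventually_elim simp
    have "\<forall>n. \<exists>y. x + real n < y \<and> y < x + real n + 1 \<and> a y = b y \<and> U y + b y = Z y"
      by (intro allI AE_lborel_Ex_interval[OF ae]) simp
    from choice[OF this] obtain y where y: "\<And>n. x + real n < y n" "\<And>n. a (y n) = b (y n)" "\<And>n. U (y n) + b (y n) = Z (y n)" by blast
    have "filterlim (\<lambda>n. x + real n) at_top sequentially"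
      by (rule filterlim_tendsto_add_at_top[OF tendsto_const filterlim_real_sequentially])
    hence yt: "filterlim y at_top sequentially"
      by (rule filterlim_at_top_mono) (use y(1) in \<open>auto intro!: always_eventually less_imp_le\<close>)
    have "(\<lambda>n. U (y n) + a (y n)) \<longlonglongrightarrow> (LBINT x. f x) + Lplus"
      unfolding U_def a_def by (intro tendsto_add primitive_tendsto(1)[OF f yt] filterlim_compose[OF lim(1) yt])
    moreover have "U (y n) + a (y n) \<le> Z x" for n
    proof -
      have "x \<le> y n" using y(1)[of n] by linarith
      hence "Z (y n) \<le> Z x" using Z(1) by (auto simp: antimono_def)
      thus ?thesis using y(2,3)[of n] by simp
    qed
    ultimately have "(LBINT x. f x) + Lplus \<le> Z x" by (intro LIMSEQ_le_const2) auto
    thus ?thesis using mass by (simp add: f_int)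
  qed
  obtain v u Kv where vu: "borel_fun v" "borel_fun u" "\<And>p. \<bar>v p\<bar> \<le> Kv" "\<And>p. \<bar>u p\<bar> \<le> Kv"
    "generalized_solution_system c s (\<lambda>x. ((Z x - W x) / 2) powr (1 / \<theta>)) (\<lambda>x. (Z x + W x) / 2) v u"
  proof (rule system_solution[OF s \<theta> c Z(1) W(1), of "- K" "- Lminus" K])
    show "- K \<le> W x \<and> W x \<le> - Lminus \<and> - Lminus \<le> Z x \<and> Z x \<le> K" for x
      using W_le[of x] Z_ge[of x] W(2)[of x] Z(2)[of x] by (simp add: abs_le_iff)
  qed (rule that)
  have Zm: "borel_fun Z" and Wm: "borel_fun W"
    using measurable_antimono Z(1) W(1) by auto
  have "generalized_solution_wave c s v0 v1 v"
  proof (rule wave_from_system[OF vu(1,3,2,4) s vu(5)])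
    fix \<phi> :: "real \<times> real \<Rightarrow> real" assume \<phi>: "\<phi> \<in> test_functions"
    note D = test_function_partial_derivatives[OF \<phi>]
    have slice_cont: "continuous_on UNIV (\<lambda>x. \<zeta> (x, 0::real))" if "\<zeta> \<in> test_functions" for \<zeta> :: "real \<times> real \<Rightarrow> real"
      by (rule continuous_on_compose2[OF test_function_continuous[OF that]]) (auto intro!: continuous_intros)
    hence slice: "borel_fun (\<lambda>x. \<zeta> (x, 0::real))" if "\<zeta> \<in> test_functions" for \<zeta> :: "real \<times> real \<Rightarrow> real"
      using that borel_measurable_continuous_onI by blast
    obtain B0 R0 where BR0: "\<And>p. \<bar>\<phi> p\<bar> \<le> B0" "\<And>p. R0 < norm p \<Longrightarrow> \<phi> p = 0" using test_function_bounded_support[OF \<phi>] by metis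
    obtain B1 R1 where BR1: "\<And>p. \<bar>dx \<phi> p\<bar> \<le> B1" "\<And>p. R1 < norm p \<Longrightarrow> dx \<phi> p = 0"
      using test_function_bounded_support[OF D(3)] by metis
    obtain B2 R2 where BR2: "\<And>p. \<bar>dt \<phi> p\<bar> \<le> B2" "\<And>p. R2 < norm p \<Longrightarrow> dt \<phi> p = 0"
      using test_function_bounded_support[OF D(4)] by metis
    define V where "V = (\<lambda>x. ((Z x - W x) / 2) powr (1 / \<theta>))"
    have Vm: "borel_fun V" unfolding V_def using Zm Wm by measurable
    \<comment> \<open>The \<theta>-th power is inverted using v0 \<ge> 0. Equality holds almost
      everywhere only, which is why \<open>wave_from_system\<close> compares the initial integrals
      and not the initial functions.\<close>
    have V: "AE x in lborel. v0 x = V x" using Z(3) W(3) b(2)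
    proof eventually_elim
      case (elim x)
      hence "(Z x - W x) / 2 = v0 x powr \<theta>" by (simp add: a_def)
      thus ?case using \<theta>_pos v0(3)[of x] by (simp add: V_def powr_powr)
    qed
    have Ueq: "AE x in lborel. U x = (Z x + W x) / 2" using Z(3) W(3) by eventually_elim simp
    have Vleb: "V \<in> borel_measurable lebesgue" using Vm by (simp add: measurable_completion)
    have i1: "integrable lebesgue (\<lambda>x. v0 x * dt \<phi> (x, 0))"
    proof (rule integrableI_bounded_set[where A = "{- R2..R2}" and B = "B * B2"])
      show "(\<lambda>x. v0 x * dt \<phi> (x, 0)) \<in> borel_measurable lebesgue"
        using v0(1) slice[OF D(4)] by (intro borel_measurable_times) (simp_all add: measurable_completion)
      have "0 \<le> B" using B[of 0] by simp
      thus "AE x in lebesgue. x \<in> {- R2..R2} \<longrightarrow> norm (v0 x * dt \<phi> (x, 0)) \<le> B * B2"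
        unfolding real_norm_def abs_mult using B BR2(1) by (intro AE_I2 impI mult_mono) auto
      have "dt \<phi> (x, 0) = 0" if "x \<notin> {- R2..R2}" for x
        using BR2(2)[of "(x, 0)"] norm_fst_le[of x "0::real"] that by auto
      thus "AE x in lebesgue. x \<notin> {- R2..R2} \<longrightarrow> v0 x * dt \<phi> (x, 0) = 0" by (intro AE_I2) auto
    qed (use emeasure_compact_finite[OF compact_Icc, of "- R2" R2] in auto)
    have i2: "integrable lebesgue (\<lambda>x. v1 x * \<phi> (x, 0))"
    proof (rule Bochner_Integration.integrable_bound[where f = "\<lambda>x. B0 * v1 x"])
      show "integrable lebesgue (\<lambda>x. B0 * v1 x)" using v1 by simp
      show "(\<lambda>x. v1 x * \<phi> (x, 0)) \<in> borel_measurable lebesgue"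
        using v1_meas slice[OF \<phi>] by (intro borel_measurable_times) (simp_all add: measurable_completion)
      have "\<bar>v1 x\<bar> * \<bar>\<phi> (x, 0)\<bar> \<le> \<bar>B0\<bar> * \<bar>v1 x\<bar>" for x
        using mult_right_mono[OF order.trans[OF BR0(1)[of "(x, 0)"] abs_ge_self], of "\<bar>v1 x\<bar>"] by (simp add: mult.commute)
      thus "AE x in lebesgue. norm (v1 x * \<phi> (x, 0)) \<le> norm (B0 * v1 x)" by (intro AE_I2) (simp add: abs_mult)
    qed
    have parts: "(LBINT x. U x * dx \<phi> (x, 0)) = - (LBINT x. f x * \<phi> (x, 0))" unfolding U_def
    proof (rule primitive_by_parts[OF f D(1) slice_cont[OF D(3)] BR1(1), of "max R0 R1"])
      fix x assume x: "max R0 R1 < \<bar>x\<bar>"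
      hence "max R0 R1 < norm (x, 0::real)" using norm_fst_le[of x "0::real"] by simp
      thus "\<phi> (x, 0) = 0" "dx \<phi> (x, 0) = 0" using BR0(2) BR1(2) by auto
    qed
    have "(LINT x|lebesgue. v0 x * dt \<phi> (x, 0) - v1 x * \<phi> (x, 0))
        = (LINT x|lebesgue. v0 x * dt \<phi> (x, 0)) - (LINT x|lebesgue. v1 x * \<phi> (x, 0))"
      by (rule Bochner_Integration.integral_diff[OF i1 i2])
    also have "(LINT x|lebesgue. v0 x * dt \<phi> (x, 0)) = (LBINT x. V x * dt \<phi> (x, 0))"
      by (rule lebesgue_integral_AE_borel[OF v0(1) Vm V slice[OF D(4)]])
    also have "(LBINT x. V x * dt \<phi> (x, 0)) = (LINT x|lebesgue. V x * dt \<phi> (x, 0))"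
      by (rule lebesgue_integral_AE_borel[OF Vleb Vm AE_I2 slice[OF D(4)], symmetric]) simp
    also have "(LINT x|lebesgue. v1 x * \<phi> (x, 0)) = (LBINT x. f x * \<phi> (x, 0))"
      by (rule lebesgue_integral_AE_borel[OF v1_meas fm(1) f0(2) slice[OF \<phi>]])
    also have "(LBINT x. f x * \<phi> (x, 0)) = - (LBINT x. U x * dx \<phi> (x, 0))" using parts by simp
    also have "(LBINT x. U x * dx \<phi> (x, 0)) = (LINT x|lebesgue. (Z x + W x) / 2 * dx \<phi> (x, 0))"
    proof (rule lebesgue_integral_AE_borel[OF _ U(1) _ slice[OF D(3)], symmetric])
      have "borel_fun (\<lambda>x. (Z x + W x) / 2)" using Zm Wm by measurable
      thus "(\<lambda>x. (Z x + W x) / 2) \<in> borel_measurable lebesgue" by (simp add: measurable_completion)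
      show "AE x in lborel. (Z x + W x) / 2 = U x" using Ueq by eventually_elim simp
    qed
    finally show "(LINT x|lebesgue. v0 x * dt \<phi> (x, 0) - v1 x * \<phi> (x, 0))
        = (LINT x|lebesgue. ((Z x - W x) / 2) powr (1 / \<theta>) * dt \<phi> (x, 0))
          + (LINT x|lebesgue. (Z x + W x) / 2 * dx \<phi> (x, 0))"
      by (simp add: V_def)
  qed
  thus ?thesis by blast
qed

end

theorem theorem1:
  fixes s \<theta> c :: real
  assumes "s > 1" and "\<theta> = (s + 1) / 2" and "c = \<theta>\<^sup>2 / s"
  shows
    "(\<forall>(u0 :: real \<Rightarrow> real) (v0 :: real \<Rightarrow> real) (w0 :: real \<Rightarrow> real) (z0 :: real \<Rightarrow> real)
        (c1 :: real) (c0 :: real) (c2 :: real).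
        bounded (range u0) \<and> bounded (range v0) \<and> (\<forall>x. 0 \<le> v0 x) \<and>
        w0 = (\<lambda>x. u0 x - v0 x powr \<theta>) \<and> z0 = (\<lambda>x. u0 x + v0 x powr \<theta>) \<and>
        antimono z0 \<and> antimono w0 \<and>
        (\<forall>x. c1 \<le> w0 x \<and> w0 x \<le> c0 \<and> c0 \<le> z0 x \<and> z0 x \<le> c2) \<longrightarrow>
        (\<exists>v u. generalized_solution_system c s v0 u0 v u))
     \<and>
     (\<forall>(v0 :: real \<Rightarrow> real) (v1 :: real \<Rightarrow> real) (Lplus :: real) (Lminus :: real).
        v0 \<in> borel_measurable lebesgue \<and> bounded (range v0) \<and> (\<forall>x. 0 \<le> v0 x) \<and>
        integrable lebesgue v1 \<and>
        ((\<lambda>x. v0 x powr \<theta>) \<longlongrightarrow> Lplus) at_top \<and>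
        ((\<lambda>x. v0 x powr \<theta>) \<longlongrightarrow> Lminus) at_bot \<and>
        (LINT x|lebesgue. v1 x) + Lplus + Lminus \<ge> 0 \<and>
        distr_nonpos (\<lambda>\<psi>. distr_of v1 \<psi> + distr_deriv (distr_of (\<lambda>x. v0 x powr \<theta>)) \<psi>) \<and>
        distr_nonpos (\<lambda>\<psi>. distr_of v1 \<psi> - distr_deriv (distr_of (\<lambda>x. v0 x powr \<theta>)) \<psi>) \<longrightarrow>
        (\<exists>v. generalized_solution_wave c s v0 v1 v))"
proof (intro conjI allI impI, goal_cases)
  case A: (1 u0 v0 w0 z0 c1 c0 c2)
  obtain v u K where "generalized_solution_system c s (\<lambda>x. ((z0 x - w0 x) / 2) powr (1 / \<theta>)) (\<lambda>x. (z0 x + w0 x) / 2) v u"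
    by (rule system_solution[OF assms, of z0 w0 c1 c0 c2]) (use A in auto)
  \<comment> \<open>\<open>system_solution\<close> expresses the initial data through the Riemann
    invariants; since v0 \<ge> 0 they determine v0 and u0 at every point.\<close>
  moreover have "(\<lambda>x. ((z0 x - w0 x) / 2) powr (1 / \<theta>)) = v0"
  proof
    fix x
    have "0 \<le> v0 x" and eq: "(z0 x - w0 x) / 2 = v0 x powr \<theta>" using A by auto
    moreover have "\<theta> * (1 / \<theta>) = 1" using assms(1,2) by simp
    ultimately show "((z0 x - w0 x) / 2) powr (1 / \<theta>) = v0 x" unfolding eq powr_powr by simp
  qed
  moreover have "(\<lambda>x. (z0 x + w0 x) / 2) = u0" using A by auto
  ultimately show ?case by auto
next
  case A: (2 v0 v1 Lplus Lminus)
  show ?case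
    by (rule wave_solution[OF assms]; use A in blast)
qed

end
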